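(* Let $\Delta$ be a finite flag complex with vertex set $V(\Delta)$ and let $G:=G_\Delta$ be the associated right-angled Artin group. Then: (i) The untwisted $G'$-fibre product of $G\times G$ is finitely presented if and only if $G$ is abelian. (ii) Let $n=|V(\Delta)|$. Then there is some twisted finitely presented $G'$-fibre product in $G\times G$ if and only if $n\leq 2|S|$ for any $S\in\mathcal{S}$.
   Context: $G_\Delta$ is the group generated by the vertices of $\Delta$ subject to the relations that two vertices commute whenever they are joined by an edge of $\Delta$. $\mathcal{S}$ is the set of subsets $S\subseteq V(\Delta)$ such that the subcomplex of $\Delta$ obtained by removing the vertices in $S$ is disconnected and $S$ is minimal (with respect to inclusion) with that property. $G'$ denotes the commutator subgroup of $G$. A (twisted) $G'$-fibre product in $G\times G$ is a subgroup of the form $H_\mu=\{(g_1,g_2)\in G\times G\mid \mu(g_1G')=g_2G'\}$ where $\mu:G/G'\to G/G'$ is any automorphism; the untwisted one is the case $\mu=\mathrm{id}$. *)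

theory Defs
  imports "HOL-Algebra.Generated_Groups"
begin

section \<open>Flag complexes\<close>

text \<open>The empty set is not counted as a simplex.\<close>

definition simplicial_complex :: "'v set set \<Rightarrow> bool" where
  "simplicial_complex K \<longleftrightarrow>
     (\<forall>\<sigma>\<in>K. finite \<sigma> \<and> \<sigma> \<noteq> {}) \<and>
     (\<forall>\<sigma>\<in>K. \<forall>\<tau>. \<tau> \<subseteq> \<sigma> \<and> \<tau> \<noteq> {} \<longrightarrow> \<tau> \<in> K)"

definition vertices :: "'v set set \<Rightarrow> 'v set" where
  "vertices K = {v. {v} \<in> K}"

definition flag_complex :: "'v set set \<Rightarrow> bool" where
  "flag_complex K \<longleftrightarrow> simplicial_complex K \<and>
     (\<forall>\<sigma>. finite \<sigma> \<and> \<sigma> \<noteq> {} \<and> \<sigma> \<subseteq> vertices K \<and>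
          (\<forall>u\<in>\<sigma>. \<forall>v\<in>\<sigma>. u \<noteq> v \<longrightarrow> {u, v} \<in> K) \<longrightarrow> \<sigma> \<in> K)"

definition remove_vertices :: "'v set set \<Rightarrow> 'v set \<Rightarrow> 'v set set" where
  "remove_vertices K S = {\<sigma> \<in> K. \<sigma> \<inter> S = {}}"

text \<open>
  Connectedness is edge-path connectedness. The empty complex counts as connected. The
  opposite convention changes the minimal separating sets only if any two vertices are joined
  by an edge; then it would make the set of all vertices the only one instead of there being none.
\<close>

definition complex_connected :: "'v set set \<Rightarrow> bool" where
  "complex_connected K \<longleftrightarrow>
     (\<forall>u\<in>vertices K. \<forall>v\<in>vertices K. (u, v) \<in> {(x, y). {x, y} \<in> K}\<^sup>*)"

definition minimal_separators :: "'v set set \<Rightarrow> 'v set set" where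
  "minimal_separators K =
     {S. S \<subseteq> vertices K \<and> \<not> complex_connected (remove_vertices K S) \<and>
         (\<forall>T. T \<subset> S \<longrightarrow> complex_connected (remove_vertices K T))}"


section \<open>Group presentations\<close>

text \<open>A letter is a generator (\<open>True\<close>) or the formal inverse of a generator (\<open>False\<close>).\<close>

type_synonym 'a word = "('a \<times> bool) list"

abbreviation words :: "'a set \<Rightarrow> 'a word set" where
  "words X \<equiv> lists (X \<times> UNIV)"

definition trivial_relators :: "'a set \<Rightarrow> 'a word set" where
  "trivial_relators X = {[(x, b), (x, \<not> b)] | x b. x \<in> X}"

text \<open>
  Two words represent the same element of \<open>\<langle>X | R\<rangle>\<close> iff they are connected by finitely
  many insertions and deletions of relators from \<open>R\<close> and of subwords \<open>x x\<^sup>-\<^sup>1\<close>, \<open>x\<^sup>-\<^sup>1 x\<close>.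
\<close>

definition insertion :: "'a set \<Rightarrow> 'a word set \<Rightarrow> ('a word \<times> 'a word) set" where
  "insertion X R = {(u @ v, u @ r @ v) | u r v.
     u \<in> words X \<and> v \<in> words X \<and> r \<in> R \<union> trivial_relators X}"

definition presentation_rel :: "'a set \<Rightarrow> 'a word set \<Rightarrow> ('a word \<times> 'a word) set" where
  "presentation_rel X R =
     (insertion X R \<union> (insertion X R)\<inverse>)\<^sup>* \<inter> words X \<times> words X"

definition presented_group :: "'a set \<Rightarrow> 'a word set \<Rightarrow> 'a word set monoid" where
  "presented_group X R =
     \<lparr>carrier = words X // presentation_rel X R,
      mult = (\<lambda>A B. presentation_rel X R `` {a @ b | a b. a \<in> A \<and> b \<in> B}),
      one = presentation_rel X R `` {[]}\<rparr>"

text \<open>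
  Since only finitely many generators are allowed, taking them from \<open>nat\<close> is no restriction.
\<close>

definition finitely_presented :: "('g, 'm) monoid_scheme \<Rightarrow> bool" where
  "finitely_presented G \<longleftrightarrow>
     (\<exists>(X :: nat set) R. finite X \<and> finite R \<and> R \<subseteq> words X \<and> G \<cong> presented_group X R)"


section \<open>Right-angled Artin groups\<close>

definition commutator_word :: "'v \<Rightarrow> 'v \<Rightarrow> 'v word" where
  "commutator_word u v = [(u, True), (v, True), (u, False), (v, False)]"

definition raag :: "'v set set \<Rightarrow> 'v word set monoid" where
  "raag K = presented_group (vertices K)
     {commutator_word u v | u v. u \<noteq> v \<and> {u, v} \<in> K}"


section \<open>Fibre products over the abelianisation\<close>

abbreviation commutator_subgroup :: "('g, 'm) monoid_scheme \<Rightarrow> 'g set" where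
  "commutator_subgroup G \<equiv> derived G (carrier G)"

abbreviation abelianisation :: "('g, 'm) monoid_scheme \<Rightarrow> 'g set monoid" where
  "abelianisation G \<equiv> G Mod commutator_subgroup G"

text \<open>
  As in the library's quotient groups, the coset of \<open>g\<close> is written as a right coset.
\<close>

definition fibre_product ::
    "('g, 'm) monoid_scheme \<Rightarrow> ('g set \<Rightarrow> 'g set) \<Rightarrow> ('g \<times> 'g) monoid" where
  "fibre_product G \<mu> = (G \<times>\<times> G)\<lparr>carrier :=
     {(g, h). g \<in> carrier G \<and> h \<in> carrier G \<and>
        \<mu> (commutator_subgroup G #>\<^bsub>G\<^esub> g) = commutator_subgroup G #>\<^bsub>G\<^esub> h}\<rparr>"


section \<open>Well-definedness\<close>

lemma equiv_presentation_rel: "equiv (words X) (presentation_rel X R)"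
proof (rule equivI)
  let ?s = "insertion X R \<union> (insertion X R)\<inverse>"
  have "sym (?s\<^sup>*)" by (intro sym_rtrancl) (auto simp: sym_def)
  then show "sym (presentation_rel X R)"
    by (auto simp: presentation_rel_def sym_def)
  show "refl_on (words X) (presentation_rel X R)"
    by (auto simp: presentation_rel_def refl_on_def)
  show "trans (presentation_rel X R)"
    by (auto simp: presentation_rel_def trans_def intro: rtrancl_trans)
qed (auto simp: presentation_rel_def)

lemma insertion_context:
  assumes "(a, b) \<in> insertion X R" "p \<in> words X" "q \<in> words X"
  shows "(p @ a @ q, p @ b @ q) \<in> insertion X R"
proof -
  obtain u r v where *: "a = u @ v" "b = u @ r @ v" "u \<in> words X" "v \<in> words X"
      "r \<in> R \<union> trivial_relators X"
    using assms(1) unfolding insertion_def by blast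
  have "p @ a @ q = (p @ u) @ (v @ q)" "p @ b @ q = (p @ u) @ r @ (v @ q)"
    using * by auto
  moreover have "p @ u \<in> words X" "v @ q \<in> words X" using * assms by auto
  ultimately show ?thesis using *(5) unfolding insertion_def by blast
qed

lemma presentation_rel_context:
  assumes "(a, b) \<in> presentation_rel X R" "p \<in> words X" "q \<in> words X"
  shows "(p @ a @ q, p @ b @ q) \<in> presentation_rel X R"
proof -
  have "(p @ a @ q, p @ b @ q) \<in> (insertion X R \<union> (insertion X R)\<inverse>)\<^sup>*"
    if "(a, b) \<in> (insertion X R \<union> (insertion X R)\<inverse>)\<^sup>*" for a b
    using that
  proof (induction rule: rtrancl_induct)
    case (step y z)
    then have "(p @ y @ q, p @ z @ q) \<in> insertion X R \<union> (insertion X R)\<inverse>"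
      using insertion_context assms(2,3) by blast
    with step.IH show ?case by (rule rtrancl_into_rtrancl)
  qed simp
  then show ?thesis using assms by (auto simp: presentation_rel_def)
qed

lemma presentation_rel_append:
  assumes "(a, a') \<in> presentation_rel X R" "(b, b') \<in> presentation_rel X R"
  shows "(a @ b, a' @ b') \<in> presentation_rel X R"
proof -
  have w: "b \<in> words X" "a' \<in> words X" using assms by (auto simp: presentation_rel_def)
  have "(a @ b, a' @ b) \<in> presentation_rel X R"
    using presentation_rel_context[OF assms(1), of "[]" b] w by simp
  moreover have "(a' @ b, a' @ b') \<in> presentation_rel X R"
    using presentation_rel_context[OF assms(2), of a' "[]"] w by simp
  ultimately show ?thesis
    using equiv_presentation_rel[of X R] by (meson equiv_def transD)
qed

lemma carrier_presented_group:
  "carrier (presented_group X R) = (\<lambda>a. presentation_rel X R `` {a}) ` words X"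
  by (auto simp: presented_group_def quotient_def)

lemma mult_presented_group:
  assumes "a \<in> words X" "b \<in> words X"
  shows "presentation_rel X R `` {a} \<otimes>\<^bsub>presented_group X R\<^esub> presentation_rel X R `` {b}
    = presentation_rel X R `` {a @ b}" (is "?l = ?r")
proof -
  note eq = equiv_presentation_rel[of X R]
  have self: "(a, a) \<in> presentation_rel X R" "(b, b) \<in> presentation_rel X R"
    using assms eq by (auto simp: equiv_def refl_on_def)
  have tr: "trans (presentation_rel X R)" using eq by (simp add: equiv_def)
  have l: "?l = presentation_rel X R ``
      {a' @ b' | a' b'. (a, a') \<in> presentation_rel X R \<and> (b, b') \<in> presentation_rel X R}"
    by (simp add: presented_group_def)
  show ?thesis
  proof
    show "?l \<subseteq> ?r"
    proof
      fix c assume "c \<in> ?l"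
      then obtain a' b' where "(a, a') \<in> presentation_rel X R" "(b, b') \<in> presentation_rel X R"
          "(a' @ b', c) \<in> presentation_rel X R"
        unfolding l by blast
      then show "c \<in> ?r" using presentation_rel_append transD[OF tr] by blast
    qed
    show "?r \<subseteq> ?l"
      unfolding l using self by blast
  qed
qed

definition inverse_word :: "'a word \<Rightarrow> 'a word" where
  "inverse_word w = rev (map (\<lambda>(x, b). (x, \<not> b)) w)"

lemma inverse_word_in_words: "w \<in> words X \<Longrightarrow> inverse_word w \<in> words X"
  by (induction w) (auto simp: inverse_word_def)

lemma inverse_word_left:
  assumes "w \<in> words X"
  shows "(inverse_word w @ w, []) \<in> presentation_rel X R"
  using assms
proof (induction w rule: list.induct)
  case Nil
  then show ?case by (simp add: inverse_word_def presentation_rel_def)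
next
  case (Cons l w)
  obtain x b where l: "l = (x, b)" by force
  have w: "w \<in> words X" "x \<in> X" using Cons.prems l by simp_all
  note iw = inverse_word_in_words[OF w(1)]
  have "[(x, \<not> b), (x, \<not> \<not> b)] \<in> trivial_relators X"
    using w(2) unfolding trivial_relators_def by blast
  then have "\<exists>u r v. (inverse_word w @ w, inverse_word w @ [(x, \<not> b), (x, b)] @ w)
      = (u @ v, u @ r @ v) \<and> u \<in> words X \<and> v \<in> words X \<and> r \<in> R \<union> trivial_relators X"
    using w iw
    by (intro exI[of _ "inverse_word w"] exI[of _ "[(x, \<not> b), (x, b)]"] exI[of _ w]) simp
  then have "(inverse_word w @ w, inverse_word w @ [(x, \<not> b), (x, b)] @ w) \<in> insertion X R"
    unfolding insertion_def by blast
  then have "(inverse_word w @ [(x, \<not> b), (x, b)] @ w, inverse_word w @ w)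
      \<in> presentation_rel X R"
    using w iw unfolding presentation_rel_def by auto
  moreover have "inverse_word (l # w) @ l # w = inverse_word w @ [(x, \<not> b), (x, b)] @ w"
    by (simp add: inverse_word_def l)
  ultimately show ?case
    using Cons.IH[OF w(1)] equiv_presentation_rel[of X R] by (metis equiv_def transD)
qed

lemma group_presented_group: "group (presented_group X R)"
proof (rule groupI)
  let ?G = "presented_group X R" and ?c = "\<lambda>a. presentation_rel X R `` {a}"
  have one: "\<one>\<^bsub>?G\<^esub> = ?c []" by (simp add: presented_group_def)
  show "\<one>\<^bsub>?G\<^esub> \<in> carrier ?G" unfolding one carrier_presented_group by blast
  have rep: "\<exists>a. a \<in> words X \<and> x = ?c a" if "x \<in> carrier ?G" for x
    using that unfolding carrier_presented_group by blast
  have app: "a @ b \<in> words X" if "a \<in> words X" "b \<in> words X" for a b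
    using that by simp
  have Nil: "[] \<in> words X" by simp
  show "x \<otimes>\<^bsub>?G\<^esub> y \<in> carrier ?G" if "x \<in> carrier ?G" "y \<in> carrier ?G" for x y
  proof -
    obtain a b where ab: "a \<in> words X" "b \<in> words X" "x = ?c a" "y = ?c b"
      using rep[OF \<open>x \<in> carrier ?G\<close>] rep[OF \<open>y \<in> carrier ?G\<close>] by blast
    show ?thesis
      unfolding ab(3,4) mult_presented_group[OF ab(1,2)] carrier_presented_group
      using app[OF ab(1,2)] by (rule imageI)
  qed
  show "x \<otimes>\<^bsub>?G\<^esub> y \<otimes>\<^bsub>?G\<^esub> z = x \<otimes>\<^bsub>?G\<^esub> (y \<otimes>\<^bsub>?G\<^esub> z)"
    if "x \<in> carrier ?G" "y \<in> carrier ?G" "z \<in> carrier ?G" for x y z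
  proof -
    obtain a b d where w: "a \<in> words X" "b \<in> words X" "d \<in> words X"
        "x = ?c a" "y = ?c b" "z = ?c d"
      using rep[OF \<open>x \<in> carrier ?G\<close>] rep[OF \<open>y \<in> carrier ?G\<close>]
        rep[OF \<open>z \<in> carrier ?G\<close>] by blast
    show ?thesis
      unfolding w(4-6) mult_presented_group[OF w(1,2)] mult_presented_group[OF w(2,3)]
        mult_presented_group[OF app[OF w(1,2)] w(3)] mult_presented_group[OF w(1) app[OF w(2,3)]]
      by (simp only: append_assoc)
  qed
  show "\<one>\<^bsub>?G\<^esub> \<otimes>\<^bsub>?G\<^esub> x = x" if "x \<in> carrier ?G" for x
  proof -
    obtain a where a: "a \<in> words X" "x = ?c a" using rep[OF \<open>x \<in> carrier ?G\<close>] by blast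
    show ?thesis unfolding one a(2) mult_presented_group[OF Nil a(1)] append_Nil ..
  qed
  show "\<exists>y\<in>carrier ?G. y \<otimes>\<^bsub>?G\<^esub> x = \<one>\<^bsub>?G\<^esub>" if "x \<in> carrier ?G" for x
  proof -
    obtain w where w: "w \<in> words X" "x = ?c w"
      using rep[OF \<open>x \<in> carrier ?G\<close>] by blast
    note iw = inverse_word_in_words[OF w(1)]
    have "?c (inverse_word w) \<otimes>\<^bsub>?G\<^esub> x = ?c (inverse_word w @ w)"
      unfolding w(2) by (rule mult_presented_group[OF iw w(1)])
    also have "\<dots> = ?c []"
      by (rule equiv_class_eq[OF equiv_presentation_rel inverse_word_left[OF w(1)]])
    finally show ?thesis using iw unfolding one carrier_presented_group by blast
  qed
qed

lemma group_raag: "group (raag K)"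
  by (simp add: raag_def group_presented_group)

lemma subgroup_fibre_product:
  assumes "group G" "\<mu> \<in> iso (abelianisation G) (abelianisation G)"
  shows "subgroup (carrier (fibre_product G \<mu>)) (G \<times>\<times> G)"
proof -
  interpret group G by fact
  let ?D = "commutator_subgroup G"
  interpret D: normal ?D G by (rule derived_self_is_normal)
  interpret Q: group "abelianisation G" by (rule D.factorgroup_is_group)
  interpret P: group "G \<times>\<times> G" by (rule DirProd_group) (fact assms(1))+
  let ?q = "\<lambda>g. ?D #>\<^bsub>G\<^esub> g"
  have q: "group_hom G (abelianisation G) ?q"
    using D.r_coset_hom_Mod by (simp add: group_hom_def group_hom_axioms_def is_group Q.is_group)
  have m: "group_hom (abelianisation G) (abelianisation G) \<mu>"
    using assms(2) by (simp add: group_hom_def group_hom_axioms_def Q.is_group iso_def)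
  interpret q: group_hom G "abelianisation G" ?q by (rule q)
  interpret m: group_hom "abelianisation G" "abelianisation G" \<mu> by (rule m)
  show ?thesis
  proof (rule P.subgroupI)
    show "carrier (fibre_product G \<mu>) \<subseteq> carrier (G \<times>\<times> G)"
      by (auto simp: fibre_product_def DirProd_def)
    have "(\<one>\<^bsub>G\<^esub>, \<one>\<^bsub>G\<^esub>) \<in> carrier (fibre_product G \<mu>)"
      using m.hom_one q.hom_one by (simp add: fibre_product_def)
    then show "carrier (fibre_product G \<mu>) \<noteq> {}" by blast
  next
    fix a assume a: "a \<in> carrier (fibre_product G \<mu>)"
    then obtain g h where gh: "a = (g, h)" "g \<in> carrier G" "h \<in> carrier G" "\<mu> (?q g) = ?q h"
      by (auto simp: fibre_product_def)
    have "\<mu> (?q (inv\<^bsub>G\<^esub> g)) = ?q (inv\<^bsub>G\<^esub> h)"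
      using gh(2-4) m.hom_inv[OF q.hom_closed[OF gh(2)]] q.hom_inv by simp
    then show "inv\<^bsub>G \<times>\<times> G\<^esub> a \<in> carrier (fibre_product G \<mu>)"
      using gh by (simp add: inv_DirProd[OF is_group is_group] fibre_product_def)
  next
    fix a b assume ab: "a \<in> carrier (fibre_product G \<mu>)" "b \<in> carrier (fibre_product G \<mu>)"
    obtain g h where gh: "a = (g, h)" "g \<in> carrier G" "h \<in> carrier G" "\<mu> (?q g) = ?q h"
      using ab(1) by (auto simp: fibre_product_def)
    obtain g' h' where gh': "b = (g', h')" "g' \<in> carrier G" "h' \<in> carrier G" "\<mu> (?q g') = ?q h'"
      using ab(2) by (auto simp: fibre_product_def)
    have "\<mu> (?q (g \<otimes>\<^bsub>G\<^esub> g')) = ?q (h \<otimes>\<^bsub>G\<^esub> h')"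
      using gh(2-4) gh'(2-4) q.hom_mult m.hom_mult[OF q.hom_closed[OF gh(2)] q.hom_closed[OF gh'(2)]]
      by metis
    then show "a \<otimes>\<^bsub>G \<times>\<times> G\<^esub> b \<in> carrier (fibre_product G \<mu>)"
      using gh gh' by (simp add: fibre_product_def)
  qed
qed

end

theory Submission
  imports Defs Complex_Main "HOL-Algebra.FiniteProduct" "HOL-Library.Countable_Set"
    "HOL-Library.Function_Algebras"
begin

text \<open>
  Let \<open>\<chi>\<close> be a nonzero integral character of \<open>G\<close> that vanishes on a separating set of vertices.
  There is a derivation of \<open>G\<close> into the rationals, on which \<open>g\<close> acts through \<open>2\<close> to the power \<open>\<chi> g\<close>,
  that does not vanish on \<open>G'\<close>. If \<open>\<chi> g = \<chi>' h\<close> on the fibre product for two such characters, then the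
  product of the derivations belonging to \<open>\<chi>\<close> and to \<open>- \<chi>'\<close> is a cocycle of the fibre product, and in
  the corresponding central extension the commutators of commuting elements have unbounded
  denominators. Over a finite presentation this is impossible. For \<open>\<mu> = id\<close> one takes \<open>\<chi> = \<chi>'\<close>; if
  \<open>2 * card S < n\<close>, then \<open>\<chi>'\<close> exists for every \<open>\<mu>\<close>, being subject to only \<open>2 * card S\<close> linear conditions.

  Conversely, let \<open>\<mu>\<close> be a matrix of binomial coefficients all of whose minors are nonzero. The fibre
  product is the kernel of a homomorphism from \<open>G \<times> G\<close> to the lattice of rank \<open>n\<close>. The edges of the
  lattice inside a large ball, labelled by the generators of \<open>G \<times> G\<close>, and the commuting squares inside
  that ball present a group \<open>Q\<close>. The tautological labelling by \<open>Q\<close> extends to the whole lattice, one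
  point at a time in the order of the norm: if \<open>n \<le> 2 * card S\<close> for all minimal separators, then at a
  point outside the ball the generators pointing towards the origin span a simply connected complex.
  Reading off labels makes the fibre product a retract of the finitely presented group \<open>Q\<close>.
\<close>

section \<open>Homomorphisms out of presented groups\<close>

text \<open>The bound \<open>2 * card S\<close> is a count of generators. At a lattice point
  \<open>z\<close>, call a generator of either factor weak if its vector is nearly orthogonal to
  \<open>z\<close>. Nonzero minors leave fewer than \<open>n\<close> weak ones in the two factors
  together. So one factor has fewer than \<open>n / 2\<close>, and by hypothesis deleting those does
  not disconnect the complex; the other factor still has a generator that is not weak. A generator
  that is not weak, with the right sign, lowers the norm even after a bounded detour, provided that
  \<open>z\<close> is far from the origin: hence the ball. Generators of different factors commute,
  so the descending complex is a join of two pieces, one nonempty and one connected, hence simply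
  connected.

  The obstacle is that \<open>Q\<close> need not be the fibre product, and its kernel over it stays
  unknown. A retract suffices: finitely many extra relators collapse \<open>Q\<close> onto it.
  Abelian \<open>G\<close>, which covers fewer than two vertices, is settled by the identity
  automorphism.\<close>

primrec word_value :: "('g, 'm) monoid_scheme \<Rightarrow> ('a \<Rightarrow> 'g) \<Rightarrow> 'a word \<Rightarrow> 'g" where
  "word_value H f [] = \<one>\<^bsub>H\<^esub>"
| "word_value H f (l # w) =
     (if snd l then f (fst l) else inv\<^bsub>H\<^esub> f (fst l)) \<otimes>\<^bsub>H\<^esub> word_value H f w"

abbreviation word_class :: "'a set \<Rightarrow> 'a word set \<Rightarrow> 'a word \<Rightarrow> 'a word set" where
  "word_class X R w \<equiv> presentation_rel X R `` {w}"

text \<open>Evaluates an arbitrary representative; the choice is immaterial once every relator has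
  value one.\<close>

definition lift_presented :: "('g, 'm) monoid_scheme \<Rightarrow> ('a \<Rightarrow> 'g) \<Rightarrow> 'a word set \<Rightarrow> 'g" where
  "lift_presented H f C = word_value H f (SOME w. w \<in> C)"

context group
begin

lemma word_value_closed [simp]:
  "\<lbrakk>f \<in> X \<rightarrow> carrier G; w \<in> words X\<rbrakk> \<Longrightarrow> word_value G f w \<in> carrier G"
  by (induction w) (auto simp: Pi_iff)

lemma word_value_append:
  "\<lbrakk>f \<in> X \<rightarrow> carrier G; u \<in> words X; w \<in> words X\<rbrakk> \<Longrightarrow>
    word_value G f (u @ w) = word_value G f u \<otimes> word_value G f w"
proof (induction u)
  case (Cons l u)
  then have "f (fst l) \<in> carrier G" by auto
  with Cons word_value_closed[OF Cons.prems(1)] show ?case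
    by (auto simp: m_assoc)
qed simp

lemma word_value_cong:
  "\<lbrakk>w \<in> words X; \<And>x. x \<in> X \<Longrightarrow> f x = g x\<rbrakk> \<Longrightarrow> word_value G f w = word_value G g w"
  by (induction w) auto

lemma word_value_trivial_relator:
  "\<lbrakk>f \<in> X \<rightarrow> carrier G; r \<in> trivial_relators X\<rbrakk> \<Longrightarrow> word_value G f r = \<one>"
  by (auto simp: trivial_relators_def Pi_iff)

lemma word_value_insertion:
  assumes f: "f \<in> X \<rightarrow> carrier G" and R: "R \<subseteq> words X" "\<forall>r\<in>R. word_value G f r = \<one>"
    and ins: "(a, b) \<in> insertion X R"
  shows "word_value G f a = word_value G f b"
proof -
  obtain u r v where *: "a = u @ v" "b = u @ r @ v" "u \<in> words X" "v \<in> words X"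
      "r \<in> R \<union> trivial_relators X"
    using ins unfolding insertion_def by blast
  have "r \<in> words X" using * R(1) by (auto simp: trivial_relators_def)
  moreover have "word_value G f r = \<one>" using * R(2) word_value_trivial_relator[OF f] by blast
  ultimately show ?thesis
    using * by (simp add: word_value_append[OF f] word_value_closed[OF f])
qed

lemma word_value_presentation_rel:
  assumes f: "f \<in> X \<rightarrow> carrier G" and R: "R \<subseteq> words X" "\<forall>r\<in>R. word_value G f r = \<one>"
    and rel: "(a, b) \<in> presentation_rel X R"
  shows "word_value G f a = word_value G f b"
proof -
  have "(a, b) \<in> (insertion X R \<union> (insertion X R)\<inverse>)\<^sup>*"
    using rel by (simp add: presentation_rel_def)
  then show ?thesis
    proof (induction rule: rtrancl_induct)
    case (step y z)
    from step.hyps(2) have "word_value G f y = word_value G f z"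
      using word_value_insertion[OF f R, of y z] word_value_insertion[OF f R, of z y] by auto
    with step.IH show ?case by simp
  qed simp
qed

lemma lift_presented_class:
  assumes "f \<in> X \<rightarrow> carrier G" "R \<subseteq> words X" "\<forall>r\<in>R. word_value G f r = \<one>"
    and "w \<in> words X"
  shows "lift_presented G f (word_class X R w) = word_value G f w"
proof -
  have "w \<in> word_class X R w"
    using equiv_class_self[OF equiv_presentation_rel assms(4)] .
  then have "(SOME w'. w' \<in> word_class X R w) \<in> word_class X R w" by (rule someI)
  then show ?thesis
    using word_value_presentation_rel[OF assms(1-3)] by (simp add: lift_presented_def)
qed

lemma lift_presented_hom:
  assumes "f \<in> X \<rightarrow> carrier G" "R \<subseteq> words X" "\<forall>r\<in>R. word_value G f r = \<one>"
  shows "lift_presented G f \<in> hom (presented_group X R) G"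
proof (rule homI)
  note lift = lift_presented_class[OF assms]
  fix A B assume "A \<in> carrier (presented_group X R)" "B \<in> carrier (presented_group X R)"
  then obtain a b where ab: "a \<in> words X" "b \<in> words X" "A = word_class X R a" "B = word_class X R b"
    by (auto simp: carrier_presented_group)
  have "a @ b \<in> words X" using ab by simp
  show "lift_presented G f A \<in> carrier G"
    using lift[OF ab(1)] word_value_closed[OF assms(1) ab(1)] ab(3) by simp
  show "lift_presented G f (A \<otimes>\<^bsub>presented_group X R\<^esub> B) =
      lift_presented G f A \<otimes> lift_presented G f B"
    unfolding ab(3,4) mult_presented_group[OF ab(1,2)] lift[OF \<open>a @ b \<in> words X\<close>]
      lift[OF ab(1)] lift[OF ab(2)]
    by (rule word_value_append[OF assms(1) ab(1,2)])
qed

end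

lemma hom_word_value:
  assumes "group G" "group H" "\<phi> \<in> hom G H" "f \<in> X \<rightarrow> carrier G" "w \<in> words X"
  shows "\<phi> (word_value G f w) = word_value H (\<phi> \<circ> f) w"
proof -
  interpret group_hom G H \<phi>
    using assms by (simp add: group_hom_def group_hom_axioms_def)
  show ?thesis
    using assms(5)
  proof (induction w rule: list.induct)
    case (Cons l w)
    then have "f (fst l) \<in> carrier G" "word_value G f w \<in> carrier G"
      using assms(4) by auto
    with Cons show ?case by auto
  qed simp
qed

abbreviation gen_class :: "'a set \<Rightarrow> 'a word set \<Rightarrow> 'a \<Rightarrow> 'a word set" where
  "gen_class X R x \<equiv> word_class X R [(x, True)]"

lemma word_class_closed: "w \<in> words X \<Longrightarrow> word_class X R w \<in> carrier (presented_group X R)"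
  by (simp add: carrier_presented_group)

lemma gen_class_closed: "gen_class X R \<in> X \<rightarrow> carrier (presented_group X R)"
  by (auto intro!: word_class_closed)

lemma one_presented_group: "\<one>\<^bsub>presented_group X R\<^esub> = word_class X R []"
  by (simp add: presented_group_def)

lemma inv_word_class:
  assumes "w \<in> words X"
  shows "inv\<^bsub>presented_group X R\<^esub> (word_class X R w) = word_class X R (inverse_word w)"
proof -
  interpret group "presented_group X R" by (rule group_presented_group)
  note iw = inverse_word_in_words[OF assms]
  have "word_class X R (inverse_word w) \<otimes>\<^bsub>presented_group X R\<^esub> word_class X R w = \<one>\<^bsub>presented_group X R\<^esub>"
    unfolding mult_presented_group[OF iw assms] one_presented_group
    by (rule equiv_class_eq[OF equiv_presentation_rel inverse_word_left[OF assms]])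
  then show ?thesis
    using assms iw by (intro inv_equality) (auto intro: word_class_closed)
qed

lemma word_value_gen_class:
  assumes "w \<in> words X"
  shows "word_value (presented_group X R) (gen_class X R) w = word_class X R w"
  using assms
proof (induction w rule: list.induct)
  case (Cons l w)
  obtain x b where l: "l = (x, b)" by force
  have *: "l \<in> X \<times> UNIV" "w \<in> words X"
    using Cons.prems by simp_all
  then have x: "[(x, b)] \<in> words X" "w \<in> words X" "x \<in> X" using l by simp_all
  have "(if b then gen_class X R x else inv\<^bsub>presented_group X R\<^esub> gen_class X R x)
      = word_class X R [(x, b)]"
    using x(3) by (auto simp: inv_word_class inverse_word_def)
  with Cons.IH[OF x(2)] mult_presented_group[OF x(1,2), of R] show ?case
    by (cases b) (simp_all add: l)
qed (simp add: one_presented_group)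

lemma word_value_relator:
  assumes "R \<subseteq> words X" "r \<in> R"
  shows "word_value (presented_group X R) (gen_class X R) r = \<one>\<^bsub>presented_group X R\<^esub>"
proof -
  have r: "r \<in> words X" using assms by blast
  have "([], r) \<in> insertion X R"
    unfolding insertion_def using assms(2) by force
  then have "([], r) \<in> presentation_rel X R"
    using r by (auto simp: presentation_rel_def)
  then have "word_class X R [] = word_class X R r"
    by (rule equiv_class_eq[OF equiv_presentation_rel])
  then show ?thesis by (simp add: word_value_gen_class[OF r] one_presented_group)
qed

lemma carrier_presented_group_word_value:
  assumes "g \<in> carrier (presented_group X R)"
  obtains w where "w \<in> words X" "g = word_value (presented_group X R) (gen_class X R) w"
  using assms word_value_gen_class[of _ X R] by (auto simp: carrier_presented_group)

lemma hom_presented_group_eqI: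
  assumes "group H" "\<phi> \<in> hom (presented_group X R) H" "\<psi> \<in> hom (presented_group X R) H"
    and "\<And>x. x \<in> X \<Longrightarrow> \<phi> (gen_class X R x) = \<psi> (gen_class X R x)"
    and "g \<in> carrier (presented_group X R)"
  shows "\<phi> g = \<psi> g"
proof -
  obtain w where w: "w \<in> words X" "g = word_value (presented_group X R) (gen_class X R) w"
    using assms(5) by (rule carrier_presented_group_word_value)
  show ?thesis
    unfolding w(2) hom_word_value[OF group_presented_group assms(1) assms(2) gen_class_closed w(1)]
      hom_word_value[OF group_presented_group assms(1) assms(3) gen_class_closed w(1)]
    using assms(4) by (intro group.word_value_cong[OF assms(1) w(1)]) simp
qed

lemma lift_presented_gen:
  assumes "group H" "f \<in> X \<rightarrow> carrier H" "R \<subseteq> words X"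
    "\<forall>r\<in>R. word_value H f r = \<one>\<^bsub>H\<^esub>" "x \<in> X"
  shows "lift_presented H f (gen_class X R x) = f x"
proof -
  interpret group H by fact
  show ?thesis
    using lift_presented_class[OF assms(2-4), of "[(x, True)]"] assms(2,5) by (simp add: Pi_iff)
qed

lemma lift_presented_word_value:
  assumes "group H" "f \<in> X \<rightarrow> carrier H" "R \<subseteq> words X"
    "\<forall>r\<in>R. word_value H f r = \<one>\<^bsub>H\<^esub>" "w \<in> words X"
  shows "lift_presented H f (word_value (presented_group X R) (gen_class X R) w) = word_value H f w"
  unfolding word_value_gen_class[OF assms(5)]
  by (rule group.lift_presented_class[OF assms])

section \<open>Finite presentability of retracts\<close>

lemma word_value_map:
  "word_value H f (map (map_prod h id) w) = word_value H (f \<circ> h) w"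
  by (induction w) auto

text \<open>Since \<epsilon> after \<Lambda> is the identity, \<Lambda> after \<epsilon> is an
  idempotent endomorphism of the presented group. One further relator per generator, equating
  \<open>x\<close> with a word for its image under this idempotent, collapses the group onto
  \<open>P\<close>.\<close>

lemma finitely_presented_retract:
  fixes P :: "('g, 'm) monoid_scheme" and X :: "'a set"
  assumes P: "group P" and X: "finite X" and R: "finite R" "R \<subseteq> words X"
    and \<epsilon>: "\<epsilon> \<in> X \<rightarrow> carrier P" "\<forall>r\<in>R. word_value P \<epsilon> r = \<one>\<^bsub>P\<^esub>"
    and \<Lambda>: "\<Lambda> \<in> hom P (presented_group X R)"
    and retract: "\<And>p. p \<in> carrier P \<Longrightarrow> lift_presented P \<epsilon> (\<Lambda> p) = p"
  shows "finitely_presented P"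
proof -
  interpret P: group P by fact
  let ?Q = "presented_group X R"
  \<comment> \<open>\<open>finitely_presented\<close> asks for generators in \<open>nat\<close>, so
    the letters are renamed along \<iota>.\<close>
  obtain \<iota> :: "'a \<Rightarrow> nat" where \<iota>: "inj_on \<iota> X"
    using X by (meson finite_imp_inj_to_nat_seg)
  define m where "m = map (map_prod \<iota> (id :: bool \<Rightarrow> bool))"
  define X' where "X' = \<iota> ` X"
  have mw: "m w \<in> words X'" if "w \<in> words X" for w
    using that by (force simp: m_def X'_def)
  have "\<exists>w \<in> words X. \<Lambda> (\<epsilon> x) = word_value ?Q (gen_class X R) w" if "x \<in> X" for x
  proof -
    have "\<Lambda> (\<epsilon> x) \<in> carrier ?Q" using that \<epsilon>(1) \<Lambda> by (auto simp: hom_def)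
    then show ?thesis by (rule carrier_presented_group_word_value) blast
  qed
  then have "\<forall>x\<in>X. \<exists>w. w \<in> words X \<and> \<Lambda> (\<epsilon> x) = word_value ?Q (gen_class X R) w" by blast
  from bchoice[OF this] obtain \<rho> where
    \<rho>: "\<And>x. x \<in> X \<Longrightarrow> \<rho> x \<in> words X"
      "\<And>x. x \<in> X \<Longrightarrow> \<Lambda> (\<epsilon> x) = word_value ?Q (gen_class X R) (\<rho> x)" by blast
  define R' where "R' = m ` R \<union> (\<lambda>x. (\<iota> x, False) # m (\<rho> x)) ` X"
  have R'w: "R' \<subseteq> words X'"
  proof -
    have "m ` R \<subseteq> words X'" using R(2) mw by blast
    moreover have "(\<iota> x, False) # m (\<rho> x) \<in> words X'" if "x \<in> X" for x
      unfolding Cons_in_lists_iff using that mw[OF \<rho>(1)[OF that]] by (simp add: X'_def)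
    ultimately show ?thesis unfolding R'_def by blast
  qed
  let ?Q' = "presented_group X' R'"
  interpret Q': group ?Q' by (rule group_presented_group)
  define \<epsilon>' where "\<epsilon>' = \<epsilon> \<circ> inv_into X \<iota>"
  have \<epsilon>'\<iota>: "\<epsilon>' (\<iota> x) = \<epsilon> x" if "x \<in> X" for x using that \<iota> by (simp add: \<epsilon>'_def)
  have \<epsilon>': "\<epsilon>' \<in> X' \<rightarrow> carrier P" using \<epsilon>(1) \<epsilon>'\<iota> by (auto simp: X'_def)
  have val: "word_value P \<epsilon>' (m w) = word_value P \<epsilon> w" if "w \<in> words X" for w
    unfolding m_def word_value_map using that by (rule P.word_value_cong) (simp add: \<epsilon>'\<iota>)
  \<comment> \<open>The added relators hold in \<open>P\<close>: \<open>\<rho> x\<close> spells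
    \<open>\<Lambda> (\<epsilon> x)\<close>, which is sent back to
    \<open>\<epsilon> x\<close>.\<close>
  have \<epsilon>\<rho>: "word_value P \<epsilon> (\<rho> x) = \<epsilon> x" if "x \<in> X" for x
    using retract[of "\<epsilon> x"] \<epsilon>(1) that \<rho>[OF that]
      lift_presented_word_value[OF P \<epsilon>(1) R(2) \<epsilon>(2) \<rho>(1)[OF that]] by auto
  have \<epsilon>'R: "\<forall>r\<in>R'. word_value P \<epsilon>' r = \<one>\<^bsub>P\<^esub>"
  proof
    fix r assume r: "r \<in> R'"
    from r consider s where "s \<in> R" "r = m s" | x where "x \<in> X" "r = (\<iota> x, False) # m (\<rho> x)"
      by (auto simp: R'_def)
    then show "word_value P \<epsilon>' r = \<one>\<^bsub>P\<^esub>"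
    proof cases
      case 1
      then show ?thesis using val[of s] R(2) \<epsilon>(2) by auto
    next
      case 2
      then show ?thesis using val[OF \<rho>(1)] \<epsilon>\<rho> \<epsilon>(1) \<epsilon>'\<iota> by (simp add: Pi_iff)
    qed
  qed
  define A where "A = lift_presented P \<epsilon>'"
  have Ahom: "A \<in> hom ?Q' P"
    unfolding A_def by (rule P.lift_presented_hom[OF \<epsilon>' R'w \<epsilon>'R])
  define g where "g = gen_class X' R' \<circ> \<iota>"
  have g: "g \<in> X \<rightarrow> carrier ?Q'"
    using gen_class_closed[of X' R'] by (auto simp: g_def X'_def Pi_iff)
  have gval: "word_value ?Q' g w = word_value ?Q' (gen_class X' R') (m w)" if "w \<in> words X" for w
    unfolding g_def m_def word_value_map ..
  have gR: "\<forall>r\<in>R. word_value ?Q' g r = \<one>\<^bsub>?Q'\<^esub>"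
  proof
    fix r assume r: "r \<in> R"
    have "r \<in> words X" using r R(2) by blast
    moreover have "m r \<in> R'" using r by (simp add: R'_def)
    ultimately show "word_value ?Q' g r = \<one>\<^bsub>?Q'\<^esub>"
      using gval word_value_relator[OF R'w] by simp
  qed
  define B where "B = lift_presented ?Q' g \<circ> \<Lambda>"
  have lg: "lift_presented ?Q' g \<in> hom ?Q ?Q'"
    by (rule Q'.lift_presented_hom[OF g R(2) gR])
  have Bhom: "B \<in> hom P ?Q'" unfolding B_def by (rule hom_compose[OF \<Lambda> lg])
  \<comment> \<open>On a generator the composite yields the word \<open>\<rho> x\<close>, which the
    added relator identifies with that generator.\<close>
  have BA: "B (A q) = q" if q: "q \<in> carrier ?Q'" for q
  proof -
    have "(B \<circ> A) q = id q"
    proof (rule hom_presented_group_eqI[OF Q'.is_group _ _ _ q])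
      show "B \<circ> A \<in> hom ?Q' ?Q'" by (rule hom_compose[OF Ahom Bhom])
      show "id \<in> hom ?Q' ?Q'" by (simp add: hom_def)
      fix y assume "y \<in> X'"
      then obtain x where x: "x \<in> X" "y = \<iota> x" by (auto simp: X'_def)
      have "A (gen_class X' R' y) = \<epsilon> x"
        unfolding A_def using lift_presented_gen[OF P \<epsilon>' R'w \<epsilon>'R \<open>y \<in> X'\<close>] \<epsilon>'\<iota> x by simp
      then have "B (A (gen_class X' R' y)) = word_value ?Q' g (\<rho> x)"
        unfolding B_def using \<rho>[OF x(1)]
          lift_presented_word_value[OF Q'.is_group g R(2) gR \<rho>(1)[OF x(1)]] by simp
      also have "\<dots> = word_value ?Q' (gen_class X' R') (m (\<rho> x))"
        by (rule gval[OF \<rho>(1)[OF x(1)]])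
      also have "\<dots> = gen_class X' R' y"
      proof -
        have cl: "gen_class X' R' y \<in> carrier ?Q'"
            "word_value ?Q' (gen_class X' R') (m (\<rho> x)) \<in> carrier ?Q'"
          using gen_class_closed[of X' R'] \<open>y \<in> X'\<close> mw[OF \<rho>(1)[OF x(1)]]
          by (auto intro!: Q'.word_value_closed)
        have "(y, False) # m (\<rho> x) \<in> R'" using x by (auto simp: R'_def)
        from word_value_relator[OF R'w this]
        have "inv\<^bsub>?Q'\<^esub> gen_class X' R' y \<otimes>\<^bsub>?Q'\<^esub> word_value ?Q' (gen_class X' R') (m (\<rho> x)) = \<one>\<^bsub>?Q'\<^esub>"
          by simp
        then show ?thesis
          using cl by (metis Q'.inv_closed Q'.inv_equality Q'.inv_inv)
      qed
      finally show "(B \<circ> A) (gen_class X' R' y) = id (gen_class X' R' y)" by simp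
    qed
    then show ?thesis by simp
  qed
  have AB: "A (B p) = p" if p: "p \<in> carrier P" for p
  proof -
    have "(A \<circ> lift_presented ?Q' g) q = lift_presented P \<epsilon> q" if "q \<in> carrier ?Q" for q
    proof (rule hom_presented_group_eqI[OF P _ _ _ that])
      show "A \<circ> lift_presented ?Q' g \<in> hom ?Q P" by (rule hom_compose[OF lg Ahom])
      show "lift_presented P \<epsilon> \<in> hom ?Q P" by (rule P.lift_presented_hom[OF \<epsilon>(1) R(2) \<epsilon>(2)])
      fix x assume x: "x \<in> X"
      then have "\<iota> x \<in> X'" by (simp add: X'_def)
      then show "(A \<circ> lift_presented ?Q' g) (gen_class X R x) = lift_presented P \<epsilon> (gen_class X R x)"
        using lift_presented_gen[OF P \<epsilon>(1) R(2) \<epsilon>(2) x]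
          lift_presented_gen[OF Q'.is_group g R(2) gR x]
          lift_presented_gen[OF P \<epsilon>' R'w \<epsilon>'R, of "\<iota> x"] \<epsilon>'\<iota>[OF x]
        by (simp add: A_def g_def)
    qed
    moreover have "\<Lambda> p \<in> carrier ?Q" using p \<Lambda> by (auto simp: hom_def)
    ultimately show ?thesis using retract[OF p] by (simp add: B_def)
  qed
  have "B \<in> iso P ?Q'"
    unfolding iso_def
  proof (intro CollectI conjI Bhom bij_betw_byWitness[where f' = A])
    show "\<forall>a\<in>carrier P. A (B a) = a" using AB by blast
    show "\<forall>a'\<in>carrier ?Q'. B (A a') = a'" using BA by blast
    show "B ` carrier P \<subseteq> carrier ?Q'" using Bhom by (auto simp: hom_def)
    show "A ` carrier ?Q' \<subseteq> carrier P" using Ahom by (auto simp: hom_def)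
  qed
  then have "P \<cong> ?Q'" by (auto simp: is_iso_def)
  moreover have "finite X'" "finite R'" using X R(1) by (auto simp: X'_def R'_def)
  ultimately show ?thesis unfolding finitely_presented_def using R'w by blast
qed

section \<open>Central extensions of finitely presented groups\<close>

definition cocycle_extension ::
    "('g, 'm) monoid_scheme \<Rightarrow> ('g \<Rightarrow> 'g \<Rightarrow> 'a::ab_group_add) \<Rightarrow> ('a \<times> 'g) monoid" where
  "cocycle_extension G c =
     \<lparr>carrier = UNIV \<times> carrier G,
      mult = (\<lambda>(a, g) (b, h). (a + b + c g h, g \<otimes>\<^bsub>G\<^esub> h)),
      one = (0, \<one>\<^bsub>G\<^esub>)\<rparr>"

lemma cocycle_extension_simps [simp]:
  "carrier (cocycle_extension G c) = UNIV \<times> carrier G"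
  "(a, g) \<otimes>\<^bsub>cocycle_extension G c\<^esub> (b, h) = (a + b + c g h, g \<otimes>\<^bsub>G\<^esub> h)"
  "\<one>\<^bsub>cocycle_extension G c\<^esub> = (0, \<one>\<^bsub>G\<^esub>)"
  by (simp_all add: cocycle_extension_def)

definition normalized_cocycle ::
    "('g, 'm) monoid_scheme \<Rightarrow> ('g \<Rightarrow> 'g \<Rightarrow> 'a::ab_group_add) \<Rightarrow> bool" where
  "normalized_cocycle G c \<longleftrightarrow>
     (\<forall>g\<in>carrier G. c \<one>\<^bsub>G\<^esub> g = 0 \<and> c g \<one>\<^bsub>G\<^esub> = 0) \<and>
     (\<forall>g\<in>carrier G. \<forall>h\<in>carrier G. \<forall>k\<in>carrier G.
        c g h + c (g \<otimes>\<^bsub>G\<^esub> h) k = c h k + c g (h \<otimes>\<^bsub>G\<^esub> k))"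

lemma group_cocycle_extension:
  fixes c :: "'g \<Rightarrow> 'g \<Rightarrow> 'a::ab_group_add"
  assumes "group G" "normalized_cocycle G c"
  shows "group (cocycle_extension G c)"
proof (rule groupI)
  interpret group G by fact
  let ?E = "cocycle_extension G c"
  show "\<one>\<^bsub>?E\<^esub> \<in> carrier ?E" by simp
  show "x \<otimes>\<^bsub>?E\<^esub> y \<in> carrier ?E" if "x \<in> carrier ?E" "y \<in> carrier ?E" for x y
    using that by (cases x; cases y) simp
  show "x \<otimes>\<^bsub>?E\<^esub> y \<otimes>\<^bsub>?E\<^esub> z = x \<otimes>\<^bsub>?E\<^esub> (y \<otimes>\<^bsub>?E\<^esub> z)"
    if "x \<in> carrier ?E" "y \<in> carrier ?E" "z \<in> carrier ?E" for x y z
  proof -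
    obtain a g b h d k where *: "x = (a, g)" "y = (b, h)" "z = (d, k)"
      by (cases x; cases y; cases z)
    then have gh: "g \<in> carrier G" "h \<in> carrier G" "k \<in> carrier G" using that by auto
    then have "c g h + c (g \<otimes>\<^bsub>G\<^esub> h) k = c h k + c g (h \<otimes>\<^bsub>G\<^esub> k)"
      using assms(2) unfolding normalized_cocycle_def by blast
    then have "a + b + c g h + d + c (g \<otimes>\<^bsub>G\<^esub> h) k = a + (b + d + c h k) + c g (h \<otimes>\<^bsub>G\<^esub> k)"
      by (simp add: algebra_simps)
    then show ?thesis using gh by (simp add: * m_assoc)
  qed
  show "\<one>\<^bsub>?E\<^esub> \<otimes>\<^bsub>?E\<^esub> x = x" if "x \<in> carrier ?E" for x
    using that assms(2) by (cases x) (simp add: normalized_cocycle_def)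
  show "\<exists>y\<in>carrier ?E. y \<otimes>\<^bsub>?E\<^esub> x = \<one>\<^bsub>?E\<^esub>" if "x \<in> carrier ?E" for x
  proof -
    obtain a g where x: "x = (a, g)" by (cases x)
    with that have g: "g \<in> carrier G" by simp
    show ?thesis
      by (rule bexI[of _ "(- a - c (inv\<^bsub>G\<^esub> g) g, inv\<^bsub>G\<^esub> g)"]) (simp_all add: x g)
  qed
qed

lemma common_denominator:
  fixes A :: "rat set"
  assumes "finite A"
  shows "\<exists>N::int. N > 0 \<and> (\<forall>a\<in>A. of_int N * a \<in> \<int>)"
  using assms
proof (induction A)
  case empty
  then show ?case by (intro exI[of _ 1]) simp
next
  case (insert a A)
  then obtain N :: int where N: "N > 0" "\<And>a. a \<in> A \<Longrightarrow> of_int N * a \<in> \<int>" by blast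
  obtain p q where pq: "quotient_of a = (p, q)" by force
  have q: "q > 0" "a = of_int p / of_int q"
    using quotient_of_denom_pos[OF pq] quotient_of_div[OF pq] by auto
  have "of_int (N * q) * a = of_int (N * p)" using q by simp
  then have "of_int (N * q) * a \<in> \<int>" by (metis Ints_of_int)
  moreover have "of_int (N * q) * b \<in> \<int>" if "b \<in> A" for b
  proof -
    have "of_int (N * q) * b = of_int q * (of_int N * b)" by simp
    then show ?thesis using N(2)[OF that] by (metis Ints_mult Ints_of_int)
  qed
  ultimately show ?case using N(1) q(1) by (intro exI[of _ "N * q"]) auto
qed

text \<open>
  Over a finite presentation, the values of the relators in a central extension span a finitely
  generated subgroup of the kernel, which contains the commutators of commuting elements.
\<close>

lemma finitely_presented_commutator_denominator:
  fixes c :: "'g \<Rightarrow> 'g \<Rightarrow> rat"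
  assumes P: "group P" and fp: "finitely_presented P" and c: "normalized_cocycle P c"
  shows "\<exists>N::int. N > 0 \<and> (\<forall>g\<in>carrier P. \<forall>h\<in>carrier P.
    g \<otimes>\<^bsub>P\<^esub> h = h \<otimes>\<^bsub>P\<^esub> g \<longrightarrow> of_int N * (c g h - c h g) \<in> \<int>)"
proof -
  interpret P: group P by fact
  obtain X :: "nat set" and R where R: "finite R" "R \<subseteq> words X" "P \<cong> presented_group X R"
    using fp unfolding finitely_presented_def by blast
  let ?Q = "presented_group X R"
  have "?Q \<cong> P" using R(3) P.iso_sym by blast
  then obtain \<psi> where \<psi>: "\<psi> \<in> iso ?Q P" by (auto simp: is_iso_def)
  then have \<psi>hom: "\<psi> \<in> hom ?Q P" and \<psi>bij: "bij_betw \<psi> (carrier ?Q) (carrier P)"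
    by (auto simp: iso_def)
  define \<epsilon> where "\<epsilon> = \<psi> \<circ> gen_class X R"
  have \<epsilon>: "\<epsilon> \<in> X \<rightarrow> carrier P"
    using \<psi>hom gen_class_closed[of X R] by (auto simp: \<epsilon>_def hom_def Pi_iff)
  have \<psi>w: "\<psi> (word_class X R w) = word_value P \<epsilon> w" if "w \<in> words X" for w
    using hom_word_value[OF group_presented_group P \<psi>hom gen_class_closed that]
    by (simp add: word_value_gen_class[OF that] \<epsilon>_def)
  have rel: "(v, w) \<in> presentation_rel X R"
    if "v \<in> words X" "w \<in> words X" "word_value P \<epsilon> v = word_value P \<epsilon> w" for v w
  proof -
    have "word_class X R v = word_class X R w"
      using that \<psi>w \<psi>bij by (metis bij_betw_imp_inj_on inj_onD word_class_closed)
    then show ?thesis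
      using that eq_equiv_class[OF _ equiv_presentation_rel] by blast
  qed
  have ex: "\<exists>w\<in>words X. word_value P \<epsilon> w = p" if "p \<in> carrier P" for p
  proof -
    obtain q where "q \<in> carrier ?Q" "p = \<psi> q"
      using bij_betw_imp_surj_on[OF \<psi>bij] \<open>p \<in> carrier P\<close> by blast
    then obtain w where "w \<in> words X" "p = \<psi> (word_class X R w)"
      unfolding carrier_presented_group by (elim imageE) simp
    then show ?thesis using \<psi>w by metis
  qed
  let ?E = "cocycle_extension P c"
  interpret E: group ?E by (rule group_cocycle_extension[OF P c])
  define v where "v = word_value ?E (\<lambda>x. (0, \<epsilon> x))"
  have fE: "(\<lambda>x. (0, \<epsilon> x)) \<in> X \<rightarrow> carrier ?E" using \<epsilon> by (auto simp: Pi_iff)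
  have snd_v: "snd (v w) = word_value P \<epsilon> w" if "w \<in> words X" for w
  proof -
    have "snd \<in> hom ?E P" by (auto simp: hom_def)
    from hom_word_value[OF E.is_group P this fE that] show ?thesis
      by (simp add: v_def comp_def)
  qed
  have v_app: "v (u @ w) = v u \<otimes>\<^bsub>?E\<^esub> v w" if "u \<in> words X" "w \<in> words X" for u w
    unfolding v_def by (rule E.word_value_append[OF fE that])
  obtain N :: int where N: "N > 0" "\<And>r. r \<in> R \<Longrightarrow> of_int N * fst (v r) \<in> \<int>"
    using common_denominator[of "(\<lambda>r. fst (v r)) ` R"] R(1) by auto
  have triv: "of_int N * fst (v r) \<in> \<int> \<and> word_value P \<epsilon> r = \<one>\<^bsub>P\<^esub> \<and> r \<in> words X"
    if "r \<in> R \<union> trivial_relators X" for r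
  proof (cases "r \<in> R")
    case True
    then have r: "r \<in> words X" using R(2) by blast
    then have "word_value P \<epsilon> r = \<psi> (word_value ?Q (gen_class X R) r)"
      using \<psi>w by (simp add: word_value_gen_class)
    also have "\<dots> = \<one>\<^bsub>P\<^esub>"
      using word_value_relator[OF R(2) True] hom_one[OF \<psi>hom group_presented_group P] by simp
    finally show ?thesis using N(2) True r by blast
  next
    case False
    then have r: "r \<in> trivial_relators X" using that by blast
    then have "v r = \<one>\<^bsub>?E\<^esub>" unfolding v_def by (rule E.word_value_trivial_relator[OF fE])
    moreover have "r \<in> words X" using r by (auto simp: trivial_relators_def)
    ultimately show ?thesis using P.word_value_trivial_relator[OF \<epsilon> r] by simp
  qed
  \<comment> \<open>A relator evaluates to a central element, so inserting it anywhere adds just its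
    first component, and \<open>N\<close> times that is an integer.\<close>
  have ins: "of_int N * (fst (v b) - fst (v a)) \<in> \<int>" if "(a, b) \<in> insertion X R" for a b
  proof -
    obtain u r w where *: "a = u @ w" "b = u @ r @ w" "u \<in> words X" "w \<in> words X"
        "r \<in> R \<union> trivial_relators X"
      using \<open>(a, b) \<in> insertion X R\<close> unfolding insertion_def by blast
    note r = triv[OF *(5)]
    have vu: "v u = (fst (v u), word_value P \<epsilon> u)" "v w = (fst (v w), word_value P \<epsilon> w)"
        "v r = (fst (v r), \<one>\<^bsub>P\<^esub>)"
      using snd_v[OF *(3)] snd_v[OF *(4)] snd_v[of r] r by (metis prod.collapse)+
    have cl: "word_value P \<epsilon> w \<in> carrier P" using \<epsilon> *(4) by auto
    have "v b = v u \<otimes>\<^bsub>?E\<^esub> (v r \<otimes>\<^bsub>?E\<^esub> v w)"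
      using * r v_app by simp
    also have "v r \<otimes>\<^bsub>?E\<^esub> v w = (fst (v r) + fst (v w), word_value P \<epsilon> w)"
      using cl c by (subst vu(2), subst vu(3)) (simp add: normalized_cocycle_def)
    also have "v u \<otimes>\<^bsub>?E\<^esub> \<dots> = (fst (v r) + fst (v a), snd (v a))"
    proof -
      have "v a = v u \<otimes>\<^bsub>?E\<^esub> v w" using * v_app by simp
      also have "\<dots> = (fst (v u) + fst (v w) + c (word_value P \<epsilon> u) (word_value P \<epsilon> w),
          word_value P \<epsilon> u \<otimes>\<^bsub>P\<^esub> word_value P \<epsilon> w)"
        by (subst vu(1), subst vu(2)) simp
      finally show ?thesis by (subst vu(1)) simp
    qed
    finally show ?thesis using r by simp
  qed
  have "of_int N * (fst (v b) - fst (v a)) \<in> \<int>" if "(a, b) \<in> presentation_rel X R" for a b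
  proof -
    have "(a, b) \<in> (insertion X R \<union> (insertion X R)\<inverse>)\<^sup>*"
      using that by (simp add: presentation_rel_def)
    then show ?thesis
    proof (induction rule: rtrancl_induct)
      case (step y z)
      have "of_int N * (fst (v z) - fst (v y)) \<in> \<int>"
        using step.hyps(2) ins[of y z] Ints_minus[OF ins[of z y]] by (auto simp: algebra_simps)
      from Ints_add[OF step.IH this] show ?case by (simp add: algebra_simps)
    qed simp
  qed
  note vrel = this
  show ?thesis
  proof (intro exI[of _ N] conjI ballI impI N(1))
    fix g h assume gh: "g \<in> carrier P" "h \<in> carrier P" "g \<otimes>\<^bsub>P\<^esub> h = h \<otimes>\<^bsub>P\<^esub> g"
    obtain a where a: "a \<in> words X" "word_value P \<epsilon> a = g" using ex gh(1) by blast
    obtain b where b: "b \<in> words X" "word_value P \<epsilon> b = h" using ex gh(2) by blast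
    have va: "v a = (fst (v a), g)" "v b = (fst (v b), h)"
      using snd_v a b by (metis prod.collapse)+
    \<comment> \<open>The two orders spell one element of \<open>P\<close>, hence are joined by
      insertions and deletions of relators; their lifts differ by the commutator of the lifts of
      \<open>g\<close> and \<open>h\<close>.\<close>
    have "(b @ a, a @ b) \<in> presentation_rel X R"
      using a b gh by (intro rel) (simp_all add: P.word_value_append[OF \<epsilon>])
    then have "of_int N * (fst (v (a @ b)) - fst (v (b @ a))) \<in> \<int>" by (rule vrel)
    moreover have "fst (v (a @ b)) - fst (v (b @ a)) = c g h - c h g"
      unfolding v_app[OF a(1) b(1)] v_app[OF b(1) a(1)]
      by (subst (1 2) va(1), subst (1 2) va(2)) simp
    ultimately show "of_int N * (c g h - c h g) \<in> \<int>" by simp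
  qed
qed

text \<open>
  The cocycle below is the one of the group of matrices with rows
  \<open>(1, e, z)\<close>, \<open>(0, s, d)\<close>, \<open>(0, 0, 1)\<close> over its centre.
\<close>

lemma not_finitely_presentedI:
  fixes s e d :: "'g \<Rightarrow> rat" and x y :: rat
  assumes P: "group P"
    and s: "\<And>p. p \<in> carrier P \<Longrightarrow> s p \<noteq> 0"
      "\<And>p q. \<lbrakk>p \<in> carrier P; q \<in> carrier P\<rbrakk> \<Longrightarrow> s (p \<otimes>\<^bsub>P\<^esub> q) = s p * s q"
    and e: "\<And>p q. \<lbrakk>p \<in> carrier P; q \<in> carrier P\<rbrakk> \<Longrightarrow> e (p \<otimes>\<^bsub>P\<^esub> q) = e p * s q + e q"
    and d: "\<And>p q. \<lbrakk>p \<in> carrier P; q \<in> carrier P\<rbrakk> \<Longrightarrow> d (p \<otimes>\<^bsub>P\<^esub> q) = d p + s p * d q"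
    and h: "h \<in> carrier P"
    and k: "\<And>n::nat. k n \<in> carrier P" "\<And>n. k n \<otimes>\<^bsub>P\<^esub> h = h \<otimes>\<^bsub>P\<^esub> k n" "\<And>n. d (k n) = 0"
      "\<And>n. e (k n) * d h = x / y ^ n"
    and x: "x \<noteq> 0" and y: "y \<ge> 2"
  shows "\<not> finitely_presented P"
proof
  assume fp: "finitely_presented P"
  interpret P: group P by fact
  have e1: "e \<one>\<^bsub>P\<^esub> = 0" using e[of "\<one>\<^bsub>P\<^esub>" "\<one>\<^bsub>P\<^esub>"] s(1)[of "\<one>\<^bsub>P\<^esub>"] by simp
  have d1: "d \<one>\<^bsub>P\<^esub> = 0" using d[of "\<one>\<^bsub>P\<^esub>" "\<one>\<^bsub>P\<^esub>"] s(1)[of "\<one>\<^bsub>P\<^esub>"] by simp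
  \<comment> \<open>The cup product of the two derivations: in the cocycle identity both sides
    contain the mixed term \<open>e g * s h * d k\<close>.\<close>
  have "normalized_cocycle P (\<lambda>p q. e p * d q)"
    unfolding normalized_cocycle_def by (simp add: e1 d1 e d s algebra_simps)
  from finitely_presented_commutator_denominator[OF P fp this]
  obtain N :: int where N: "N > 0" "\<And>p q. \<lbrakk>p \<in> carrier P; q \<in> carrier P; p \<otimes>\<^bsub>P\<^esub> q = q \<otimes>\<^bsub>P\<^esub> p\<rbrakk>
      \<Longrightarrow> of_int N * (e p * d q - e q * d p) \<in> \<int>"
    by blast
  have int: "of_int N * (x / y ^ n) \<in> \<int>" for n
    using N(2)[OF k(1)[of n] h k(2)[of n]] k(3,4)[of n] by simp
  \<comment> \<open>\<open>n\<close> is taken so large that the integer \<open>N * x / y ^ n\<close>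
    has absolute value below one.\<close>
  obtain n where n: "\<bar>of_int N * x\<bar> < of_nat n" using reals_Archimedean2 by blast
  have "(of_nat n :: rat) < 2 ^ n"
    by (metis of_nat_less_two_power)
  moreover have "2 ^ n \<le> y ^ n" using y by (intro power_mono) auto
  ultimately have "\<bar>of_int N * x\<bar> < y ^ n" using n by linarith
  then have "\<bar>of_int N * (x / y ^ n)\<bar> < 1" using y by (simp add: abs_mult field_simps)
  with int[of n] have "of_int N * (x / y ^ n) = 0" by (metis Ints_nonzero_abs_less1)
  then show False using N(1) x y by simp
qed

section \<open>Right-angled Artin groups\<close>

definition additive_group :: "'a::ab_group_add monoid" where
  "additive_group = \<lparr>carrier = UNIV, mult = (+), one = 0\<rparr>"

lemma additive_group_simps [simp]:
  "carrier additive_group = UNIV" "x \<otimes>\<^bsub>additive_group\<^esub> y = x + y" "\<one>\<^bsub>additive_group\<^esub> = 0"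
  by (simp_all add: additive_group_def)

lemma group_additive_group: "group (additive_group :: 'a::ab_group_add monoid)"
  by (rule groupI) (auto simp: add.assoc intro: exI[of _ "- x" for x])

abbreviation raag_relators :: "'v set set \<Rightarrow> 'v word set" where
  "raag_relators K \<equiv> {commutator_word u v | u v. u \<noteq> v \<and> {u, v} \<in> K}"

definition raag_gen :: "'v set set \<Rightarrow> 'v \<Rightarrow> 'v word set" where
  "raag_gen K = gen_class (vertices K) (raag_relators K)"

lemma edge_vertices:
  assumes "simplicial_complex K" "{u, v} \<in> K"
  shows "u \<in> vertices K" "v \<in> vertices K"
  using assms unfolding simplicial_complex_def vertices_def
  by (metis (no_types, lifting) empty_not_insert insert_subset mem_Collect_eq singletonI subset_insertI subset_refl insertI2 empty_subsetI)+

lemma raag_relators_words: "simplicial_complex K \<Longrightarrow> raag_relators K \<subseteq> words (vertices K)"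
  by (auto simp: commutator_word_def dest: edge_vertices)

lemma raag_gen_closed [simp]: "v \<in> vertices K \<Longrightarrow> raag_gen K v \<in> carrier (raag K)"
  using gen_class_closed[of "vertices K" "raag_relators K"] by (auto simp: raag_gen_def raag_def)

lemma (in group) word_value_square:
  assumes "x a \<in> carrier G" "x b \<in> carrier G" "x c \<in> carrier G" "x d \<in> carrier G"
  shows "word_value G x [(a, True), (b, True), (c, False), (d, False)] = \<one> \<longleftrightarrow> x a \<otimes> x b = x d \<otimes> x c"
proof -
  have "word_value G x [(a, True), (b, True), (c, False), (d, False)] = (x a \<otimes> x b) \<otimes> inv (x d \<otimes> x c)"
    using assms by (simp add: inv_mult_group m_assoc)
  then show ?thesis
    using assms by (metis inv_closed inv_equality inv_inv m_closed r_inv)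
qed

lemma (in group) word_value_commutator:
  assumes "x u \<in> carrier G" "x v \<in> carrier G"
  shows "word_value G x (commutator_word u v) = \<one> \<longleftrightarrow> x u \<otimes> x v = x v \<otimes> x u"
  unfolding commutator_word_def using assms by (intro word_value_square)

lemma raag_gen_commute:
  assumes "simplicial_complex K" "{u, v} \<in> K"
  shows "raag_gen K u \<otimes>\<^bsub>raag K\<^esub> raag_gen K v = raag_gen K v \<otimes>\<^bsub>raag K\<^esub> raag_gen K u"
proof (cases "u = v")
  case False
  interpret group "raag K" by (rule group_raag)
  have "word_value (raag K) (raag_gen K) (commutator_word u v) = \<one>\<^bsub>raag K\<^esub>"
    unfolding raag_def raag_gen_def
    by (rule word_value_relator[OF raag_relators_words[OF assms(1)]]) (use False assms(2) in blast)
  then show ?thesis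
    using word_value_commutator[of "raag_gen K" u v] edge_vertices[OF assms] by simp
qed simp

lemma raag_universal:
  assumes K: "simplicial_complex K" and H: "group H"
    and f: "\<And>v. v \<in> vertices K \<Longrightarrow> f v \<in> carrier H"
    and comm: "\<And>u v. \<lbrakk>u \<noteq> v; {u, v} \<in> K\<rbrakk> \<Longrightarrow> f u \<otimes>\<^bsub>H\<^esub> f v = f v \<otimes>\<^bsub>H\<^esub> f u"
  obtains \<phi> where "\<phi> \<in> hom (raag K) H" "\<And>v. v \<in> vertices K \<Longrightarrow> \<phi> (raag_gen K v) = f v"
proof
  interpret H: group H by fact
  have f': "f \<in> vertices K \<rightarrow> carrier H" using f by auto
  have R: "\<forall>r\<in>raag_relators K. word_value H f r = \<one>\<^bsub>H\<^esub>"
  proof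
    fix r assume "r \<in> raag_relators K"
    then obtain u v where uv: "r = commutator_word u v" "u \<noteq> v" "{u, v} \<in> K" by blast
    show "word_value H f r = \<one>\<^bsub>H\<^esub>"
      unfolding uv(1) using H.word_value_commutator[of f u v] f edge_vertices[OF K uv(3)] comm[OF uv(2,3)]
      by simp
  qed
  show "lift_presented H f \<in> hom (raag K) H"
    unfolding raag_def by (rule H.lift_presented_hom[OF f' raag_relators_words[OF K] R])
  show "lift_presented H f (raag_gen K v) = f v" if "v \<in> vertices K" for v
    unfolding raag_gen_def
    by (rule lift_presented_gen[OF H f' raag_relators_words[OF K] R that])
qed

lemma raag_hom_eqI:
  assumes "group H" "\<phi> \<in> hom (raag K) H" "\<psi> \<in> hom (raag K) H"
    and "\<And>v. v \<in> vertices K \<Longrightarrow> \<phi> (raag_gen K v) = \<psi> (raag_gen K v)" "g \<in> carrier (raag K)"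
  shows "\<phi> g = \<psi> g"
  using hom_presented_group_eqI[of H \<phi> "vertices K" "raag_relators K" \<psi> g] assms
  by (simp add: raag_def raag_gen_def)

lemma raag_induct [consumes 1, case_names one gen inv]:
  assumes "g \<in> carrier (raag K)"
    and "P \<one>\<^bsub>raag K\<^esub>"
    and "\<And>v g. \<lbrakk>v \<in> vertices K; g \<in> carrier (raag K); P g\<rbrakk> \<Longrightarrow> P (raag_gen K v \<otimes>\<^bsub>raag K\<^esub> g)"
    and "\<And>v g. \<lbrakk>v \<in> vertices K; g \<in> carrier (raag K); P g\<rbrakk>
      \<Longrightarrow> P (inv\<^bsub>raag K\<^esub> raag_gen K v \<otimes>\<^bsub>raag K\<^esub> g)"
  shows "P g"
proof -
  interpret group "raag K" by (rule group_raag)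
  obtain w where w: "w \<in> words (vertices K)" "g = word_value (raag K) (raag_gen K) w"
    using assms(1) unfolding raag_def raag_gen_def by (rule carrier_presented_group_word_value)
  have gen: "raag_gen K \<in> vertices K \<rightarrow> carrier (raag K)" by simp
  have "P (word_value (raag K) (raag_gen K) w)"
    using w(1)
  proof (induction w rule: list.induct)
    case (Cons l w)
    then have "fst l \<in> vertices K" "w \<in> words (vertices K)" by (auto simp: mem_Times_iff)
    with Cons.IH assms(3,4)[of "fst l"] word_value_closed[OF gen] show ?case by simp
  qed (simp add: assms(2))
  then show ?thesis by (simp add: w(2))
qed

lemma (in group) commutes_inv:
  assumes "x \<in> carrier G" "y \<in> carrier G" "x \<otimes> y = y \<otimes> x"
  shows "x \<otimes> inv y = inv y \<otimes> x"
proof -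
  have "inv y \<otimes> (x \<otimes> y) \<otimes> inv y = inv y \<otimes> (y \<otimes> x) \<otimes> inv y" by (simp only: assms(3))
  moreover have "inv y \<otimes> (x \<otimes> y) \<otimes> inv y = inv y \<otimes> x"
    using assms(1,2) by (simp add: m_assoc)
  moreover have "inv y \<otimes> (y \<otimes> x) \<otimes> inv y = x \<otimes> inv y"
    using assms(1,2) by (simp add: m_assoc[symmetric])
  ultimately show ?thesis by simp
qed

lemma raag_hom_commutes:
  assumes H: "group H" and \<phi>: "\<phi> \<in> hom (raag K) H" and x: "x \<in> carrier H"
    and gen: "\<And>v. v \<in> vertices K \<Longrightarrow> x \<otimes>\<^bsub>H\<^esub> \<phi> (raag_gen K v) = \<phi> (raag_gen K v) \<otimes>\<^bsub>H\<^esub> x"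
    and g: "g \<in> carrier (raag K)"
  shows "x \<otimes>\<^bsub>H\<^esub> \<phi> g = \<phi> g \<otimes>\<^bsub>H\<^esub> x"
proof -
  interpret \<phi>: group_hom "raag K" H \<phi>
    using H \<phi> group_raag by (simp add: group_hom_def group_hom_axioms_def)
  have step: "x \<otimes>\<^bsub>H\<^esub> (y \<otimes>\<^bsub>H\<^esub> z) = (y \<otimes>\<^bsub>H\<^esub> z) \<otimes>\<^bsub>H\<^esub> x"
    if "y \<in> carrier H" "z \<in> carrier H" "x \<otimes>\<^bsub>H\<^esub> y = y \<otimes>\<^bsub>H\<^esub> x" "x \<otimes>\<^bsub>H\<^esub> z = z \<otimes>\<^bsub>H\<^esub> x" for y z
  proof -
    have "x \<otimes>\<^bsub>H\<^esub> (y \<otimes>\<^bsub>H\<^esub> z) = x \<otimes>\<^bsub>H\<^esub> y \<otimes>\<^bsub>H\<^esub> z" using that(1,2) x by (simp add: \<phi>.H.m_assoc)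
    also have "\<dots> = y \<otimes>\<^bsub>H\<^esub> (x \<otimes>\<^bsub>H\<^esub> z)" unfolding that(3) using that(1,2) x by (simp add: \<phi>.H.m_assoc)
    also have "\<dots> = y \<otimes>\<^bsub>H\<^esub> z \<otimes>\<^bsub>H\<^esub> x" unfolding that(4) using that(1,2) x by (simp add: \<phi>.H.m_assoc)
    finally show ?thesis .
  qed
  show ?thesis
    using g
  proof (induction rule: raag_induct)
    case one
    then show ?case using x by simp
  next
    case (gen v g)
    then show ?case using step[of "\<phi> (raag_gen K v)" "\<phi> g"] assms(4) by simp
  next
    case (inv v g)
    have "x \<otimes>\<^bsub>H\<^esub> inv\<^bsub>H\<^esub> \<phi> (raag_gen K v) = inv\<^bsub>H\<^esub> \<phi> (raag_gen K v) \<otimes>\<^bsub>H\<^esub> x"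
      using inv by (intro \<phi>.H.commutes_inv x assms(4)) auto
    with inv show ?case using step[of "inv\<^bsub>H\<^esub> \<phi> (raag_gen K v)" "\<phi> g"] by simp
  qed
qed

section \<open>Exponent vectors and the abelianisation\<close>

text \<open>Chosen by \<open>SOME\<close> because the universal property provides only existence;
  the values on generators determine the homomorphism.\<close>

definition exponents :: "'v set set \<Rightarrow> 'v word set \<Rightarrow> 'v \<Rightarrow> int" where
  "exponents K = (SOME \<phi>. \<phi> \<in> hom (raag K) additive_group \<and>
     (\<forall>v\<in>vertices K. \<phi> (raag_gen K v) = (\<lambda>u. if u = v then 1 else 0)))"

context
  fixes K :: "'v set set"
  assumes K: "simplicial_complex K"
begin

interpretation G: group "raag K" by (rule group_raag)

lemma exponents_hom: "exponents K \<in> hom (raag K) additive_group"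
  and exponents_gen: "v \<in> vertices K \<Longrightarrow> exponents K (raag_gen K v) = (\<lambda>u. if u = v then 1 else 0)"
proof -
  obtain \<phi> where "\<phi> \<in> hom (raag K) (additive_group :: ('v \<Rightarrow> int) monoid)"
      "\<And>v. v \<in> vertices K \<Longrightarrow> \<phi> (raag_gen K v) = (\<lambda>u. if u = v then 1 else 0)"
    by (rule raag_universal[OF K group_additive_group, of "\<lambda>v u. if u = v then 1 else 0"])
      (auto simp: add.commute)
  then have "\<exists>\<phi>. \<phi> \<in> hom (raag K) (additive_group :: ('v \<Rightarrow> int) monoid) \<and>
      (\<forall>v\<in>vertices K. \<phi> (raag_gen K v) = (\<lambda>u. if u = v then 1 else 0))" by blast
  from someI_ex[OF this, folded exponents_def]
  show "exponents K \<in> hom (raag K) additive_group"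
    and "v \<in> vertices K \<Longrightarrow> exponents K (raag_gen K v) = (\<lambda>u. if u = v then 1 else 0)" by blast+
qed

lemma exponents_mult:
  "\<lbrakk>g \<in> carrier (raag K); h \<in> carrier (raag K)\<rbrakk> \<Longrightarrow>
    exponents K (g \<otimes>\<^bsub>raag K\<^esub> h) = exponents K g + exponents K h"
  using hom_mult[OF exponents_hom] by simp

lemma exponents_one: "exponents K \<one>\<^bsub>raag K\<^esub> = 0"
  using hom_one[OF exponents_hom G.is_group group_additive_group] by simp

lemma exponents_inv:
  assumes "g \<in> carrier (raag K)"
  shows "exponents K (inv\<^bsub>raag K\<^esub> g) = - exponents K g"
proof -
  have "exponents K (inv\<^bsub>raag K\<^esub> g) + exponents K g = 0"
    using exponents_mult[of "inv\<^bsub>raag K\<^esub> g" g] assms by (simp add: exponents_one)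
  then show ?thesis by (simp add: eq_neg_iff_add_eq_0)
qed

lemma exponents_outside:
  assumes "g \<in> carrier (raag K)" "v \<notin> vertices K"
  shows "exponents K g v = 0"
  using assms(1)
  by (induction rule: raag_induct)
    (use assms(2) in \<open>auto simp: exponents_one exponents_mult exponents_gen exponents_inv\<close>)

text \<open>Both sides are homomorphisms into a commutative group and agree on generators. Applied
  to the quotient by the commutator subgroup, this shows that elements with zero exponents lie in
  that subgroup.\<close>

lemma comm_group_hom_exponents:
  assumes fin: "finite (vertices K)" and A: "comm_group A" and \<psi>: "\<psi> \<in> hom (raag K) A"
    and g: "g \<in> carrier (raag K)"
  shows "\<psi> g = finprod A (\<lambda>v. \<psi> (raag_gen K v) [^]\<^bsub>A\<^esub> exponents K g v) (vertices K)"
proof -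
  interpret A: comm_group A by fact
  have cl: "\<psi> x \<in> carrier A" if "x \<in> carrier (raag K)" for x using that \<psi> by (auto simp: hom_def)
  have clg: "\<psi> (raag_gen K v) \<in> carrier A" if "v \<in> vertices K" for v using that by (simp add: cl)
  define \<theta> where "\<theta> g = finprod A (\<lambda>v. \<psi> (raag_gen K v) [^]\<^bsub>A\<^esub> exponents K g v) (vertices K)" for g
  show ?thesis
  proof (subst \<theta>_def[symmetric], rule raag_hom_eqI[OF A.is_group \<psi> _ _ g])
    show "\<theta> \<in> hom (raag K) A"
    proof (rule homI)
      show "\<theta> x \<in> carrier A" for x
        unfolding \<theta>_def by (intro A.finprod_closed) (auto simp: clg)
      fix x y assume xy: "x \<in> carrier (raag K)" "y \<in> carrier (raag K)"
      have "\<theta> (x \<otimes>\<^bsub>raag K\<^esub> y) = finprod A (\<lambda>v. \<psi> (raag_gen K v) [^]\<^bsub>A\<^esub> exponents K x v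
          \<otimes>\<^bsub>A\<^esub> \<psi> (raag_gen K v) [^]\<^bsub>A\<^esub> exponents K y v) (vertices K)"
        unfolding \<theta>_def using xy
        by (intro A.finprod_cong') (auto simp: clg exponents_mult A.int_pow_mult)
      then show "\<theta> (x \<otimes>\<^bsub>raag K\<^esub> y) = \<theta> x \<otimes>\<^bsub>A\<^esub> \<theta> y"
        unfolding \<theta>_def by (simp add: clg Pi_iff)
    qed
    fix v assume v: "v \<in> vertices K"
    have "\<theta> (raag_gen K v) = finprod A (\<lambda>u. if v = u then \<psi> (raag_gen K u) else \<one>\<^bsub>A\<^esub>) (vertices K)"
      unfolding \<theta>_def using v
      by (intro A.finprod_cong') (auto simp: clg exponents_gen)
    also have "\<dots> = \<psi> (raag_gen K v)"
      using A.finprod_singleton[OF v fin] clg by auto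
    finally show "\<psi> (raag_gen K v) = \<theta> (raag_gen K v)" by simp
  qed
qed

lemma commutator_subgroup_raag:
  assumes fin: "finite (vertices K)"
  shows "commutator_subgroup (raag K) = {g \<in> carrier (raag K). exponents K g = 0}"
proof (intro equalityI subsetI)
  let ?D = "commutator_subgroup (raag K)"
  fix g
  interpret D: normal ?D "raag K" by (rule G.derived_self_is_normal)
  interpret Q: comm_group "abelianisation (raag K)" by (rule G.derived_quot_is_comm_group)
  {
    assume g: "g \<in> {g \<in> carrier (raag K). exponents K g = 0}"
    then have "?D #>\<^bsub>raag K\<^esub> g = finprod (abelianisation (raag K))
        (\<lambda>v. (?D #>\<^bsub>raag K\<^esub> raag_gen K v) [^]\<^bsub>abelianisation (raag K)\<^esub> exponents K g v) (vertices K)"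
      using comm_group_hom_exponents[OF fin Q.comm_group_axioms D.r_coset_hom_Mod, of g] by simp
    also have "\<dots> = \<one>\<^bsub>abelianisation (raag K)\<^esub>"
      using g by (intro Q.finprod_one_eqI) simp
    finally have "?D #>\<^bsub>raag K\<^esub> g = \<one>\<^bsub>abelianisation (raag K)\<^esub>" .
    then show "g \<in> ?D"
      using g G.coset_join1[OF _ _ D.subgroup_axioms, of g] by (simp add: FactGroup_def)
  }
  assume "g \<in> ?D"
  then have "g \<in> carrier (raag K) \<and> exponents K g = 0"
    unfolding derived_def
  proof (induction rule: generate.induct)
    case (incl h)
    then show ?case by (auto simp: exponents_mult exponents_inv)
  next
    case (inv h)
    then show ?case by (auto simp: exponents_mult exponents_inv)
  qed (auto simp: exponents_one exponents_mult)
  then show "g \<in> {g \<in> carrier (raag K). exponents K g = 0}" by blast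
qed

lemma commutator_coset_eq_iff:
  assumes fin: "finite (vertices K)" and "g \<in> carrier (raag K)" "h \<in> carrier (raag K)"
  shows "commutator_subgroup (raag K) #>\<^bsub>raag K\<^esub> g = commutator_subgroup (raag K) #>\<^bsub>raag K\<^esub> h
    \<longleftrightarrow> exponents K g = exponents K h"
proof -
  let ?D = "commutator_subgroup (raag K)"
  interpret D: normal ?D "raag K" by (rule G.derived_self_is_normal)
  have "?D #>\<^bsub>raag K\<^esub> g = ?D #>\<^bsub>raag K\<^esub> h \<longleftrightarrow> g \<otimes>\<^bsub>raag K\<^esub> inv\<^bsub>raag K\<^esub> h \<in> ?D"
  proof -
    have "?D #>\<^bsub>raag K\<^esub> g = ?D #>\<^bsub>raag K\<^esub> h \<longleftrightarrow> g \<in> ?D #>\<^bsub>raag K\<^esub> h"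
      using G.rcos_self[OF assms(2) D.subgroup_axioms]
        G.repr_independence[OF _ assms(3) D.subgroup_axioms, of g] by auto
    then show ?thesis using D.rcos_module[OF G.is_group assms(3,2)] by simp
  qed
  also have "\<dots> \<longleftrightarrow> exponents K g = exponents K h"
  proof -
    have c: "g \<otimes>\<^bsub>raag K\<^esub> inv\<^bsub>raag K\<^esub> h \<in> carrier (raag K)" using assms by simp
    have "exponents K (g \<otimes>\<^bsub>raag K\<^esub> inv\<^bsub>raag K\<^esub> h) = exponents K g - exponents K h"
      using exponents_mult[OF assms(2) G.inv_closed[OF assms(3)]] exponents_inv[OF assms(3)] by simp
    with c show ?thesis unfolding commutator_subgroup_raag[OF fin] by simp
  qed
  finally show ?thesis .
qed

end

section \<open>Fibre products that are not finitely presented\<close>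

text \<open>The invertible affine maps of the rational line, \<open>(t, b)\<close> standing for the
  map that takes \<open>x\<close> to \<open>b + t * x\<close>. The translation part of a
  homomorphism into this group is a derivation.\<close>

definition affine_group :: "(rat \<times> rat) monoid" where
  "affine_group = \<lparr>carrier = {(t, b). t \<noteq> 0}, mult = (\<lambda>(t, b) (t', b'). (t * t', b + t * b')), one = (1, 0)\<rparr>"

lemma group_affine_group: "group affine_group"
proof (rule groupI)
  show "\<exists>y\<in>carrier affine_group. y \<otimes>\<^bsub>affine_group\<^esub> x = \<one>\<^bsub>affine_group\<^esub>"
    if "x \<in> carrier affine_group" for x
    using that by (cases x, intro bexI[of _ "(1 / fst x, - snd x / fst x)"]) (auto simp: affine_group_def)
qed (auto simp: affine_group_def algebra_simps)

text \<open>The condition on \<delta> says exactly that \<open>(\<tau> u, \<delta> u)\<close> and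
  \<open>(\<tau> v, \<delta> v)\<close> commute in \<open>affine_group\<close>, so the universal
  property applies.\<close>

lemma raag_derivation:
  fixes \<tau> \<delta> :: "'v \<Rightarrow> rat"
  assumes K: "simplicial_complex K" and \<tau>: "\<And>v. v \<in> vertices K \<Longrightarrow> \<tau> v \<noteq> 0"
    and \<delta>: "\<And>u v. {u, v} \<in> K \<Longrightarrow> (1 - \<tau> v) * \<delta> u = (1 - \<tau> u) * \<delta> v"
  obtains t D where
    "\<forall>g\<in>carrier (raag K). t g \<noteq> 0"
    "\<forall>g\<in>carrier (raag K). \<forall>h\<in>carrier (raag K). t (g \<otimes>\<^bsub>raag K\<^esub> h) = t g * t h"
    "\<forall>g\<in>carrier (raag K). \<forall>h\<in>carrier (raag K). D (g \<otimes>\<^bsub>raag K\<^esub> h) = D g + t g * D h"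
    "\<forall>v\<in>vertices K. t (raag_gen K v) = \<tau> v \<and> D (raag_gen K v) = \<delta> v"
proof -
  have comm: "(\<tau> u, \<delta> u) \<otimes>\<^bsub>affine_group\<^esub> (\<tau> v, \<delta> v) = (\<tau> v, \<delta> v) \<otimes>\<^bsub>affine_group\<^esub> (\<tau> u, \<delta> u)"
    if "{u, v} \<in> K" for u v
    using \<delta>[OF that] by (simp add: affine_group_def algebra_simps)
  obtain \<phi> where \<phi>: "\<phi> \<in> hom (raag K) affine_group"
      "\<And>v. v \<in> vertices K \<Longrightarrow> \<phi> (raag_gen K v) = (\<tau> v, \<delta> v)"
    by (rule raag_universal[OF K group_affine_group, of "\<lambda>v. (\<tau> v, \<delta> v)"])
      (use \<tau> comm in \<open>auto simp: affine_group_def\<close>)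
  have m: "\<phi> (g \<otimes>\<^bsub>raag K\<^esub> h) = (fst (\<phi> g) * fst (\<phi> h), snd (\<phi> g) + fst (\<phi> g) * snd (\<phi> h))"
    if "g \<in> carrier (raag K)" "h \<in> carrier (raag K)" for g h
    using hom_mult[OF \<phi>(1) that] by (simp add: affine_group_def split: prod.splits)
  have "fst (\<phi> g) \<noteq> 0" if "g \<in> carrier (raag K)" for g
    using \<phi>(1) that by (auto simp: hom_def affine_group_def Pi_iff)
  with m \<phi>(2) show ?thesis by (intro that[of "\<lambda>g. fst (\<phi> g)" "\<lambda>g. snd (\<phi> g)"]) simp_all
qed

text \<open>The integral character with values \<chi> on the generators.\<close>

definition exponent_sum :: "'v set set \<Rightarrow> ('v \<Rightarrow> int) \<Rightarrow> 'v word set \<Rightarrow> int" where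
  "exponent_sum K \<chi> g = (\<Sum>v\<in>vertices K. \<chi> v * exponents K g v)"

lemma exponent_sum_mult:
  "\<lbrakk>simplicial_complex K; g \<in> carrier (raag K); h \<in> carrier (raag K)\<rbrakk> \<Longrightarrow>
    exponent_sum K \<chi> (g \<otimes>\<^bsub>raag K\<^esub> h) = exponent_sum K \<chi> g + exponent_sum K \<chi> h"
  by (simp add: exponent_sum_def exponents_mult algebra_simps sum.distrib)

lemma exponent_sum_gen:
  "\<lbrakk>simplicial_complex K; finite (vertices K); v \<in> vertices K\<rbrakk> \<Longrightarrow>
    exponent_sum K \<chi> (raag_gen K v) = \<chi> v"
  by (simp add: exponent_sum_def exponents_gen if_distrib cong: if_cong)

lemma rat_2_powi_eq_1_iff: "(2 :: rat) powi m = 1 \<longleftrightarrow> m = 0"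
proof
  assume "(2 :: rat) powi m = 1"
  then show "m = 0"
    using power_int_strict_increasing[of 0 m "2::rat"] power_int_strict_increasing[of m 0 "2::rat"]
    by (cases m "0::int" rule: linorder_cases) auto
qed simp

text \<open>
  The character \<open>\<chi>\<close> makes the group act on the rationals through \<open>2 ^ \<chi>\<close>. Since \<open>\<chi>\<close> is trivial on
  the separator, one may prescribe a derivation independently on the two sides of it, so that it does
  not vanish on some commutator; conjugation then gives values with arbitrarily large denominators.
\<close>

lemma separated_derivation_aux:
  fixes \<chi> :: "'v \<Rightarrow> int"
  assumes K: "simplicial_complex K" and fin: "finite (vertices K)"
    and AB: "A \<union> B = vertices K - S" "A \<inter> B = {}" "A \<noteq> {}"
    and sep: "\<And>a b. \<lbrakk>a \<in> A; b \<in> B\<rbrakk> \<Longrightarrow> {a, b} \<notin> K"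
    and \<chi>: "\<And>v. v \<in> S \<Longrightarrow> \<chi> v = 0" and b: "b \<in> B" "\<chi> b \<noteq> 0"
  obtains D k where
    "\<And>g h. \<lbrakk>g \<in> carrier (raag K); h \<in> carrier (raag K)\<rbrakk> \<Longrightarrow>
       D (g \<otimes>\<^bsub>raag K\<^esub> h) = D g + 2 powi exponent_sum K \<chi> g * D h"
    "k \<in> commutator_subgroup (raag K)" "D k \<noteq> (0 :: rat)"
proof -
  interpret G: group "raag K" by (rule group_raag)
  define \<tau> :: "'v \<Rightarrow> rat" where "\<tau> v = 2 powi \<chi> v" for v
  have sep': "{x, y} \<notin> K" if "x \<in> A \<and> y \<in> B \<or> x \<in> B \<and> y \<in> A" for x y
    using that sep[of x y] sep[of y x] by (auto simp: insert_commute)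
  have V: "v \<in> A \<or> v \<in> B \<or> v \<in> S" if "v \<in> vertices K" for v using that AB by blast
  have \<tau>S: "\<tau> v = 1" if "v \<in> S" for v using that \<chi> by (simp add: \<tau>_def)
  have disj: "v \<in> A \<Longrightarrow> v \<notin> B \<and> v \<notin> S" "v \<in> B \<Longrightarrow> v \<notin> A \<and> v \<notin> S" for v using AB by blast+
  obtain a where a: "a \<in> A" "(\<exists>a\<in>A. \<chi> a \<noteq> 0) \<Longrightarrow> \<chi> a \<noteq> 0" using AB(3) by blast
  \<comment> \<open>If \<chi> is nonzero somewhere on \<open>A\<close>, take the inner derivation
    \<open>\<tau> - 1\<close> on \<open>B\<close> and the zero derivation on \<open>A\<close>; both
    vanish on \<open>S\<close>, where \<tau> is one. Otherwise \<open>A\<close> acts trivially, and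
    a constant on \<open>A\<close> is compatible with every edge.\<close>
  define \<delta> :: "'v \<Rightarrow> rat" where
    "\<delta> v = (if \<chi> a \<noteq> 0 then if v \<in> B then \<tau> v - 1 else 0 else if v \<in> A then 1 else 0)" for v
  have \<delta>: "(1 - \<tau> v) * \<delta> u = (1 - \<tau> u) * \<delta> v" if "{u, v} \<in> K" for u v
  proof -
    have u: "u \<in> A \<or> u \<in> B \<or> u \<in> S" and v: "v \<in> A \<or> v \<in> B \<or> v \<in> S"
      using V edge_vertices[OF K that] by blast+
    show ?thesis
    proof (cases "\<chi> a = 0")
      case False
      then show ?thesis using u v sep'[of u v] that disj \<tau>S by (auto simp: \<delta>_def algebra_simps)
    next
      case True
      then have "\<chi> x = 0" if "x \<in> A" for x using a(2) that by blast
      then have "\<tau> x = 1" if "x \<in> A" for x using that by (simp add: \<tau>_def)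
      then show ?thesis using True u v sep'[of u v] that disj \<tau>S by (auto simp: \<delta>_def)
    qed
  qed
  have \<tau>0: "\<tau> v \<noteq> 0" for v by (simp add: \<tau>_def)
  obtain t D where tD: "\<forall>g\<in>carrier (raag K). t g \<noteq> 0"
    "\<forall>g\<in>carrier (raag K). \<forall>h\<in>carrier (raag K). t (g \<otimes>\<^bsub>raag K\<^esub> h) = t g * t h"
    "\<forall>g\<in>carrier (raag K). \<forall>h\<in>carrier (raag K). D (g \<otimes>\<^bsub>raag K\<^esub> h) = D g + t g * D h"
    "\<forall>v\<in>vertices K. t (raag_gen K v) = \<tau> v \<and> D (raag_gen K v) = \<delta> v"
    by (rule raag_derivation[where \<tau> = \<tau> and \<delta> = \<delta>, OF K \<tau>0 \<delta>])
  have t: "t g \<noteq> 0" "t (g \<otimes>\<^bsub>raag K\<^esub> h) = t g * t h"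
    and D1: "D (g \<otimes>\<^bsub>raag K\<^esub> h) = D g + t g * D h"
    if "g \<in> carrier (raag K)" "h \<in> carrier (raag K)" for g h
    using tD that by blast+
  have tv: "t (raag_gen K v) = \<tau> v" and Dv: "D (raag_gen K v) = \<delta> v" if "v \<in> vertices K" for v
    using tD(4) that by blast+
  have t1: "t \<one>\<^bsub>raag K\<^esub> = 1" using t(1)[of "\<one>\<^bsub>raag K\<^esub>" "\<one>\<^bsub>raag K\<^esub>"] t(2)[of "\<one>\<^bsub>raag K\<^esub>" "\<one>\<^bsub>raag K\<^esub>"] by simp
  have t_eq: "t g = 2 powi exponent_sum K \<chi> g" if "g \<in> carrier (raag K)" for g
    using that
  proof (induction rule: raag_induct)
    case one
    then show ?case by (simp add: t1 exponent_sum_def exponents_one[OF K])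
  next
    case (gen v g)
    then show ?case
      by (simp add: t(2) tv exponent_sum_mult[OF K] exponent_sum_gen[OF K fin] \<tau>_def power_int_add)
  next
    case (inv v g)
    have "t (inv\<^bsub>raag K\<^esub> raag_gen K v) * \<tau> v = 1"
      using t(2)[of "inv\<^bsub>raag K\<^esub> raag_gen K v" "raag_gen K v"] inv t1 tv by simp
    moreover have "exponent_sum K \<chi> (inv\<^bsub>raag K\<^esub> raag_gen K v) = - \<chi> v"
      using exponent_sum_gen[OF K fin inv(1), of \<chi>] inv(1)
      by (simp add: exponent_sum_def exponents_inv[OF K] sum_negf)
    moreover have "t (inv\<^bsub>raag K\<^esub> raag_gen K v) = 2 powi (- \<chi> v)"
      using calculation(1) by (simp add: \<tau>_def power_int_minus eq_divide_eq inverse_eq_divide)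
    ultimately show ?case
      using inv power_int_add[of "2::rat" "- \<chi> v" "exponent_sum K \<chi> g"]
      by (simp add: t(2) exponent_sum_mult[OF K])
  qed
  let ?a = "raag_gen K a" and ?b = "raag_gen K b"
  have ab: "a \<in> vertices K" "b \<in> vertices K" using a b AB by blast+
  then have ab': "?a \<in> carrier (raag K)" "?b \<in> carrier (raag K)" by simp_all
  define k where "k = ?a \<otimes>\<^bsub>raag K\<^esub> ?b \<otimes>\<^bsub>raag K\<^esub> inv\<^bsub>raag K\<^esub> ?a \<otimes>\<^bsub>raag K\<^esub> inv\<^bsub>raag K\<^esub> ?b"
  have k: "k \<in> commutator_subgroup (raag K)"
    unfolding derived_def k_def using ab' by (intro generate.incl) blast
  have kc: "k \<in> carrier (raag K)" using ab' by (simp add: k_def)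
  have cancel: "inv\<^bsub>raag K\<^esub> x \<otimes>\<^bsub>raag K\<^esub> (x \<otimes>\<^bsub>raag K\<^esub> y) = y"
    if "x \<in> carrier (raag K)" "y \<in> carrier (raag K)" for x y
    using that by (simp flip: G.m_assoc)
  have "k \<otimes>\<^bsub>raag K\<^esub> (?b \<otimes>\<^bsub>raag K\<^esub> ?a) = ?a \<otimes>\<^bsub>raag K\<^esub> ?b"
    using ab' by (simp add: k_def G.m_assoc cancel)
  then have "D k + t k * (\<delta> b + \<tau> b * \<delta> a) = \<delta> a + \<tau> a * \<delta> b" "t k = 1"
    using ab ab' kc D1[of k "?b \<otimes>\<^bsub>raag K\<^esub> ?a"] t(2)[of k "?b \<otimes>\<^bsub>raag K\<^esub> ?a"]
    by (auto simp: D1 t(2) tv Dv \<tau>0)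
  \<comment> \<open>If \<open>\<chi> a\<close> is nonzero, then \<open>\<delta> a\<close> vanishes
    and \<open>\<delta> b\<close> is \<open>\<tau> b - 1\<close>; otherwise
    \<open>\<delta> b\<close> vanishes and \<open>\<delta> a\<close> is one. Either way exactly one
    product survives, with nonzero factors.\<close>
  then have "D k = (\<tau> a - 1) * \<delta> b + (1 - \<tau> b) * \<delta> a"
    by (simp add: algebra_simps)
  moreover have "\<tau> a \<noteq> 1" if "\<chi> a \<noteq> 0" using that by (simp add: \<tau>_def rat_2_powi_eq_1_iff)
  moreover have "\<tau> b \<noteq> 1" using b(2) by (simp add: \<tau>_def rat_2_powi_eq_1_iff)
  ultimately have "D k \<noteq> 0" using a(1) b(1) disj by (auto simp: \<delta>_def)
  with that[of D k] D1 t_eq k show ?thesis by simp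
qed

lemma separated_derivation:
  fixes \<chi> :: "'v \<Rightarrow> int"
  assumes K: "simplicial_complex K" and fin: "finite (vertices K)"
    and S: "\<not> complex_connected (remove_vertices K S)"
    and \<chi>: "\<And>v. v \<in> S \<Longrightarrow> \<chi> v = 0" and w: "w \<in> vertices K" "\<chi> w \<noteq> 0"
  obtains D k where
    "\<And>g h. \<lbrakk>g \<in> carrier (raag K); h \<in> carrier (raag K)\<rbrakk> \<Longrightarrow>
       D (g \<otimes>\<^bsub>raag K\<^esub> h) = D g + 2 powi exponent_sum K \<chi> g * D h"
    "k \<in> commutator_subgroup (raag K)" "D k \<noteq> (0 :: rat)"
proof -
  let ?E = "{(x, y). {x, y} \<in> remove_vertices K S}"
  have V: "vertices (remove_vertices K S) = vertices K - S"
    by (auto simp: vertices_def remove_vertices_def)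
  obtain u v where uv: "u \<in> vertices K - S" "v \<in> vertices K - S" "(u, v) \<notin> ?E\<^sup>*"
    using S unfolding complex_connected_def V by blast
  define A where "A = {x \<in> vertices K - S. (u, x) \<in> ?E\<^sup>*}"
  define B where "B = vertices K - S - A"
  have AB: "A \<union> B = vertices K - S" "A \<inter> B = {}" by (auto simp: A_def B_def)
  have ne: "u \<in> A" "v \<in> B" using uv by (auto simp: A_def B_def)
  have sep: "{a, b} \<notin> K" if "a \<in> A" "b \<in> B" for a b
  proof
    assume "{a, b} \<in> K"
    then have "(a, b) \<in> ?E" using that AB by (auto simp: remove_vertices_def)
    moreover have "(u, a) \<in> ?E\<^sup>*" using that by (simp add: A_def)
    ultimately have "(u, b) \<in> ?E\<^sup>*" by (rule rtrancl_into_rtrancl[rotated])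
    then show False using that by (auto simp: A_def B_def)
  qed
  \<comment> \<open>\<open>w\<close> is outside \<open>S\<close>, where \<chi> vanishes; the two
    sides are named so that \<open>w\<close> falls into the second.\<close>
  have "w \<in> A \<or> w \<in> B" using w \<chi> AB by blast
  then show ?thesis
  proof
    assume "w \<in> B"
    then show ?thesis
      using separated_derivation_aux[where \<chi> = \<chi> and b = w, OF K fin AB _ sep \<chi> _ w(2)] ne that by blast
  next
    assume "w \<in> A"
    have sep': "{a, b} \<notin> K" if "a \<in> B" "b \<in> A" for a b
      using sep[OF that(2,1)] by (simp add: insert_commute)
    have BA: "B \<union> A = vertices K - S" "B \<inter> A = {}" using AB by blast+
    show ?thesis
      using separated_derivation_aux[where \<chi> = \<chi> and b = w, OF K fin BA _ sep' \<chi> \<open>w \<in> A\<close> w(2)] ne that by blast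
  qed
qed

lemma group_fibre_product:
  assumes "group G" "\<mu> \<in> iso (abelianisation G) (abelianisation G)"
  shows "group (fibre_product G \<mu>)"
proof -
  have "fibre_product G \<mu> = (G \<times>\<times> G)\<lparr>carrier := carrier (fibre_product G \<mu>)\<rparr>"
    by (simp add: fibre_product_def)
  then show ?thesis
    using subgroup.subgroup_is_group[OF subgroup_fibre_product[OF assms] DirProd_group[OF assms(1,1)]]
    by simp
qed

lemma fibre_product_mult: "(g, h) \<otimes>\<^bsub>fibre_product G \<mu>\<^esub> (g', h') = (g \<otimes>\<^bsub>G\<^esub> g', h \<otimes>\<^bsub>G\<^esub> h')"
  by (simp add: fibre_product_def)

text \<open>\<open>D\<close> at inverses is a right derivation and \<open>D'\<close>, taken for
  \<open>- \<chi>'\<close>, a left one. Both are derivations over a single character of the fibre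
  product because the two exponent sums agree on it. A commutator element paired with one lies in
  every fibre product, and elements of different factors commute.\<close>

theorem fibre_product_not_finitely_presented:
  fixes \<chi> \<chi>' :: "'v \<Rightarrow> int"
  assumes K: "simplicial_complex K" and fin: "finite (vertices K)"
    and \<mu>: "\<mu> \<in> iso (abelianisation (raag K)) (abelianisation (raag K))"
    and S: "\<not> complex_connected (remove_vertices K S)"
    and \<chi>: "\<And>v. v \<in> S \<Longrightarrow> \<chi> v = 0" and w: "w \<in> vertices K" "\<chi> w \<noteq> 0"
    and \<chi>': "\<And>v. v \<in> S \<Longrightarrow> \<chi>' v = 0" and w': "w' \<in> vertices K" "\<chi>' w' \<noteq> 0"
    and eq: "\<And>g h. (g, h) \<in> carrier (fibre_product (raag K) \<mu>) \<Longrightarrow>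
      exponent_sum K \<chi> g = exponent_sum K \<chi>' h"
  shows "\<not> finitely_presented (fibre_product (raag K) \<mu>)"
proof -
  interpret G: group "raag K" by (rule group_raag)
  let ?G = "raag K" and ?P = "fibre_product (raag K) \<mu>" and ?D = "commutator_subgroup (raag K)"
  interpret Der: normal ?D ?G by (rule G.derived_self_is_normal)
  obtain D k where D: "\<And>g h. \<lbrakk>g \<in> carrier ?G; h \<in> carrier ?G\<rbrakk> \<Longrightarrow>
       D (g \<otimes>\<^bsub>?G\<^esub> h) = D g + 2 powi exponent_sum K \<chi> g * D h"
    and k: "k \<in> ?D" "D k \<noteq> (0 :: rat)"
    using separated_derivation[where \<chi> = \<chi>, OF K fin S \<chi> w] by blast
  have "\<And>v. v \<in> S \<Longrightarrow> - \<chi>' v = 0" "- \<chi>' w' \<noteq> 0" using \<chi>' w' by simp_all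
  from separated_derivation[where \<chi> = "\<lambda>v. - \<chi>' v", OF K fin S this(1) w'(1) this(2)]
  obtain D' k' where D': "\<And>g h. \<lbrakk>g \<in> carrier ?G; h \<in> carrier ?G\<rbrakk> \<Longrightarrow>
       D' (g \<otimes>\<^bsub>?G\<^esub> h) = D' g + 2 powi exponent_sum K (\<lambda>v. - \<chi>' v) g * D' h"
    and k': "k' \<in> ?D" "D' k' \<noteq> (0 :: rat)"
    by blast
  have neg: "exponent_sum K (\<lambda>v. - \<chi>' v) g = - exponent_sum K \<chi>' g" for g
    by (simp add: exponent_sum_def sum_negf)
  have D1: "D \<one>\<^bsub>?G\<^esub> = 0" and D'1: "D' \<one>\<^bsub>?G\<^esub> = 0"
    using D[of "\<one>\<^bsub>?G\<^esub>" "\<one>\<^bsub>?G\<^esub>"] D'[of "\<one>\<^bsub>?G\<^esub>" "\<one>\<^bsub>?G\<^esub>"]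
    by (simp_all add: exponent_sum_def exponents_one[OF K])
  have Dinv: "D (inv\<^bsub>?G\<^esub> g) = - (2 powi (- exponent_sum K \<chi> g)) * D g" if "g \<in> carrier ?G" for g
    using D[of g "inv\<^bsub>?G\<^esub> g"] that D1 by (simp add: power_int_minus field_simps)
  have einv: "exponent_sum K \<chi> (inv\<^bsub>?G\<^esub> g) = - exponent_sum K \<chi> g" if "g \<in> carrier ?G" for g
    using that by (simp add: exponent_sum_def exponents_inv[OF K] sum_negf)
  have e0: "exponent_sum K \<chi> g = 0" if "g \<in> ?D" for g
  proof -
    have "exponents K g = 0" using that unfolding commutator_subgroup_raag[OF K fin] by blast
    then show ?thesis by (simp add: exponent_sum_def)
  qed
  have Dc: "g \<in> carrier ?G" if "g \<in> ?D" for g using that Der.subset by blast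
  \<comment> \<open>Conjugation by \<open>u\<close> divides \<open>D\<close> by \<open>2 ^ m\<close>
    on elements of exponent sum zero, which produces the growing denominators.\<close>
  obtain u m where u: "u \<in> carrier ?G" "exponent_sum K \<chi> u = - int m" "m > 0"
  proof (cases "\<chi> w > 0")
    case True
    then show ?thesis
      using that[of "inv\<^bsub>?G\<^esub> raag_gen K w" "nat (\<chi> w)"] w
      by (simp add: einv exponent_sum_gen[OF K fin])
  next
    case False
    then show ?thesis
      using that[of "raag_gen K w" "nat (- \<chi> w)"] w
      by (simp add: exponent_sum_gen[OF K fin])
  qed
  define c where "c n = ((\<lambda>x. u \<otimes>\<^bsub>?G\<^esub> x \<otimes>\<^bsub>?G\<^esub> inv\<^bsub>?G\<^esub> u) ^^ n) k" for n
  have c: "c n \<in> ?D \<and> D (c n) = D k / (2 ^ m) ^ n" for n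
  proof (induction n)
    case (Suc n)
    have cS: "c (Suc n) = u \<otimes>\<^bsub>?G\<^esub> c n \<otimes>\<^bsub>?G\<^esub> inv\<^bsub>?G\<^esub> u" by (simp add: c_def)
    have cc: "c n \<in> carrier ?G" using Suc Dc by blast
    have "D (c (Suc n)) = 2 powi (- int m) * D (c n)"
      unfolding cS using u cc Suc e0[of "c n"]
      by (simp add: D exponent_sum_mult[OF K] Dinv power_int_minus)
    moreover have "c (Suc n) \<in> ?D" unfolding cS using Der.inv_op_closed2[OF u(1)] Suc by simp
    ultimately show ?case using Suc by (simp add: power_int_minus field_simps)
  qed (simp add: c_def k)
  have mu1: "\<mu> ?D = ?D"
  proof -
    have "group (abelianisation ?G)" by (rule Der.factorgroup_is_group)
    then have "\<mu> \<one>\<^bsub>abelianisation ?G\<^esub> = \<one>\<^bsub>abelianisation ?G\<^esub>"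
      using \<mu> by (intro hom_one) (auto simp: iso_def)
    then show ?thesis by (simp add: FactGroup_def)
  qed
  have coset: "?D #>\<^bsub>?G\<^esub> g = ?D" if "g \<in> ?D" for g
    using that Dc[OF that] by (intro G.coset_join2) (auto simp: Der.subgroup_axioms)
  have one: "\<one>\<^bsub>?G\<^esub> \<in> ?D" by (rule Der.one_closed)
  have memP: "(g, h) \<in> carrier ?P" if "g \<in> ?D" "h \<in> ?D" for g h
    using that Dc by (simp add: fibre_product_def coset mu1)
  have Pc: "fst p \<in> carrier ?G" "snd p \<in> carrier ?G"
    "exponent_sum K \<chi> (fst p) = exponent_sum K \<chi>' (snd p)"
    if "p \<in> carrier ?P" for p
    using that eq[of "fst p" "snd p"] by (auto simp: fibre_product_def)
  have Pm: "fst (p \<otimes>\<^bsub>?P\<^esub> q) = fst p \<otimes>\<^bsub>?G\<^esub> fst q" "snd (p \<otimes>\<^bsub>?P\<^esub> q) = snd p \<otimes>\<^bsub>?G\<^esub> snd q" for p q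
    by (cases p; cases q; simp add: fibre_product_mult)+
  show ?thesis
  proof (rule not_finitely_presentedI[where
        s = "\<lambda>p. 2 powi (- exponent_sum K \<chi> (fst p))" and e = "\<lambda>p. D (inv\<^bsub>?G\<^esub> (fst p))" and
        d = "\<lambda>p. D' (snd p)" and h = "(\<one>\<^bsub>?G\<^esub>, k')" and k = "\<lambda>n. (c n, \<one>\<^bsub>?G\<^esub>)" and
        x = "- D k * D' k'" and y = "2 ^ m"])
    show "group ?P" by (rule group_fibre_product[OF G.is_group \<mu>])
    show "2 powi (- exponent_sum K \<chi> (fst (p \<otimes>\<^bsub>?P\<^esub> q))) =
        2 powi (- exponent_sum K \<chi> (fst p)) * (2 powi (- exponent_sum K \<chi> (fst q)) :: rat)"
      if "p \<in> carrier ?P" "q \<in> carrier ?P" for p q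
      using Pc[OF that(1)] Pc[OF that(2)]
      by (simp add: Pm exponent_sum_mult[OF K] power_int_add[symmetric])
    show "D (inv\<^bsub>?G\<^esub> (fst (p \<otimes>\<^bsub>?P\<^esub> q))) =
        D (inv\<^bsub>?G\<^esub> (fst p)) * 2 powi (- exponent_sum K \<chi> (fst q)) + D (inv\<^bsub>?G\<^esub> (fst q))"
      if "p \<in> carrier ?P" "q \<in> carrier ?P" for p q
      using Pc[OF that(1)] Pc[OF that(2)]
      by (simp add: Pm G.inv_mult_group D einv)
    show "D' (snd (p \<otimes>\<^bsub>?P\<^esub> q)) = D' (snd p) + 2 powi (- exponent_sum K \<chi> (fst p)) * D' (snd q)"
      if "p \<in> carrier ?P" "q \<in> carrier ?P" for p q
      using Pc[OF that(1)] Pc[OF that(2)] by (simp add: Pm D' neg)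
    show "(\<one>\<^bsub>?G\<^esub>, k') \<in> carrier ?P" "(c n, \<one>\<^bsub>?G\<^esub>) \<in> carrier ?P" for n
      using memP one k' c by blast+
    show "(c n, \<one>\<^bsub>?G\<^esub>) \<otimes>\<^bsub>?P\<^esub> (\<one>\<^bsub>?G\<^esub>, k') = (\<one>\<^bsub>?G\<^esub>, k') \<otimes>\<^bsub>?P\<^esub> (c n, \<one>\<^bsub>?G\<^esub>)" for n
      using Dc c[of n] k'(1) by (simp add: fibre_product_mult)
    show "D (inv\<^bsub>?G\<^esub> (fst (c n, \<one>\<^bsub>?G\<^esub>))) * D' (snd (\<one>\<^bsub>?G\<^esub>, k')) = - D k * D' k' / (2 ^ m) ^ n" for n
      using c[of n] Dc e0 by (simp add: Dinv)
    show "(2::rat) \<le> 2 ^ m" using power_increasing[of 1 m "2::rat"] u(3) by simp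
  qed (use k k' D'1 in auto)
qed

section \<open>Integral characters subject to linear conditions\<close>

text \<open>Elimination without division, which keeps the solution integral: equation
  \<open>e\<close> removes the unknown \<open>w\<close>, and the other equations are
  cross-multiplied by its coefficient.\<close>

lemma homogeneous_system_nonzero_solution:
  fixes A :: "'e \<Rightarrow> 'v \<Rightarrow> int"
  assumes "finite E" "finite V" "card E < card V"
  shows "\<exists>x. (\<exists>v\<in>V. x v \<noteq> 0) \<and> (\<forall>e\<in>E. (\<Sum>v\<in>V. A e v * x v) = 0)"
  using assms
proof (induction E arbitrary: V A rule: finite_induct)
  case empty
  then have "V \<noteq> {}" by auto
  then show ?case by (intro exI[of _ "\<lambda>_. 1"]) auto
next
  case (insert e E)
  show ?case
  proof (cases "\<exists>w\<in>V. A e w \<noteq> 0")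
    case False
    have "card E < card V" using insert by simp
    from insert.IH[OF insert.prems(1) this, of A] False show ?thesis by auto
  next
    case True
    then obtain w where w: "w \<in> V" "A e w \<noteq> 0" by blast
    define V' where "V' = V - {w}"
    have V': "finite V'" "w \<notin> V'" "V = insert w V'" "card E < card V'"
      using insert w by (auto simp: V'_def)
    from insert.IH[OF V'(1,4), of "\<lambda>f v. A e w * A f v - A f w * A e v"]
    obtain x where x: "\<exists>v\<in>V'. x v \<noteq> 0"
        "\<And>f. f \<in> E \<Longrightarrow> (\<Sum>v\<in>V'. (A e w * A f v - A f w * A e v) * x v) = 0" by blast
    \<comment> \<open>Scaling the other unknowns by \<open>A e w\<close> lets equation
      \<open>e\<close> be solved for \<open>w\<close> over the integers.\<close>
    define y where "y v = (if v = w then - (\<Sum>v\<in>V'. A e v * x v) else A e w * x v)" for v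
    have sum: "(\<Sum>v\<in>V. A f v * y v) = (\<Sum>v\<in>V'. (A e w * A f v - A f w * A e v) * x v)" for f
    proof -
      have "(\<Sum>v\<in>V. A f v * y v) = A f w * y w + (\<Sum>v\<in>V'. A f v * y v)"
        using V' by simp
      also have "(\<Sum>v\<in>V'. A f v * y v) = (\<Sum>v\<in>V'. A e w * A f v * x v)"
        using V'(2) by (intro sum.cong) (auto simp: y_def)
      also have "A f w * y w = - (\<Sum>v\<in>V'. A f w * A e v * x v)"
        by (simp add: y_def sum_distrib_left mult.assoc)
      finally show ?thesis by (simp add: left_diff_distrib sum_subtractf)
    qed
    have "\<exists>v\<in>V. y v \<noteq> 0"
      using x(1) V' w(2) by (auto simp: y_def)
    moreover have "(\<Sum>v\<in>V. A f v * y v) = 0" if "f \<in> insert e E" for f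
      using that x(2)[of f] unfolding sum by auto
    ultimately show ?thesis by blast
  qed
qed

text \<open>Row \<open>v\<close> of the matrix of \<mu> is the exponent vector of some partner of
  the generator \<open>v\<close>; multiplying by that pair or its inverse strips a generator from
  \<open>g\<close> and drives the induction. The second part serves to show that a nonzero character
  has a nonzero pullback.\<close>

lemma fibre_product_exponents:
  assumes K: "simplicial_complex K" and fin: "finite (vertices K)"
    and \<mu>: "\<mu> \<in> iso (abelianisation (raag K)) (abelianisation (raag K))"
  obtains M where
    "\<And>g h u. (g, h) \<in> carrier (fibre_product (raag K) \<mu>) \<Longrightarrow>
       exponents K h u = (\<Sum>v\<in>vertices K. exponents K g v * M v u)"
    "\<And>h. h \<in> carrier (raag K) \<Longrightarrow> \<exists>g. (g, h) \<in> carrier (fibre_product (raag K) \<mu>)"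
proof -
  let ?G = "raag K" and ?P = "fibre_product (raag K) \<mu>" and ?D = "commutator_subgroup (raag K)"
  interpret G: group ?G by (rule group_raag)
  interpret P: group ?P by (rule group_fibre_product[OF G.is_group \<mu>])
  interpret Der: normal ?D ?G by (rule G.derived_self_is_normal)
  have carr: "carrier (abelianisation ?G) = (\<lambda>g. ?D #>\<^bsub>?G\<^esub> g) ` carrier ?G"
    by (auto simp: FactGroup_def RCOSETS_def)
  have bij: "bij_betw \<mu> (carrier (abelianisation ?G)) (carrier (abelianisation ?G))"
    using \<mu> by (simp add: iso_def)
  have memP: "(g, h) \<in> carrier ?P \<longleftrightarrow> g \<in> carrier ?G \<and> h \<in> carrier ?G \<and>
      \<mu> (?D #>\<^bsub>?G\<^esub> g) = ?D #>\<^bsub>?G\<^esub> h" for g h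
    by (simp add: fibre_product_def)
  have right: "\<exists>h. (g, h) \<in> carrier ?P" if "g \<in> carrier ?G" for g
  proof -
    have "\<mu> (?D #>\<^bsub>?G\<^esub> g) \<in> carrier (abelianisation ?G)"
      using that bij_betw_apply[OF bij] unfolding carr by blast
    then show ?thesis using that memP unfolding carr by auto
  qed
  have left: "\<exists>g. (g, h) \<in> carrier ?P" if "h \<in> carrier ?G" for h
  proof -
    have "?D #>\<^bsub>?G\<^esub> h \<in> \<mu> ` carrier (abelianisation ?G)"
      using that bij_betw_imp_surj_on[OF bij] unfolding carr by blast
    then show ?thesis using that memP unfolding carr by auto
  qed
  have "\<forall>v\<in>vertices K. \<exists>h. (raag_gen K v, h) \<in> carrier ?P" using right by simp
  from bchoice[OF this] obtain r where r: "\<And>v. v \<in> vertices K \<Longrightarrow> (raag_gen K v, r v) \<in> carrier ?P"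
    by blast
  then have rc: "r v \<in> carrier ?G" if "v \<in> vertices K" for v using that memP by blast
  define M where "M v = exponents K (r v)" for v
  have oneP: "\<one>\<^bsub>?P\<^esub> = (\<one>\<^bsub>?G\<^esub>, \<one>\<^bsub>?G\<^esub>)" by (simp add: fibre_product_def)
  have invP: "inv\<^bsub>?P\<^esub> (g, h) = (inv\<^bsub>?G\<^esub> g, inv\<^bsub>?G\<^esub> h)" if "(g, h) \<in> carrier ?P" for g h
  proof (rule P.inv_equality)
    have "(inv\<^bsub>?G\<^esub> g, inv\<^bsub>?G\<^esub> h) = inv\<^bsub>?G \<times>\<times> ?G\<^esub> (g, h)"
      using that memP by (simp add: inv_DirProd[OF G.is_group G.is_group])
    then show "(inv\<^bsub>?G\<^esub> g, inv\<^bsub>?G\<^esub> h) \<in> carrier ?P"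
      using subgroup.m_inv_closed[OF subgroup_fibre_product[OF G.is_group \<mu>] that] by simp
    show "(inv\<^bsub>?G\<^esub> g, inv\<^bsub>?G\<^esub> h) \<otimes>\<^bsub>?P\<^esub> (g, h) = \<one>\<^bsub>?P\<^esub>"
      using that memP by (simp add: fibre_product_mult oneP)
  qed (rule that)
  have "\<forall>h. (g, h) \<in> carrier ?P \<longrightarrow> (\<forall>u. exponents K h u = (\<Sum>v\<in>vertices K. exponents K g v * M v u))"
    if "g \<in> carrier ?G" for g
    using that
  proof (induction rule: raag_induct)
    case one
    show ?case
    proof (intro allI impI)
      fix h u assume h: "(\<one>\<^bsub>?G\<^esub>, h) \<in> carrier ?P"
      have "(\<one>\<^bsub>?G\<^esub>, \<one>\<^bsub>?G\<^esub>) \<in> carrier ?P" unfolding oneP[symmetric] by (rule P.one_closed)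
      then have "?D #>\<^bsub>?G\<^esub> h = ?D #>\<^bsub>?G\<^esub> \<one>\<^bsub>?G\<^esub>" using h memP by metis
      then have "exponents K h = exponents K \<one>\<^bsub>?G\<^esub>"
        using commutator_coset_eq_iff[OF K fin] h memP G.one_closed by blast
      then show "exponents K h u = (\<Sum>v\<in>vertices K. exponents K \<one>\<^bsub>?G\<^esub> v * M v u)"
        by (simp add: exponents_one[OF K])
    qed
  next
    case (gen v g)
    show ?case
    proof (intro allI impI)
      fix h u assume h: "(raag_gen K v \<otimes>\<^bsub>?G\<^esub> g, h) \<in> carrier ?P"
      then have hc: "h \<in> carrier ?G" using memP by blast
      have "(inv\<^bsub>?G\<^esub> raag_gen K v, inv\<^bsub>?G\<^esub> r v) \<otimes>\<^bsub>?P\<^esub> (raag_gen K v \<otimes>\<^bsub>?G\<^esub> g, h) \<in> carrier ?P"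
        using P.m_closed[OF P.inv_closed[OF r[OF gen(1)]] h] invP[OF r[OF gen(1)]] by simp
      then have "(g, inv\<^bsub>?G\<^esub> r v \<otimes>\<^bsub>?G\<^esub> h) \<in> carrier ?P"
        using gen by (simp add: fibre_product_mult flip: G.m_assoc)
      with gen.IH have "exponents K (inv\<^bsub>?G\<^esub> r v \<otimes>\<^bsub>?G\<^esub> h) u = (\<Sum>x\<in>vertices K. exponents K g x * M x u)"
        by blast
      moreover have "exponents K (inv\<^bsub>?G\<^esub> r v \<otimes>\<^bsub>?G\<^esub> h) = exponents K h - M v"
        using rc[OF gen(1)] hc by (simp add: exponents_mult[OF K] exponents_inv[OF K] M_def)
      moreover have "(\<Sum>x\<in>vertices K. exponents K (raag_gen K v \<otimes>\<^bsub>?G\<^esub> g) x * M x u) =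
          M v u + (\<Sum>x\<in>vertices K. exponents K g x * M x u)"
        using gen fin by (simp add: exponents_mult[OF K] exponents_gen[OF K] distrib_right sum.distrib
            if_distrib[of "\<lambda>x. x * _"] cong: if_cong)
      ultimately show "exponents K h u = (\<Sum>x\<in>vertices K. exponents K (raag_gen K v \<otimes>\<^bsub>?G\<^esub> g) x * M x u)"
        by simp
    qed
  next
    case (inv v g)
    show ?case
    proof (intro allI impI)
      fix h u assume h: "(inv\<^bsub>?G\<^esub> raag_gen K v \<otimes>\<^bsub>?G\<^esub> g, h) \<in> carrier ?P"
      then have hc: "h \<in> carrier ?G" using memP by blast
      have "(raag_gen K v, r v) \<otimes>\<^bsub>?P\<^esub> (inv\<^bsub>?G\<^esub> raag_gen K v \<otimes>\<^bsub>?G\<^esub> g, h) \<in> carrier ?P"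
        using P.m_closed[OF r[OF inv(1)] h] by simp
      then have "(g, r v \<otimes>\<^bsub>?G\<^esub> h) \<in> carrier ?P"
        using inv by (simp add: fibre_product_mult flip: G.m_assoc)
      with inv.IH have "exponents K (r v \<otimes>\<^bsub>?G\<^esub> h) u = (\<Sum>x\<in>vertices K. exponents K g x * M x u)"
        by blast
      moreover have "exponents K (r v \<otimes>\<^bsub>?G\<^esub> h) = exponents K h + M v"
        using rc[OF inv(1)] hc by (simp add: exponents_mult[OF K] M_def add.commute)
      moreover have "(\<Sum>x\<in>vertices K. exponents K (inv\<^bsub>?G\<^esub> raag_gen K v \<otimes>\<^bsub>?G\<^esub> g) x * M x u) =
          (\<Sum>x\<in>vertices K. exponents K g x * M x u) - M v u"
        using inv fin by (simp add: exponents_mult[OF K] exponents_gen[OF K] exponents_inv[OF K]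
            left_diff_distrib sum_subtractf if_distrib[of "\<lambda>x. x * _"] cong: if_cong)
      ultimately show "exponents K h u =
          (\<Sum>x\<in>vertices K. exponents K (inv\<^bsub>?G\<^esub> raag_gen K v \<otimes>\<^bsub>?G\<^esub> g) x * M x u)"
        by simp
    qed
  qed
  then show ?thesis using that[of M] left memP by blast
qed

theorem small_separator_fibre_product_not_finitely_presented:
  assumes K: "simplicial_complex K" and fin: "finite (vertices K)"
    and \<mu>: "\<mu> \<in> iso (abelianisation (raag K)) (abelianisation (raag K))"
    and S: "\<not> complex_connected (remove_vertices K S)" "S \<subseteq> vertices K"
    and card: "2 * card S < card (vertices K)"
  shows "\<not> finitely_presented (fibre_product (raag K) \<mu>)"
proof -
  obtain M where M: "\<And>g h u. (g, h) \<in> carrier (fibre_product (raag K) \<mu>) \<Longrightarrow>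
       exponents K h u = (\<Sum>v\<in>vertices K. exponents K g v * M v u)"
    and left: "\<And>h. h \<in> carrier (raag K) \<Longrightarrow> \<exists>g. (g, h) \<in> carrier (fibre_product (raag K) \<mu>)"
    using fibre_product_exponents[OF K fin \<mu>] by blast
  \<comment> \<open>The unknown is \<chi>'. Rows \<open>Inl s\<close> make it vanish at
    \<open>s\<close>, rows \<open>Inr s\<close> make its pullback along \<open>M\<close> vanish
    there.\<close>
  define A where "A e u = (case e of Inl s \<Rightarrow> if u = s then 1 else 0 | Inr s \<Rightarrow> M s u)" for e u
  have finS: "finite S" using S(2) fin by (rule finite_subset)
  have "card (S <+> S) < card (vertices K)" using finS card by (simp add: card_Plus)
  from homogeneous_system_nonzero_solution[OF _ fin this, of A]
  obtain \<chi>' where \<chi>': "\<exists>v\<in>vertices K. \<chi>' v \<noteq> 0"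
      "\<forall>e\<in>S <+> S. (\<Sum>v\<in>vertices K. A e v * \<chi>' v) = 0"
    using finS by auto
  have \<chi>'S: "\<chi>' s = 0" if "s \<in> S" for s
  proof -
    have "(\<Sum>v\<in>vertices K. A (Inl s) v * \<chi>' v) = 0" using \<chi>'(2) that by blast
    then show ?thesis
      using that S(2) fin by (auto simp: A_def if_distrib[of "\<lambda>x. x * _"] cong: if_cong)
  qed
  define \<chi> where "\<chi> v = (\<Sum>u\<in>vertices K. M v u * \<chi>' u)" for v
  have \<chi>S: "\<chi> s = 0" if "s \<in> S" for s
  proof -
    have "(\<Sum>v\<in>vertices K. A (Inr s) v * \<chi>' v) = 0" using \<chi>'(2) that by blast
    then show ?thesis by (simp add: \<chi>_def A_def)
  qed
  have eq: "exponent_sum K \<chi> g = exponent_sum K \<chi>' h"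
    if "(g, h) \<in> carrier (fibre_product (raag K) \<mu>)" for g h
  proof -
    have "exponent_sum K \<chi>' h =
        (\<Sum>u\<in>vertices K. \<Sum>v\<in>vertices K. \<chi>' u * (exponents K g v * M v u))"
      by (simp add: exponent_sum_def M[OF that] sum_distrib_left)
    also have "\<dots> = exponent_sum K \<chi> g"
      unfolding exponent_sum_def \<chi>_def sum_distrib_right
      by (subst sum.swap) (simp add: ac_simps)
    finally show ?thesis by simp
  qed
  obtain w' where w': "w' \<in> vertices K" "\<chi>' w' \<noteq> 0" using \<chi>' by blast
  \<comment> \<open>A partner of the generator \<open>w'\<close> witnesses that the pullback \<chi>
    is nonzero.\<close>
  obtain g where g: "(g, raag_gen K w') \<in> carrier (fibre_product (raag K) \<mu>)"
    using left[OF raag_gen_closed[OF w'(1)]] by blast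
  have "exponent_sum K \<chi> g \<noteq> 0"
    using eq[OF g] w' by (simp add: exponent_sum_gen[OF K fin])
  have "\<exists>w\<in>vertices K. \<chi> w \<noteq> 0"
  proof (rule ccontr)
    assume "\<not> (\<exists>w\<in>vertices K. \<chi> w \<noteq> 0)"
    then have "exponent_sum K \<chi> g = 0" by (simp add: exponent_sum_def)
    with \<open>exponent_sum K \<chi> g \<noteq> 0\<close> show False by simp
  qed
  then obtain w where w: "w \<in> vertices K" "\<chi> w \<noteq> 0" by blast
  show ?thesis
    by (rule fibre_product_not_finitely_presented[where \<chi> = \<chi> and \<chi>' = \<chi>', OF K fin \<mu> S(1) \<chi>S w \<chi>'S w' eq])
qed

lemma iso_id: "id \<in> iso G G"
  by (simp add: iso_def hom_def)

lemma raag_not_comm_group: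
  assumes K: "simplicial_complex K" and nc: "\<not> comm_group (raag K)"
  obtains u v where "u \<in> vertices K" "v \<in> vertices K" "u \<noteq> v" "{u, v} \<notin> K"
proof -
  interpret G: group "raag K" by (rule group_raag)
  have "comm_group (raag K)"
    if edges: "\<forall>u\<in>vertices K. \<forall>v\<in>vertices K. u \<noteq> v \<longrightarrow> {u, v} \<in> K"
  proof (rule G.group_comm_groupI)
    have id: "id \<in> hom (raag K) (raag K)" by (simp add: hom_def)
    note commutes = raag_hom_commutes[OF G.is_group id, simplified]
    have gens: "raag_gen K u \<otimes>\<^bsub>raag K\<^esub> raag_gen K v = raag_gen K v \<otimes>\<^bsub>raag K\<^esub> raag_gen K u"
      if "u \<in> vertices K" "v \<in> vertices K" for u v
      using that edges raag_gen_commute[OF K] by (cases "u = v") auto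
    fix x y assume x: "x \<in> carrier (raag K)" and y: "y \<in> carrier (raag K)"
    have "x \<otimes>\<^bsub>raag K\<^esub> raag_gen K v = raag_gen K v \<otimes>\<^bsub>raag K\<^esub> x" if v: "v \<in> vertices K" for v
      using commutes[OF raag_gen_closed[OF v] gens[OF v] x] by simp
    then show "x \<otimes>\<^bsub>raag K\<^esub> y = y \<otimes>\<^bsub>raag K\<^esub> x" by (rule commutes[OF x _ y])
  qed
  with nc that show ?thesis by blast
qed

lemma complement_of_nonadjacent_separates:
  assumes K: "simplicial_complex K"
    and uv: "u \<in> vertices K" "v \<in> vertices K" "u \<noteq> v" "{u, v} \<notin> K"
  shows "\<not> complex_connected (remove_vertices K (vertices K - {u, v}))"
proof
  let ?L = "remove_vertices K (vertices K - {u, v})"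
  assume "complex_connected ?L"
  moreover have "u \<in> vertices ?L" "v \<in> vertices ?L"
    using uv by (auto simp: vertices_def remove_vertices_def)
  ultimately have "(u, v) \<in> {(x, y). {x, y} \<in> ?L}\<^sup>*" unfolding complex_connected_def by blast
  moreover have "y = u" if "(u, y) \<in> {(x, y). {x, y} \<in> ?L}\<^sup>*" for y
    using that
  proof (induction rule: rtrancl_induct)
    case (step y z)
    then have uz: "{u, z} \<in> K" "{u, z} \<inter> (vertices K - {u, v}) = {}"
      by (auto simp: remove_vertices_def)
    show ?case using edge_vertices[OF K uz(1)] uv(4) uz by auto
  qed simp
  ultimately show False using uv(3) by blast
qed

theorem untwisted_fibre_product_not_finitely_presented:
  assumes K: "simplicial_complex K" and fin: "finite (vertices K)" and nc: "\<not> comm_group (raag K)"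
  shows "\<not> finitely_presented (fibre_product (raag K) id)"
proof -
  obtain u v where uv: "u \<in> vertices K" "v \<in> vertices K" "u \<noteq> v" "{u, v} \<notin> K"
    by (rule raag_not_comm_group[OF K nc])
  \<comment> \<open>The exponent of \<open>u\<close> alone vanishes on the complement of
    \<open>{u, v}\<close>, which separates because \<open>u\<close> and \<open>v\<close> are not
    adjacent.\<close>
  define \<chi> :: "'a \<Rightarrow> int" where "\<chi> w = (if w = u then 1 else 0)" for w
  have \<chi>: "\<chi> w = 0" if "w \<in> vertices K - {u, v}" for w using that by (auto simp: \<chi>_def)
  have \<chi>u: "\<chi> u \<noteq> 0" by (simp add: \<chi>_def)
  have eq: "exponent_sum K \<chi> g = exponent_sum K \<chi> h"
    if "(g, h) \<in> carrier (fibre_product (raag K) id)" for g h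
  proof -
    have "exponents K g = exponents K h"
      using that commutator_coset_eq_iff[OF K fin, of g h] by (simp add: fibre_product_def)
    then show ?thesis by (simp add: exponent_sum_def)
  qed
  show ?thesis
    by (rule fibre_product_not_finitely_presented[where \<chi> = \<chi> and \<chi>' = \<chi>, OF K fin iso_id
        complement_of_nonadjacent_separates[OF K uv] \<chi> uv(1) \<chi>u \<chi> uv(1) \<chi>u eq])
qed

section \<open>A unimodular matrix in general position\<close>

text \<open>Sign changes have to be counted along with zeros for Rolle's theorem to hold for differences.\<close>

definition generalized_zero :: "(nat \<Rightarrow> real) \<Rightarrow> nat \<Rightarrow> bool" where
  "generalized_zero g t \<longleftrightarrow> g t = 0 \<or> g t * g (Suc t) < 0"

text \<open>A zero or sign change at \<open>s\<close> followed by strict increase makes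
  \<open>g\<close> positive from \<open>Suc s\<close> on, hence at \<open>t\<close> and at
  \<open>Suc t\<close>, which leaves no room for either at \<open>t\<close>.\<close>

lemma discrete_rolle_increasing:
  assumes "s < t" "generalized_zero g s" "\<And>u. \<lbrakk>s \<le> u; u < t\<rbrakk> \<Longrightarrow> g u < g (Suc u)" "g t \<le> g (Suc t)"
  shows "\<not> generalized_zero g t"
proof -
  have "g s < g (Suc s)" using assms(1,3) by simp
  then have pos: "g (Suc s) > 0" using assms(2) by (auto simp: generalized_zero_def mult_less_0_iff)
  have "g (Suc s) \<le> g t"
    using assms(1)[THEN Suc_leI] assms(3)
  proof (induction t rule: dec_induct)
    case (step m)
    then show ?case by (smt (verit) Suc_leD less_SucI lessI)
  qed simp
  with pos assms(4) have "g t > 0" "g (Suc t) > 0" by linarith+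
  then show ?thesis by (simp add: generalized_zero_def not_less)
qed

text \<open>Otherwise the differences keep one strict sign from \<open>s\<close> up to
  \<open>t\<close>. Then \<open>g\<close> or its negative increases there, which excludes a second
  generalized zero.\<close>

lemma discrete_rolle:
  assumes "s < t" "generalized_zero g s" "generalized_zero g t"
  shows "\<exists>u. s \<le> u \<and> u < t \<and> generalized_zero (\<lambda>k. g (Suc k) - g k) u"
proof (rule ccontr)
  assume none: "\<nexists>u. s \<le> u \<and> u < t \<and> generalized_zero (\<lambda>k. g (Suc k) - g k) u"
  define d where "d k = g (Suc k) - g k" for k
  have nz: "d u \<noteq> 0" "d u * d (Suc u) \<ge> 0" if "s \<le> u" "u < t" for u
    using none that by (auto simp: generalized_zero_def d_def)
  have sign: "u < t \<longrightarrow> d s * d u > 0" if "s \<le> u" for u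
    using that
  proof (induction u rule: dec_induct)
    case base
    then show ?case using nz(1)[of s] assms(1) by (simp add: zero_less_mult_iff) linarith
  next
    case (step u)
    show ?case
    proof
      assume "Suc u < t"
      then have "d s * d u > 0" "d u * d (Suc u) \<ge> 0" "d (Suc u) \<noteq> 0"
        using step nz[of u] nz(1)[of "Suc u"] by auto
      then show "d s * d (Suc u) > 0" by (auto simp: zero_less_mult_iff zero_le_mult_iff)
    qed
  qed
  \<comment> \<open>At \<open>t\<close> itself the difference may vanish; only the absence of a sign
    change at the predecessor of \<open>t\<close> is available, so the inequality is weak.\<close>
  have last: "d s * d t \<ge> 0"
  proof -
    obtain u where u: "t = Suc u" "s \<le> u" using assms(1) by (cases t) auto
    then have "d s * d u > 0" "d u * d t \<ge> 0" using sign[of u] nz(2)[of u] by auto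
    then show ?thesis by (auto simp: zero_less_mult_iff zero_le_mult_iff)
  qed
  show False
  proof (cases "d s > 0")
    case True
    have "\<not> generalized_zero g t"
      by (rule discrete_rolle_increasing[OF assms(1,2)])
        (use sign last True in \<open>auto simp: d_def zero_less_mult_iff zero_le_mult_iff\<close>)
    then show False using assms(3) by simp
  next
    case False
    then have neg: "d s < 0" using nz(1)[of s] assms(1) by simp
    have gz: "generalized_zero (\<lambda>k. - g k) k \<longleftrightarrow> generalized_zero g k" for k
      by (simp add: generalized_zero_def)
    have "\<not> generalized_zero (\<lambda>k. - g k) t"
      by (rule discrete_rolle_increasing[OF assms(1)])
        (use assms(2) sign last neg in \<open>auto simp: gz d_def zero_less_mult_iff zero_le_mult_iff\<close>)
    then show False using assms(3) gz by simp
  qed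
qed

text \<open>Consecutive elements of \<open>Z\<close> bound disjoint half-open intervals, so the
  zeros found in them are distinct. The range \<open>{Min Z..<Max Z}\<close> carries this through
  the induction and keeps the new zeros above the old minimum.\<close>

lemma discrete_rolle_card:
  assumes "finite Z" "Z \<noteq> {}" "\<And>t. t \<in> Z \<Longrightarrow> generalized_zero g t"
  shows "\<exists>Z'. finite Z' \<and> Suc (card Z') = card Z \<and> Z' \<subseteq> {Min Z..<Max Z} \<and>
    (\<forall>t\<in>Z'. generalized_zero (\<lambda>k. g (Suc k) - g k) t)"
  using assms
proof (induction Z rule: finite_linorder_max_induct)
  case (insert b A)
  show ?case
  proof (cases "A = {}")
    case True
    then show ?thesis by (intro exI[of _ "{}"]) simp
  next
    case False
    with insert obtain Z' where Z': "finite Z'" "Suc (card Z') = card A" "Z' \<subseteq> {Min A..<Max A}"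
        "\<forall>t\<in>Z'. generalized_zero (\<lambda>k. g (Suc k) - g k) t" by auto
    have a: "Max A \<in> A" "Max A < b" using insert False by auto
    then obtain u where u: "Max A \<le> u" "u < b" "generalized_zero (\<lambda>k. g (Suc k) - g k) u"
      using discrete_rolle[of "Max A" b g] insert.prems by auto
    have "u \<notin> Z'" using Z'(3) u(1) by auto
    moreover have "b \<notin> A" using insert by auto
    moreover have le: "Min A \<le> Max A" using insert(1) False by simp
    moreover have "Min (insert b A) = Min A" "Max (insert b A) = b"
      unfolding Min_insert[OF insert(1) False] Max_insert[OF insert(1) False]
      using le a(2) by (simp_all add: min_def max_def)
    moreover have "Min A \<le> u" using le u(1) by simp
    ultimately show ?thesis
      using Z' u insert(1) a by (intro exI[of _ "insert u Z'"]) auto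
  qed
qed simp

text \<open>
  Descartes' rule of signs for sums of binomial coefficients: dividing by the first one present
  moves the exponents down to \<open>0\<close>, and then taking differences removes one summand.
\<close>

lemma descartes_binomial:
  fixes x :: "nat \<Rightarrow> real"
  assumes "finite Z" "\<exists>j<N. x j \<noteq> 0"
    and "\<And>t. t \<in> Z \<Longrightarrow> t \<ge> N \<and> generalized_zero (\<lambda>t. \<Sum>j<N. x j * real (t choose j)) t"
  shows "card Z < card {j. j < N \<and> x j \<noteq> 0}"
  using assms
proof (induction "card {j. j < N \<and> x j \<noteq> 0}" arbitrary: x N Z rule: less_induct)
  case less
  define p where "p t = (\<Sum>j<N. x j * real (t choose j))" for t
  define j0 where "j0 = (LEAST j. j < N \<and> x j \<noteq> 0)"
  have j0: "j0 < N" "x j0 \<noteq> 0" and j0_least: "\<And>j. j < j0 \<Longrightarrow> x j = 0"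
    using less.prems(2) LeastI_ex[of "\<lambda>j. j < N \<and> x j \<noteq> 0"] not_less_Least[of _ "\<lambda>j. j < N \<and> x j \<noteq> 0"]
    unfolding j0_def[symmetric] by (auto dest: less_trans)
  \<comment> \<open>Dividing by the binomial coefficient of \<open>j0\<close>: choosing
    \<open>i + j0\<close> elements and then \<open>j0\<close> of these amounts to choosing
    \<open>j0\<close> and then \<open>i\<close> of the rest.\<close>
  define y where "y i = x (i + j0) / real ((i + j0) choose j0)" for i
  define N' where "N' = N - j0"
  have N': "N' > 0" "N = N' + j0" using j0 by (auto simp: N'_def)
  define q where "q s = (\<Sum>i<N'. y i * real (s choose i))" for s
  have pq: "p t = real (t choose j0) * q (t - j0)" if "t \<ge> N" for t
  proof -
    have "p t = (\<Sum>j\<in>{j0..<N}. x j * real (t choose j))"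
      unfolding p_def using j0_least j0(1) by (intro sum.mono_neutral_right) (auto simp: not_le)
    also have "\<dots> = (\<Sum>i<N'. x (i + j0) * real (t choose (i + j0)))"
      using sum.shift_bounds_nat_ivl[of "\<lambda>j. x j * real (t choose j)" 0 j0 N']
      by (simp add: N'(2) lessThan_atLeast0 add.commute)
    also have "\<dots> = (\<Sum>i<N'. real (t choose j0) * (y i * real ((t - j0) choose i)))"
    proof (rule sum.cong)
      fix i assume "i \<in> {..<N'}"
      then have "(t choose (i + j0)) * ((i + j0) choose j0) = (t choose j0) * ((t - j0) choose i)"
        using choose_mult[of j0 "i + j0" t] that N' by simp
      then have "real (t choose (i + j0)) * real ((i + j0) choose j0) =
          real (t choose j0) * real ((t - j0) choose i)"
        by (metis of_nat_mult)
      moreover have "real ((i + j0) choose j0) \<noteq> 0" by simp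
      ultimately show "x (i + j0) * real (t choose (i + j0)) =
          real (t choose j0) * (y i * real ((t - j0) choose i))"
        by (simp add: y_def field_simps)
    qed simp
    finally show ?thesis by (simp add: q_def sum_distrib_left)
  qed
  define Z1 where "Z1 = (\<lambda>t. t - j0) ` Z"
  have Zge: "t \<ge> N" if "t \<in> Z" for t using less.prems(3) that by blast
  have "inj_on (\<lambda>t. t - j0) Z"
  proof (rule inj_onI)
    fix s t assume "s \<in> Z" "t \<in> Z" "s - j0 = t - j0"
    then show "s = t" using Zge[of s] Zge[of t] j0(1) by linarith
  qed
  then have cardZ1: "card Z1 = card Z" by (simp add: Z1_def card_image)
  have finZ1: "finite Z1" using less.prems(1) by (simp add: Z1_def)
  \<comment> \<open>From \<open>N\<close> on, \<open>t choose j0\<close> is positive at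
    \<open>t\<close> and at \<open>Suc t\<close>, so the division preserves zeros and sign
    changes.\<close>
  have Z1: "s \<ge> N' \<and> generalized_zero q s" if s: "s \<in> Z1" for s
  proof -
    obtain t where t: "t \<in> Z" "s = t - j0" using s by (auto simp: Z1_def)
    have tN: "t \<ge> N" "Suc t \<ge> N" using Zge[OF t(1)] by auto
    have "generalized_zero p t" using less.prems(3)[OF t(1)] by (simp add: p_def[abs_def])
    moreover have "real (t choose j0) > 0" "real (Suc t choose j0) > 0" using tN j0(1) by simp_all
    moreover have "Suc t - j0 = Suc (t - j0)" using tN j0(1) by linarith
    ultimately have "generalized_zero q s"
      unfolding generalized_zero_def pq[OF tN(1)] pq[OF tN(2)] t(2)
      by (auto simp: mult_less_0_iff zero_less_mult_iff)
    moreover have "s \<ge> N'" using tN t(2) by (simp add: N'_def)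
    ultimately show ?thesis by blast
  qed
  \<comment> \<open>By Pascal's rule, differences lower each lower index by one, and the constant
    term disappears.\<close>
  define w where "w i = y (Suc i)" for i
  define N'' where "N'' = N' - 1"
  have N'': "N' = Suc N''" using N'(1) by (simp add: N''_def)
  have dq: "q (Suc s) - q s = (\<Sum>i<N''. w i * real (s choose i))" for s
    unfolding q_def N'' sum.lessThan_Suc_shift
    by (simp add: w_def algebra_simps sum.distrib)
  have y0: "y 0 \<noteq> 0" using j0 by (simp add: y_def)
  have supp: "card {j. j < N \<and> x j \<noteq> 0} = Suc (card {i. i < N'' \<and> w i \<noteq> 0})"
  proof -
    have "{j. j < N \<and> x j \<noteq> 0} = insert j0 ((\<lambda>i. Suc i + j0) ` {i. i < N'' \<and> w i \<noteq> 0})"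
    proof (intro equalityI subsetI)
      fix j assume j: "j \<in> {j. j < N \<and> x j \<noteq> 0}"
      show "j \<in> insert j0 ((\<lambda>i. Suc i + j0) ` {i. i < N'' \<and> w i \<noteq> 0})"
      proof (cases "j = j0")
        case False
        with j j0_least have "j0 < j" by (metis (mono_tags, lifting) linorder_neqE_nat mem_Collect_eq)
        then obtain i where i: "j = Suc i + j0" by (metis add.commute add_Suc_right less_imp_Suc_add)
        with j have "i < N''" "w i \<noteq> 0" by (auto simp: w_def y_def N'(2) N'')
        with i show ?thesis by blast
      qed simp
    next
      fix j assume "j \<in> insert j0 ((\<lambda>i. Suc i + j0) ` {i. i < N'' \<and> w i \<noteq> 0})"
      then show "j \<in> {j. j < N \<and> x j \<noteq> 0}"
        using j0 by (auto simp: w_def y_def N'(2) N'')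
    qed
    moreover have "j0 \<notin> (\<lambda>i. Suc i + j0) ` {i. i < N'' \<and> w i \<noteq> 0}" by auto
    moreover have "inj_on (\<lambda>i. Suc i + j0) {i. i < N'' \<and> w i \<noteq> 0}" by (auto simp: inj_on_def)
    ultimately show ?thesis by (simp add: card_image)
  qed
  show ?case
  proof (cases "Z1 = {}")
    case True
    then show ?thesis using cardZ1 supp by simp
  next
    case False
    obtain Z2 where Z2: "finite Z2" "Suc (card Z2) = card Z1" "Z2 \<subseteq> {Min Z1..<Max Z1}"
        "\<forall>t\<in>Z2. generalized_zero (\<lambda>k. q (Suc k) - q k) t"
      using discrete_rolle_card[OF finZ1 False, of q] Z1 by blast
    have Z2': "s \<ge> N'' \<and> generalized_zero (\<lambda>s. \<Sum>i<N''. w i * real (s choose i)) s" if "s \<in> Z2" for s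
    proof -
      have "Min Z1 \<in> Z1" using finZ1 False by simp
      then have "s \<ge> N'" using Z1[of "Min Z1"] Z2(3) that by fastforce
      then show ?thesis using Z2(4) that N'' by (simp add: dq)
    qed
    show ?thesis
    proof (cases "\<exists>i<N''. w i \<noteq> 0")
      case True
      have "card Z2 < card {i. i < N'' \<and> w i \<noteq> 0}"
        by (rule less.hyps[OF _ Z2(1) True Z2']) (simp add: supp)
      then show ?thesis using Z2(2) cardZ1 supp by simp
    next
      case False
      \<comment> \<open>With no summand left, \<open>q\<close> is the nonzero constant
        \<open>y 0\<close>, which contradicts its having a generalized zero in the nonempty
        \<open>Z1\<close>.\<close>
      then have "q s = y 0" for s
        unfolding q_def N'' sum.lessThan_Suc_shift by (simp add: w_def)
      moreover obtain s where "s \<in> Z1" using \<open>Z1 \<noteq> {}\<close> by blast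
      ultimately have "generalized_zero (\<lambda>_. y 0) s" using Z1[of s] by (simp add: generalized_zero_def)
      then show ?thesis using y0 by (simp add: generalized_zero_def mult_less_0_iff)
    qed
  qed
qed

text \<open>Newton interpolation: the first differences of the data are interpolated by induction,
  which gives all coefficients but the constant one, and that one is fitted to \<open>y 0\<close>.
  No division occurs.\<close>

lemma binomial_interpolation:
  fixes y :: "nat \<Rightarrow> int"
  shows "\<exists>x. \<forall>i<n. (\<Sum>j<n. x j * int ((a + i) choose j)) = y i"
proof (induction n arbitrary: y)
  case (Suc n)
  obtain x' where x': "\<And>i. i < n \<Longrightarrow> (\<Sum>j<n. x' j * int ((a + i) choose j)) = y (Suc i) - y i"
    using Suc.IH[of "\<lambda>i. y (Suc i) - y i"] by blast
  define x where "x j = (case j of 0 \<Rightarrow> y 0 - (\<Sum>j<n. x' j * int (a choose Suc j)) | Suc j \<Rightarrow> x' j)" for j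
  have sum: "(\<Sum>j<Suc n. x j * int (t choose j)) = x 0 + (\<Sum>j<n. x' j * int (t choose Suc j))" for t
    by (simp only: sum.lessThan_Suc_shift) (simp add: x_def)
  have "(\<Sum>j<Suc n. x j * int ((a + i) choose j)) = y i" if "i < Suc n" for i
    using that
  proof (induction i)
    case 0
    show ?case unfolding sum by (simp add: x_def)
  next
    case (Suc i)
    have "(\<Sum>j<Suc n. x j * int ((a + Suc i) choose j)) =
        (\<Sum>j<Suc n. x j * int ((a + i) choose j)) + (\<Sum>j<n. x' j * int ((a + i) choose j))"
      unfolding sum by (simp add: algebra_simps sum.distrib)
    then show ?case using Suc x'[of i] by simp
  qed
  then show ?case by blast
qed simp

section \<open>Linear forms in general position and lower bounds\<close>

text \<open>An injective linear map is bounded below in the sum norm. The constant is built by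
  eliminating one column at a time, in place of a compactness argument.\<close>

lemma trivial_kernel_bound:
  fixes A :: "'e \<Rightarrow> 'v \<Rightarrow> real"
  assumes "finite V" "finite E"
    and "\<And>x. (\<And>e. e \<in> E \<Longrightarrow> (\<Sum>v\<in>V. A e v * x v) = 0) \<Longrightarrow> \<forall>v\<in>V. x v = 0"
  shows "\<exists>C\<ge>0. \<forall>x. (\<Sum>v\<in>V. \<bar>x v\<bar>) \<le> C * (\<Sum>e\<in>E. \<bar>\<Sum>v\<in>V. A e v * x v\<bar>)"
  using assms
proof (induction V arbitrary: A rule: finite_induct)
  case empty
  then show ?case by (intro exI[of _ 0]) simp
next
  case (insert w V)
  obtain e where e: "e \<in> E" "A e w \<noteq> 0"
  proof -
    have "\<exists>e\<in>E. A e w \<noteq> 0"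
    proof (rule ccontr)
      assume "\<not> (\<exists>e\<in>E. A e w \<noteq> 0)"
      then have "(\<Sum>v\<in>insert w V. A e v * (if v = w then 1 else 0)) = 0" if "e \<in> E" for e
        using that insert.hyps by (simp add: if_distrib cong: if_cong)
      from insert.prems(2)[OF this] show False by simp
    qed
    then show ?thesis using that by blast
  qed
  define r where "r f = A f w / A e w" for f
  \<comment> \<open>Row \<open>e\<close> is used to clear column \<open>w\<close> from every
    row.\<close>
  define A' where "A' f v = A f v - r f * A e v" for f v
  have A'_eq: "(\<Sum>v\<in>V. A' f v * x v) = (\<Sum>v\<in>insert w V. A f v * x v) - r f * (\<Sum>v\<in>insert w V. A e v * x v)"
    for f x
    using insert.hyps e(2)
    by (simp add: A'_def r_def left_diff_distrib sum_subtractf sum_distrib_left algebra_simps)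
  have "\<forall>v\<in>V. x v = 0" if x: "\<And>f. f \<in> E \<Longrightarrow> (\<Sum>v\<in>V. A' f v * x v) = 0" for x
  proof -
    \<comment> \<open>A kernel vector of the reduced system extends to one of the full system by
      solving row \<open>e\<close> for the coordinate \<open>w\<close>.\<close>
    define x' where "x' = x(w := - (\<Sum>v\<in>V. A e v * x v) / A e w)"
    have same: "(\<Sum>v\<in>V. B v * x' v) = (\<Sum>v\<in>V. B v * x v)" for B
      using insert.hyps(2) by (intro sum.cong) (auto simp: x'_def)
    have e0: "(\<Sum>v\<in>insert w V. A e v * x' v) = 0"
      using insert.hyps e(2) same[of "A e"] by (simp add: x'_def)
    have "(\<Sum>v\<in>insert w V. A f v * x' v) = 0" if "f \<in> E" for f
      using A'_eq[of f x'] x[OF that] same[of "A' f"] e0 by simp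
    from insert.prems(2)[OF this] have "\<forall>v\<in>V. x' v = 0" by blast
    then show ?thesis using insert.hyps(2) by (auto simp: x'_def split: if_splits)
  qed
  from insert.IH[OF insert.prems(1) this] obtain C where C: "C \<ge> 0"
      "\<And>x. (\<Sum>v\<in>V. \<bar>x v\<bar>) \<le> C * (\<Sum>f\<in>E. \<bar>\<Sum>v\<in>V. A' f v * x v\<bar>)" by blast
  define C1 where "C1 = C * (1 + (\<Sum>f\<in>E. \<bar>r f\<bar>))"
  define c2 where "c2 = (\<Sum>v\<in>V. \<bar>A e v\<bar>)"
  have C1: "C1 \<ge> 0" using C(1) by (simp add: C1_def sum_nonneg)
  have c2: "c2 \<ge> 0" by (simp add: c2_def sum_nonneg)
  show ?case
  proof (intro exI[of _ "C1 + (1 + c2 * C1) / \<bar>A e w\<bar>"] conjI allI)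
    show "0 \<le> C1 + (1 + c2 * C1) / \<bar>A e w\<bar>" using C1 c2 by simp
    fix x
    define T where "T = (\<Sum>f\<in>E. \<bar>\<Sum>v\<in>insert w V. A f v * x v\<bar>)"
    have eT: "\<bar>\<Sum>v\<in>insert w V. A e v * x v\<bar> \<le> T"
      unfolding T_def by (rule member_le_sum) (use e insert.prems(1) in auto)
    have "(\<Sum>f\<in>E. \<bar>\<Sum>v\<in>V. A' f v * x v\<bar>) \<le>
        (\<Sum>f\<in>E. \<bar>\<Sum>v\<in>insert w V. A f v * x v\<bar> + \<bar>r f\<bar> * T)"
    proof (rule sum_mono)
      fix f
      have "\<bar>r f * (\<Sum>v\<in>insert w V. A e v * x v)\<bar> \<le> \<bar>r f\<bar> * T"
        unfolding abs_mult by (rule mult_left_mono[OF eT]) simp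
      then show "\<bar>\<Sum>v\<in>V. A' f v * x v\<bar> \<le> \<bar>\<Sum>v\<in>insert w V. A f v * x v\<bar> + \<bar>r f\<bar> * T"
        unfolding A'_eq by linarith
    qed
    also have "\<dots> = (1 + (\<Sum>f\<in>E. \<bar>r f\<bar>)) * T"
      by (simp add: sum.distrib T_def[symmetric] sum_distrib_right distrib_right)
    finally have "(\<Sum>v\<in>V. \<bar>x v\<bar>) \<le> C * ((1 + (\<Sum>f\<in>E. \<bar>r f\<bar>)) * T)"
      using C(2)[of x] mult_left_mono[OF _ C(1)] by (meson order_trans)
    then have V: "(\<Sum>v\<in>V. \<bar>x v\<bar>) \<le> C1 * T" by (simp add: C1_def mult.assoc)
    have "\<bar>\<Sum>v\<in>V. A e v * x v\<bar> \<le> (\<Sum>v\<in>V. c2 * \<bar>x v\<bar>)"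
    proof (rule order_trans[OF sum_abs sum_mono])
      fix v assume "v \<in> V"
      then have "\<bar>A e v\<bar> \<le> c2" unfolding c2_def by (intro member_le_sum) (use insert.hyps in auto)
      then show "\<bar>A e v * x v\<bar> \<le> c2 * \<bar>x v\<bar>" by (simp add: abs_mult mult_right_mono)
    qed
    also have "\<dots> \<le> c2 * (C1 * T)"
      unfolding sum_distrib_left[symmetric] by (rule mult_left_mono[OF V c2])
    finally have "\<bar>\<Sum>v\<in>V. A e v * x v\<bar> \<le> c2 * C1 * T" by simp
    moreover have "A e w * x w = (\<Sum>v\<in>insert w V. A e v * x v) - (\<Sum>v\<in>V. A e v * x v)"
      using insert.hyps by simp
    ultimately have "\<bar>A e w * x w\<bar> \<le> (1 + c2 * C1) * T"
      using eT by (simp add: distrib_right)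
    then have "\<bar>x w\<bar> \<le> (1 + c2 * C1) / \<bar>A e w\<bar> * T"
      using e(2) by (simp add: abs_mult field_simps)
    then show "(\<Sum>v\<in>insert w V. \<bar>x v\<bar>) \<le>
        (C1 + (1 + c2 * C1) / \<bar>A e w\<bar>) * (\<Sum>f\<in>E. \<bar>\<Sum>v\<in>insert w V. A f v * x v\<bar>)"
      unfolding T_def[symmetric] using V insert.hyps by (simp add: distrib_right)
  qed
qed

text \<open>The entries are \<open>(n + k w) choose k u\<close> for a numbering \<open>k\<close> of
  \<open>V\<close>. Interpolation yields an integral left inverse, and the zero count, which
  expresses that all minors are nonzero, makes it two-sided. The last two properties serve to keep
  vectors of different letters apart.\<close>

theorem unimodular_general_position:
  assumes fin: "finite V"
  shows "\<exists>m' m :: 'v \<Rightarrow> 'v \<Rightarrow> int.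
    (\<forall>v\<in>V. \<forall>w\<in>V. (\<Sum>u\<in>V. m' v u * m u w) = (if v = w then 1 else 0)) \<and>
    (\<forall>v\<in>V. \<forall>w\<in>V. (\<Sum>u\<in>V. m v u * m' u w) = (if v = w then 1 else 0)) \<and>
    (\<forall>x :: 'v \<Rightarrow> real. (\<exists>v\<in>V. x v \<noteq> 0) \<longrightarrow>
       card {v \<in> V. x v = 0} + card {w \<in> V. (\<Sum>u\<in>V. x u * of_int (m u w)) = 0} < card V) \<and>
    (\<forall>v\<in>V. \<forall>w\<in>V. m v w > 0) \<and>
    (\<forall>v\<in>V. \<forall>w\<in>V. v \<noteq> w \<longrightarrow> (\<exists>u\<in>V. m u v \<noteq> m u w))"
proof -
  define n where "n = card V"
  obtain h where h: "bij_betw h {..<n} V"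
    using ex_bij_betw_nat_finite[OF fin] by (auto simp: n_def lessThan_atLeast0)
  define k where "k = inv_into {..<n} h"
  have k: "bij_betw k V {..<n}" unfolding k_def by (rule bij_betw_inv_into[OF h])
  have kh: "k (h j) = j" if "j < n" for j
    using that h by (simp add: k_def bij_betw_def)
  have hk: "h (k v) = v" if "v \<in> V" for v
    unfolding k_def using bij_betw_inv_into_right[OF h that] .
  have hV: "h j \<in> V" if "j < n" for j using h that by (auto simp: bij_betw_def)
  have kn: "k v < n" if "v \<in> V" for v using k that by (auto simp: bij_betw_def)
  have kinj: "k v = k w \<longleftrightarrow> v = w" if "v \<in> V" "w \<in> V" for v w
    using that hk by metis
  \<comment> \<open>The shift by \<open>n\<close> meets the requirement \<open>t \<ge> N\<close> of
    \<open>descartes_binomial\<close> and makes every entry positive.\<close>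
  define m where "m u w = int ((n + k w) choose k u)" for u w
  have sum_k: "(\<Sum>u\<in>V. f u) = (\<Sum>j<n. f (h j))" for f :: "'v \<Rightarrow> 'b::comm_monoid_add"
    using sum.reindex_bij_betw[OF h, of f] by simp
  have pos: "m v w > 0" if "v \<in> V" "w \<in> V" for v w
    using kn[OF that(1)] by (simp add: m_def)
  have zeros: "card {v \<in> V. x v = 0} + card {w \<in> V. (\<Sum>u\<in>V. x u * of_int (m u w)) = 0} < card V"
    if x: "\<exists>v\<in>V. x v \<noteq> 0" for x :: "'v \<Rightarrow> real"
  proof -
    let ?W = "{w \<in> V. (\<Sum>u\<in>V. x u * of_int (m u w)) = 0}"
    define Z where "Z = (\<lambda>w. n + k w) ` ?W"
    have "inj_on (\<lambda>w. n + k w) ?W" using kinj by (auto intro!: inj_onI)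
    then have Z: "card Z = card ?W" "finite Z" using fin by (simp_all add: Z_def card_image)
    have "card Z < card {j. j < n \<and> x (h j) \<noteq> 0}"
    proof (rule descartes_binomial[OF Z(2)])
      show "\<exists>j<n. x (h j) \<noteq> 0" using x hk kn by metis
      fix t assume "t \<in> Z"
      then obtain w where w: "w \<in> V" "(\<Sum>u\<in>V. x u * of_int (m u w)) = 0" "t = n + k w"
        by (auto simp: Z_def)
      have "(\<Sum>j<n. x (h j) * real (t choose j)) = (\<Sum>u\<in>V. x u * of_int (m u w))"
        unfolding sum_k w(3) by (intro sum.cong) (auto simp: m_def kh)
      then show "n \<le> t \<and> generalized_zero (\<lambda>t. \<Sum>j<n. x (h j) * real (t choose j)) t"
        using w by (simp add: generalized_zero_def)
    qed
    also have "{j. j < n \<and> x (h j) \<noteq> 0} = k ` {v \<in> V. x v \<noteq> 0}"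
      using hk kn hV kh by (auto simp: image_iff) metis
    also have "card \<dots> = card {v \<in> V. x v \<noteq> 0}"
      using kinj by (intro card_image inj_onI) auto
    finally have "card ?W < card {v \<in> V. x v \<noteq> 0}" using Z by simp
    moreover have "card {v \<in> V. x v = 0} + card {v \<in> V. x v \<noteq> 0} = card V"
      using fin by (subst card_Un_disjoint[symmetric]) (auto intro!: arg_cong[where f = card])
    ultimately show ?thesis by simp
  qed
  \<comment> \<open>A nonzero row vector annihilated by all columns would produce \<open>n\<close>
    zeros, more than the count allows.\<close>
  have inj: "x v = 0" if "\<And>w. w \<in> V \<Longrightarrow> (\<Sum>u\<in>V. x u * m u w) = 0" "v \<in> V" for x :: "'v \<Rightarrow> int" and v
  proof (rule ccontr)
    assume "x v \<noteq> 0"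
    then have "\<exists>v\<in>V. real_of_int (x v) \<noteq> 0" using that(2) by auto
    from zeros[OF this] have "card {w \<in> V. (\<Sum>u\<in>V. real_of_int (x u) * of_int (m u w)) = 0} < card V"
      by simp
    moreover have "(\<Sum>u\<in>V. real_of_int (x u) * of_int (m u w)) = of_int (\<Sum>u\<in>V. x u * m u w)" for w
      by simp
    ultimately show False using that(1) by (simp cong: conj_cong del: of_int_sum)
  qed
  have "\<exists>x. \<forall>w\<in>V. (\<Sum>u\<in>V. x u * m u w) = (if v = w then 1 else 0)" for v
  proof -
    obtain x where x: "\<And>i. i < n \<Longrightarrow> (\<Sum>j<n. x j * int ((n + i) choose j)) = (if v = h i then 1 else 0)"
      using binomial_interpolation[of n n "\<lambda>i. if v = h i then 1 else 0"] by blast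
    have "(\<Sum>u\<in>V. x (k u) * m u w) = (if v = w then 1 else 0)" if "w \<in> V" for w
    proof -
      have "(\<Sum>u\<in>V. x (k u) * m u w) = (\<Sum>j<n. x j * int ((n + k w) choose j))"
        unfolding sum_k by (intro sum.cong) (auto simp: m_def kh)
      then show ?thesis using x[OF kn[OF that]] hk[OF that] by simp
    qed
    then show ?thesis by (intro exI[of _ "\<lambda>u. x (k u)"]) blast
  qed
  then have "\<forall>v. \<exists>x. \<forall>w\<in>V. (\<Sum>u\<in>V. x u * m u w) = (if v = w then 1 else 0)" by blast
  from choice[OF this] obtain m' where
    "\<forall>v. \<forall>w\<in>V. (\<Sum>u\<in>V. m' v u * m u w) = (if v = w then 1 else 0)"
    by blast
  then have m': "(\<Sum>u\<in>V. m' v u * m u w) = (if v = w then 1 else 0)" if "w \<in> V" for v w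
    using that by blast
  \<comment> \<open>The rows of \<open>m * m' - 1\<close> are annihilated by \<open>m\<close>
    because \<open>m'\<close> is a left inverse, so \<open>inj\<close> applies to them.\<close>
  have mm': "(\<Sum>u\<in>V. m v u * m' u w) = (if v = w then 1 else 0)" if "v \<in> V" "w \<in> V" for v w
  proof -
    define x where "x u = (\<Sum>a\<in>V. m v a * m' a u) - (if v = u then 1 else 0)" for u
    have "(\<Sum>u\<in>V. x u * m u b) = 0" if b: "b \<in> V" for b
    proof -
      have "(\<Sum>u\<in>V. x u * m u b) = (\<Sum>u\<in>V. \<Sum>a\<in>V. m v a * (m' a u * m u b)) - m v b"
        using fin \<open>v \<in> V\<close> by (simp add: x_def left_diff_distrib sum_subtractf sum_distrib_right mult.assoc
            if_distrib[of "\<lambda>x. x * _"] cong: if_cong)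
      also have "(\<Sum>u\<in>V. \<Sum>a\<in>V. m v a * (m' a u * m u b)) = (\<Sum>a\<in>V. m v a * (\<Sum>u\<in>V. m' a u * m u b))"
        by (subst sum.swap) (simp add: sum_distrib_left)
      also have "\<dots> = m v b"
        using fin b by (simp add: m'[OF b] if_distrib cong: if_cong)
      finally show ?thesis by simp
    qed
    from inj[OF this \<open>w \<in> V\<close>] show ?thesis by (simp add: x_def)
  qed
  have ne: "\<exists>u\<in>V. m u v \<noteq> m u w" if vw: "v \<in> V" "w \<in> V" "v \<noteq> w" for v w
  proof -
    have "k v \<noteq> k w" using kinj vw by blast
    then have "n > 1" using kn[OF vw(1)] kn[OF vw(2)] by linarith
    \<comment> \<open>Row one of the matrix is \<open>n + k w\<close> itself, so it separates the
      columns.\<close>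
    then have "h 1 \<in> V" "k (h 1) = 1" using hV kh by auto
    then have "m (h 1) v \<noteq> m (h 1) w" using \<open>k v \<noteq> k w\<close> by (simp add: m_def)
    then show ?thesis using \<open>h 1 \<in> V\<close> by blast
  qed
  show ?thesis
    by (intro exI[of _ m'] exI[of _ m] conjI ballI allI impI m' mm' zeros pos ne)
qed

text \<open>There are \<open>2 * card V\<close> linear forms, the coordinates and the columns of
  \<open>m\<close>. Any \<open>card V\<close> of them vanish together only at zero, hence bound the
  sum norm, and \<open>C\<close> is uniform over the finitely many selections. So fewer than
  \<open>card V\<close> forms can be small relative to the norm.\<close>

lemma general_position_bound:
  fixes m :: "'v \<Rightarrow> 'v \<Rightarrow> int"
  assumes fin: "finite V" and ne: "V \<noteq> {}"
    and m: "\<And>x :: 'v \<Rightarrow> real. \<exists>v\<in>V. x v \<noteq> 0 \<Longrightarrow>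
       card {v \<in> V. x v = 0} + card {w \<in> V. (\<Sum>u\<in>V. x u * of_int (m u w)) = 0} < card V"
  shows "\<exists>C>0. \<forall>x :: 'v \<Rightarrow> real. card {v \<in> V. C * \<bar>x v\<bar> < (\<Sum>u\<in>V. \<bar>x u\<bar>)} +
    card {w \<in> V. C * \<bar>\<Sum>u\<in>V. x u * of_int (m u w)\<bar> < (\<Sum>u\<in>V. \<bar>x u\<bar>)} < card V"
proof -
  define A :: "'v + 'v \<Rightarrow> 'v \<Rightarrow> real" where
    "A e u = (case e of Inl v \<Rightarrow> if u = v then 1 else 0 | Inr w \<Rightarrow> of_int (m u w))" for e u
  define L where "L e x = (\<Sum>u\<in>V. A e u * x u)" for e x
  have L: "v \<in> V \<Longrightarrow> L (Inl v) x = x v" "L (Inr w) x = (\<Sum>u\<in>V. x u * of_int (m u w))" for v w x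
    using fin by (simp add: L_def A_def if_distrib[of "\<lambda>x. x * _"] cong: if_cong,
      simp add: L_def A_def mult.commute)
  have card_split: "card {e \<in> V <+> V. P e} = card {v \<in> V. P (Inl v)} + card {w \<in> V. P (Inr w)}" for P
  proof -
    have "{e \<in> V <+> V. P e} = {v \<in> V. P (Inl v)} <+> {w \<in> V. P (Inr w)}" by auto
    then show ?thesis using fin by (simp add: card_Plus)
  qed
  let ?n = "card V"
  have "\<exists>C\<ge>0. \<forall>x. (\<Sum>v\<in>V. \<bar>x v\<bar>) \<le> C * (\<Sum>e\<in>E. \<bar>L e x\<bar>)"
    if E: "E \<subseteq> V <+> V" "?n \<le> card E" for E
    unfolding L_def
  proof (rule trivial_kernel_bound[OF fin])
    show "finite E" using E(1) fin by (meson finite_Plus finite_subset)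
    fix x assume "\<And>e. e \<in> E \<Longrightarrow> (\<Sum>v\<in>V. A e v * x v) = 0"
    then have "E \<subseteq> {e \<in> V <+> V. L e x = 0}" using E(1) by (auto simp: L_def)
    then have "card E \<le> card {e \<in> V <+> V. L e x = 0}" using fin by (intro card_mono) auto
    also have "\<dots> = card {v \<in> V. x v = 0} + card {w \<in> V. (\<Sum>u\<in>V. x u * of_int (m u w)) = 0}"
      unfolding card_split L(2) using L(1) by (simp cong: conj_cong)
    finally show "\<forall>v\<in>V. x v = 0" using m[of x] E(2) by fastforce
  qed
  then have "\<forall>E\<in>{E. E \<subseteq> V <+> V \<and> ?n \<le> card E}. \<exists>C. C \<ge> 0 \<and>
      (\<forall>x. (\<Sum>v\<in>V. \<bar>x v\<bar>) \<le> C * (\<Sum>e\<in>E. \<bar>L e x\<bar>))" by blast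
  from bchoice[OF this] obtain C where C: "\<And>E. \<lbrakk>E \<subseteq> V <+> V; ?n \<le> card E\<rbrakk> \<Longrightarrow>
      C E \<ge> 0 \<and> (\<forall>x. (\<Sum>v\<in>V. \<bar>x v\<bar>) \<le> C E * (\<Sum>e\<in>E. \<bar>L e x\<bar>))"
    by blast
  \<comment> \<open>Exceeds \<open>2 * card V * C E\<close> for every selection \<open>E\<close>: at
    most \<open>2 * card V\<close> forms, each below \<open>T / D\<close>, enter the
    estimate.\<close>
  define D where "D = 1 + 2 * real ?n * (\<Sum>E\<in>Pow (V <+> V). \<bar>C E\<bar>)"
  have D: "D > 0" unfolding D_def by (intro add_pos_nonneg mult_nonneg_nonneg sum_nonneg) auto
  have "card {e \<in> V <+> V. D * \<bar>L e x\<bar> < (\<Sum>u\<in>V. \<bar>x u\<bar>)} < ?n" for x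
  proof (rule ccontr)
    define T where "T = (\<Sum>u\<in>V. \<bar>x u\<bar>)"
    define E where "E = {e \<in> V <+> V. D * \<bar>L e x\<bar> < T}"
    assume "\<not> card {e \<in> V <+> V. D * \<bar>L e x\<bar> < (\<Sum>u\<in>V. \<bar>x u\<bar>)} < ?n"
    then have En: "?n \<le> card E" and EV: "E \<subseteq> V <+> V" by (auto simp: E_def T_def)
    have finE: "finite E" using EV fin by (meson finite_Plus finite_subset)
    have "card E > 0" using En ne fin by (metis card_gt_0_iff less_le_trans)
    then obtain e where "e \<in> E" using finE by (metis card_gt_0_iff ex_in_conv)
    then have T: "T > 0"
      using mult_nonneg_nonneg[OF less_imp_le[OF D] abs_ge_zero[of "L e x"]] unfolding E_def by auto
    have cE: "card E \<le> 2 * ?n"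
      using card_mono[OF _ EV] fin by (simp add: card_Plus)
    have "(\<Sum>e\<in>E. \<bar>L e x\<bar>) \<le> (\<Sum>e\<in>E. T / D)"
      by (intro sum_mono) (use D in \<open>auto simp: E_def field_simps\<close>)
    also have "\<dots> \<le> 2 * real ?n * (T / D)"
    proof -
      have "real (card E) \<le> 2 * real ?n" using cE by linarith
      from mult_right_mono[OF this, of "T / D"] show ?thesis using T D by simp
    qed
    finally have sum: "(\<Sum>e\<in>E. \<bar>L e x\<bar>) \<le> 2 * real ?n * (T / D)" .
    have CE: "C E \<le> (\<Sum>E\<in>Pow (V <+> V). \<bar>C E\<bar>)"
    proof -
      have "\<bar>C E\<bar> \<le> (\<Sum>E\<in>Pow (V <+> V). \<bar>C E\<bar>)"
        by (rule member_le_sum) (use EV fin in auto)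
      then show ?thesis by linarith
    qed
    have "T \<le> C E * (2 * real ?n * (T / D))"
      using C[OF EV En] sum mult_left_mono[OF sum, of "C E"] unfolding T_def by (meson order_trans)
    then have "T * D \<le> C E * (2 * real ?n) * T" using D by (simp add: field_simps)
    then have "D \<le> C E * (2 * real ?n)" using T by (simp add: mult.commute)
    also have "\<dots> \<le> (\<Sum>E\<in>Pow (V <+> V). \<bar>C E\<bar>) * (2 * real ?n)"
      by (rule mult_right_mono[OF CE]) simp
    finally show False by (simp add: D_def mult.commute)
  qed
  then have "card {v \<in> V. D * \<bar>x v\<bar> < (\<Sum>u\<in>V. \<bar>x u\<bar>)} +
    card {w \<in> V. D * \<bar>\<Sum>u\<in>V. x u * of_int (m u w)\<bar> < (\<Sum>u\<in>V. \<bar>x u\<bar>)} < ?n" for x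
    unfolding card_split L(2) using L(1) by (simp cong: conj_cong)
  then show ?thesis using D by blast
qed

section \<open>Extending labellings of a lattice\<close>

text \<open>The equations are the three squares at the top corner of a cube: \<open>sxy\<close>
  labels the edge from corner \<open>x\<close> to corner \<open>xy\<close>, and \<open>rx\<close>
  the edge in direction \<open>x\<close> into the top. The product \<open>sxy * inv syx\<close> is
  the passage from \<open>x\<close> to \<open>y\<close>.\<close>

lemma (in group) cube_cocycle:
  assumes cl: "sab \<in> carrier G" "sac \<in> carrier G" "sba \<in> carrier G" "sbc \<in> carrier G"
      "sca \<in> carrier G" "scb \<in> carrier G" "ra \<in> carrier G" "rb \<in> carrier G" "rc \<in> carrier G"
    and eq: "sab \<otimes> rc = sac \<otimes> rb" "sba \<otimes> rc = sbc \<otimes> ra" "sca \<otimes> rb = scb \<otimes> ra"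
  shows "(sab \<otimes> inv sba) \<otimes> (sbc \<otimes> inv scb) = sac \<otimes> inv sca"
proof -
  have cancel: "x \<otimes> (inv x \<otimes> y) = y" "inv x \<otimes> (x \<otimes> y) = y" if "x \<in> carrier G" "y \<in> carrier G" for x y
    using that by (simp_all flip: m_assoc)
  have "sab = sac \<otimes> rb \<otimes> inv rc" "sba = sbc \<otimes> ra \<otimes> inv rc" "sca = scb \<otimes> ra \<otimes> inv rb"
    using cl eq by (metis inv_solve_right m_closed)+
  then show ?thesis using cl by (simp add: inv_mult_group m_assoc cancel)
qed

text \<open>
  A strong letter still lowers the rank after up to two other letters, so that together with any
  square of lower points it spans a cube of lower points.
\<close>

definition strong_letter ::
    "('l::ab_group_add \<Rightarrow> nat) \<Rightarrow> 's set \<Rightarrow> ('s \<Rightarrow> 'l) \<Rightarrow> 'l \<Rightarrow> 's \<Rightarrow> bool" where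
  "strong_letter rank Y vec z s \<longleftrightarrow> s \<in> Y \<and>
     (\<forall>w \<in> {0} \<union> vec ` Y \<union> {vec a + vec b | a b. a \<in> Y \<and> b \<in> Y}.
        rank (z + w) \<le> rank z \<longrightarrow> rank (z + w + vec s) < rank z)"

text \<open>Letters of different sides commute, so the descending letters span a join. Strong
  letters serve as cone points: a connected set \<open>D\<close> of them that dominates side
  \<open>i\<close>, with one more on the other side, makes the join simply connected.\<close>

definition good_point ::
    "('l::ab_group_add \<Rightarrow> nat) \<Rightarrow> 's set \<Rightarrow> ('s \<Rightarrow> 'l) \<Rightarrow> ('s \<Rightarrow> 's \<Rightarrow> bool) \<Rightarrow> ('s \<Rightarrow> bool) \<Rightarrow> 'l \<Rightarrow> bool"
  where
  "good_point rank Y vec com side z \<longleftrightarrow>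
     (\<exists>i D v. strong_letter rank Y vec z v \<and> side v \<noteq> i \<and> D \<noteq> {} \<and>
        (\<forall>d\<in>D. strong_letter rank Y vec z d \<and> side d = i) \<and>
        (\<forall>d\<in>D. \<forall>d'\<in>D. (d, d') \<in> {(x, y). x \<in> D \<and> y \<in> D \<and> com x y}\<^sup>*) \<and>
        (\<forall>u\<in>Y. side u = i \<and> rank (z + vec u) < rank z \<longrightarrow> u \<in> D \<or> (\<exists>d\<in>D. com u d)))"

text \<open>
  Letters come with their inverses; they shift the points of a lattice \<open>L\<close>, and a labelling assigns
  to each edge of the lattice an element of \<open>Q\<close> such that squares of commuting letters commute.
  The points are added one at a time, in the order given by \<open>rank\<close>. The homomorphism \<open>\<epsilon>\<close> makes
  sure that the labelling stays compatible with the elements \<open>el a\<close> up to the gauge \<open>p\<close>.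
\<close>

locale labelling = Q: group Q + A: group A
  for Q :: "('q, 'm) monoid_scheme" (structure) and A :: "('a, 'n) monoid_scheme" (structure) +
  fixes \<epsilon> :: "'q \<Rightarrow> 'a" and L :: "'l::ab_group_add set" and rank :: "'l \<Rightarrow> nat"
    and Y :: "'s set" and vec :: "'s \<Rightarrow> 'l" and bar :: "'s \<Rightarrow> 's" and com :: "'s \<Rightarrow> 's \<Rightarrow> bool"
    and el :: "'s \<Rightarrow> 'a" and side :: "'s \<Rightarrow> bool"
  assumes eps_hom: "\<epsilon> \<in> hom Q A" and rank_inj: "inj_on rank L"
    and L_closed: "\<lbrakk>z \<in> L; a \<in> Y\<rbrakk> \<Longrightarrow> z + vec a \<in> L"
    and bar: "a \<in> Y \<Longrightarrow> bar a \<in> Y" "a \<in> Y \<Longrightarrow> bar (bar a) = a" "a \<in> Y \<Longrightarrow> vec (bar a) = - vec a"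
    and el: "a \<in> Y \<Longrightarrow> el a \<in> carrier A" "a \<in> Y \<Longrightarrow> el (bar a) = inv\<^bsub>A\<^esub> el a"
    and com: "com a b \<Longrightarrow> com b a" "\<lbrakk>a \<in> Y; com a b\<rbrakk> \<Longrightarrow> com (bar a) b"
      "\<lbrakk>a \<in> Y; b \<in> Y; side a \<noteq> side b\<rbrakk> \<Longrightarrow> com a b"
    and com_el: "\<lbrakk>a \<in> Y; b \<in> Y; com a b\<rbrakk> \<Longrightarrow> el a \<otimes>\<^bsub>A\<^esub> el b = el b \<otimes>\<^bsub>A\<^esub> el a"
    and vec_nz: "a \<in> Y \<Longrightarrow> vec a \<noteq> 0"
    and com_vec: "\<lbrakk>a \<in> Y; b \<in> Y; com a b\<rbrakk> \<Longrightarrow> vec a \<noteq> vec b"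
begin

definition initial :: "nat \<Rightarrow> 'l set" where
  "initial k = {z \<in> L. rank z < k}"

definition commuting_square :: "('l \<Rightarrow> 's \<Rightarrow> 'q) \<Rightarrow> 'l \<Rightarrow> 's \<Rightarrow> 's \<Rightarrow> bool" where
  "commuting_square lam z a b \<longleftrightarrow>
     lam z a \<otimes>\<^bsub>Q\<^esub> lam (z + vec a) b = lam z b \<otimes>\<^bsub>Q\<^esub> lam (z + vec b) a"

text \<open>Up to the frames \<open>p\<close>, the image under \<epsilon> is the constant labelling
  by \<open>el\<close>.\<close>

definition edge_ok :: "('l \<Rightarrow> 's \<Rightarrow> 'q) \<Rightarrow> ('l \<Rightarrow> 'a) \<Rightarrow> 'l \<Rightarrow> 's \<Rightarrow> bool" where
  "edge_ok lam p z a \<longleftrightarrow> lam z a \<in> carrier Q \<and> lam (z + vec a) (bar a) = inv\<^bsub>Q\<^esub> lam z a \<and>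
     \<epsilon> (lam z a) = p z \<otimes>\<^bsub>A\<^esub> el a \<otimes>\<^bsub>A\<^esub> inv\<^bsub>A\<^esub> p (z + vec a)"

definition valid_on :: "'l set \<Rightarrow> ('l \<Rightarrow> 's \<Rightarrow> 'q) \<Rightarrow> ('l \<Rightarrow> 'a) \<Rightarrow> bool" where
  "valid_on B lam p \<longleftrightarrow> (\<forall>z\<in>B. p z \<in> carrier A) \<and>
     (\<forall>z\<in>B. \<forall>a\<in>Y. z + vec a \<in> B \<longrightarrow> edge_ok lam p z a) \<and>
     (\<forall>z\<in>B. \<forall>a\<in>Y. \<forall>b\<in>Y. com a b \<and> z + vec a \<in> B \<and> z + vec b \<in> B \<and> z + vec a + vec b \<in> B \<longrightarrow>
        commuting_square lam z a b)"

abbreviation strong :: "'l \<Rightarrow> 's \<Rightarrow> bool" where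
  "strong \<equiv> strong_letter rank Y vec"

abbreviation good :: "'l \<Rightarrow> bool" where
  "good \<equiv> good_point rank Y vec com side"

lemma vec_bar: "a \<in> Y \<Longrightarrow> z + vec a + vec (bar a) = z"
  by (simp add: bar)

text \<open>Ensures that a newly added point is never two opposite corners of one square;
  neighbouring corners are kept apart by \<open>vec_nz\<close>.\<close>

lemma com_vec_sum:
  assumes "a \<in> Y" "b \<in> Y" "com a b"
  shows "vec a + vec b \<noteq> 0"
proof -
  have "vec (bar a) \<noteq> vec b" using com_vec[OF bar(1)[OF assms(1)] assms(2)] com(2) assms by blast
  then show ?thesis unfolding bar(3)[OF assms(1)] using minus_unique by blast
qed

lemma commuting_square_sym: "commuting_square lam z a b \<longleftrightarrow> commuting_square lam z b a"
  by (auto simp: commuting_square_def)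

text \<open>Reversed edges carry inverse labels, so the relation of a square can be read from any of
  its corners; a square meeting a new point can then be checked from that point.\<close>

lemma commuting_square_rotate:
  assumes "a \<in> Y" "b \<in> Y" "edge_ok lam p z a" "edge_ok lam p (z + vec b) a"
    "lam z b \<in> carrier Q" "lam (z + vec a) b \<in> carrier Q"
    "commuting_square lam (z + vec a) (bar a) b"
  shows "commuting_square lam z a b"
proof -
  have "lam (z + vec a + vec b) (bar a) = inv\<^bsub>Q\<^esub> lam (z + vec b) a"
    using assms(4) unfolding edge_ok_def by (simp add: ac_simps)
  then have "inv\<^bsub>Q\<^esub> lam z a \<otimes>\<^bsub>Q\<^esub> lam z b = lam (z + vec a) b \<otimes>\<^bsub>Q\<^esub> inv\<^bsub>Q\<^esub> lam (z + vec b) a"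
    using assms by (simp add: commuting_square_def edge_ok_def vec_bar)
  moreover have cl: "lam z a \<in> carrier Q" "lam (z + vec b) a \<in> carrier Q"
    using assms by (auto simp: edge_ok_def)
  ultimately have "lam z a \<otimes>\<^bsub>Q\<^esub> (lam (z + vec a) b \<otimes>\<^bsub>Q\<^esub> inv\<^bsub>Q\<^esub> lam (z + vec b) a) = lam z b"
    using assms(5,6) by (metis Q.inv_closed Q.inv_solve_left Q.m_closed)
  then have "lam z a \<otimes>\<^bsub>Q\<^esub> lam (z + vec a) b \<otimes>\<^bsub>Q\<^esub> inv\<^bsub>Q\<^esub> lam (z + vec b) a = lam z b"
    using cl assms(5,6) by (simp add: Q.m_assoc)
  then show ?thesis
    unfolding commuting_square_def using cl assms(5,6) by (metis Q.inv_solve_right Q.m_closed)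
qed

section \<open>Transitions below a point\<close>

definition descending :: "'l \<Rightarrow> 's \<Rightarrow> bool" where
  "descending z a \<longleftrightarrow> a \<in> Y \<and> rank (z + vec a) < rank z"

definition face :: "'l \<Rightarrow> 's \<Rightarrow> 's \<Rightarrow> bool" where
  "face z a b \<longleftrightarrow> descending z a \<and> descending z b \<and> com a b \<and> rank (z + vec a + vec b) < rank z"

text \<open>If \<open>c a\<close> is to label the edge from \<open>z\<close> to
  \<open>z + vec a\<close>, the squares at \<open>z\<close> demand that this equal
  \<open>inv (c a) * c b\<close>. Labelling a new point thus means writing the transitions as a
  coboundary.\<close>

definition transition :: "('l \<Rightarrow> 's \<Rightarrow> 'q) \<Rightarrow> 'l \<Rightarrow> 's \<Rightarrow> 's \<Rightarrow> 'q" where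
  "transition lam z a b = lam (z + vec a) b \<otimes>\<^bsub>Q\<^esub> inv\<^bsub>Q\<^esub> lam (z + vec b) a"

lemma face_sym: "face z a b \<Longrightarrow> face z b a"
  using com(1) by (simp add: face_def ac_simps)

lemma face_Y: "face z a b \<Longrightarrow> a \<in> Y \<and> b \<in> Y"
  by (simp add: face_def descending_def)

lemma strong_descending:
  assumes "strong z s"
  shows "descending z s"
proof -
  have "rank (z + 0) \<le> rank z \<longrightarrow> rank (z + 0 + vec s) < rank z" "s \<in> Y"
    using assms unfolding strong_letter_def by blast+
  then show ?thesis by (simp add: descending_def)
qed

lemma strong_face:
  assumes s: "strong z s" and a: "descending z a" "com s a"
  shows "face z s a"
proof -
  have "vec a \<in> {0} \<union> vec ` Y \<union> {vec a + vec b | a b. a \<in> Y \<and> b \<in> Y}"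
    using a by (auto simp: descending_def)
  then have "rank (z + vec a) \<le> rank z \<longrightarrow> rank (z + vec a + vec s) < rank z"
    using s unfolding strong_letter_def by blast
  then show ?thesis using a strong_descending[OF s] by (simp add: face_def descending_def ac_simps)
qed

lemma eps_inv: "x \<in> carrier Q \<Longrightarrow> \<epsilon> (inv\<^bsub>Q\<^esub> x) = inv\<^bsub>A\<^esub> \<epsilon> x"
  using group_hom.hom_inv[of Q A \<epsilon>] eps_hom Q.is_group A.is_group
  by (simp add: group_hom_def group_hom_axioms_def)

context
  fixes lam :: "'l \<Rightarrow> 's \<Rightarrow> 'q" and p :: "'l \<Rightarrow> 'a" and z :: 'l
  assumes valid: "valid_on (initial (rank z)) lam p" and z: "z \<in> L"
begin

lemma face_initial:
  assumes "face z a b"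
  shows "z + vec a \<in> initial (rank z)" "z + vec b \<in> initial (rank z)" "z + vec a + vec b \<in> initial (rank z)"
  using assms L_closed z by (auto simp: face_def descending_def initial_def)

lemma face_edge:
  assumes "face z a b"
  shows "edge_ok lam p (z + vec a) b"
  using valid face_initial[OF assms] face_Y[OF assms] by (simp add: valid_on_def)

lemma face_edge_closed: "face z a b \<Longrightarrow> lam (z + vec a) b \<in> carrier Q"
  using face_edge by (simp add: edge_ok_def)

lemma transition_closed: "face z a b \<Longrightarrow> transition lam z a b \<in> carrier Q"
  using face_edge_closed face_sym by (simp add: transition_def)

lemma transition_sym: "face z a b \<Longrightarrow> transition lam z b a = inv\<^bsub>Q\<^esub> transition lam z a b"
  using face_edge_closed face_sym by (simp add: transition_def Q.inv_mult_group)

lemma p_closed: "w \<in> initial (rank z) \<Longrightarrow> p w \<in> carrier A"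
  using valid by (simp add: valid_on_def)

text \<open>In \<open>A\<close> the transitions already form a coboundary, that of
  \<open>p (z + vec a) * inv (el a)\<close>; this dictates the frame at \<open>z\<close>.\<close>

lemma eps_transition:
  assumes f: "face z a b"
  shows "\<epsilon> (transition lam z a b) =
    p (z + vec a) \<otimes>\<^bsub>A\<^esub> inv\<^bsub>A\<^esub> el a \<otimes>\<^bsub>A\<^esub> el b \<otimes>\<^bsub>A\<^esub> inv\<^bsub>A\<^esub> p (z + vec b)"
proof -
  have e: "\<epsilon> (lam (z + vec a) b) = p (z + vec a) \<otimes>\<^bsub>A\<^esub> el b \<otimes>\<^bsub>A\<^esub> inv\<^bsub>A\<^esub> p (z + vec a + vec b)"
    "\<epsilon> (lam (z + vec b) a) = p (z + vec b) \<otimes>\<^bsub>A\<^esub> el a \<otimes>\<^bsub>A\<^esub> inv\<^bsub>A\<^esub> p (z + vec a + vec b)"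
    using face_edge[OF f] face_edge[OF face_sym[OF f]] by (simp_all add: edge_ok_def ac_simps)
  have cl: "el a \<in> carrier A" "el b \<in> carrier A" "p (z + vec a) \<in> carrier A" "p (z + vec b) \<in> carrier A"
    "p (z + vec a + vec b) \<in> carrier A"
    using face_Y[OF f] el p_closed face_initial[OF f] by auto
  have cancel: "inv\<^bsub>A\<^esub> x \<otimes>\<^bsub>A\<^esub> (x \<otimes>\<^bsub>A\<^esub> y) = y" if "x \<in> carrier A" "y \<in> carrier A" for x y
    using that by (simp flip: A.m_assoc)
  have "com a b" using f by (simp add: face_def)
  then have comm: "el b \<otimes>\<^bsub>A\<^esub> inv\<^bsub>A\<^esub> el a = inv\<^bsub>A\<^esub> el a \<otimes>\<^bsub>A\<^esub> el b"
    using com_el[of "bar a" b] com(2)[of a b] face_Y[OF f] bar el by simp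
  have "\<epsilon> (transition lam z a b) = \<epsilon> (lam (z + vec a) b) \<otimes>\<^bsub>A\<^esub> inv\<^bsub>A\<^esub> \<epsilon> (lam (z + vec b) a)"
    unfolding transition_def
    using hom_mult[OF eps_hom] face_edge_closed[OF f] face_edge_closed[OF face_sym[OF f]] by (simp add: eps_inv)
  also have "\<dots> = p (z + vec a) \<otimes>\<^bsub>A\<^esub> (el b \<otimes>\<^bsub>A\<^esub> inv\<^bsub>A\<^esub> el a) \<otimes>\<^bsub>A\<^esub> inv\<^bsub>A\<^esub> p (z + vec b)"
    unfolding e using cl by (simp add: A.inv_mult_group A.m_assoc cancel)
  finally show ?thesis unfolding comm using cl by (simp add: A.m_assoc)
qed

text \<open>With the top corner below \<open>z\<close>, the three squares of the cube that avoid
  \<open>z\<close> are already known to commute.\<close>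

lemma transition_cube:
  assumes ab: "face z a b" and bc: "face z b c" and ac: "face z a c"
    and top: "rank (z + vec a + vec b + vec c) < rank z"
  shows "transition lam z a b \<otimes>\<^bsub>Q\<^esub> transition lam z b c = transition lam z a c"
  unfolding transition_def
proof (rule Q.cube_cocycle)
  have Y: "a \<in> Y" "b \<in> Y" "c \<in> Y" using face_Y ab bc by blast+
  have top': "z + vec a + vec b + vec c \<in> initial (rank z)"
    using top L_closed z Y by (auto simp: initial_def)
  note faces = face_initial[OF ab] face_initial[OF bc] face_initial[OF ac]
    face_sym[OF ab, THEN face_initial(3)] face_sym[OF bc, THEN face_initial(3)]
    face_sym[OF ac, THEN face_initial(3)]
  have com': "com a b" "com b c" "com a c" using ab bc ac by (auto simp: face_def)
  have sq: "commuting_square lam (z + vec x) y w"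
    if "face z x y" "face z x w" "com y w" "z + vec x + vec y + vec w \<in> initial (rank z)" for x y w
    using valid that face_Y face_initial unfolding valid_on_def by blast
  have "commuting_square lam (z + vec a) b c" using sq[OF ab ac com'(2)] top' by simp
  then show "lam (z + vec a) b \<otimes>\<^bsub>Q\<^esub> lam (z + vec a + vec b) c =
      lam (z + vec a) c \<otimes>\<^bsub>Q\<^esub> lam (z + vec a + vec c) b"
    by (simp add: commuting_square_def)
  have "commuting_square lam (z + vec b) a c"
    using sq[OF face_sym[OF ab] bc com'(3)] top' by (simp add: ac_simps)
  then show "lam (z + vec b) a \<otimes>\<^bsub>Q\<^esub> lam (z + vec a + vec b) c =
      lam (z + vec b) c \<otimes>\<^bsub>Q\<^esub> lam (z + vec b + vec c) a"
    by (simp add: commuting_square_def ac_simps)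
  have "commuting_square lam (z + vec c) a b"
    using sq[OF face_sym[OF ac] face_sym[OF bc] com'(1)] top' by (simp add: ac_simps)
  then show "lam (z + vec c) a \<otimes>\<^bsub>Q\<^esub> lam (z + vec a + vec c) b =
      lam (z + vec c) b \<otimes>\<^bsub>Q\<^esub> lam (z + vec b + vec c) a"
    by (simp add: commuting_square_def ac_simps)
  have ed: "lam (w) x \<in> carrier Q"
    if "w \<in> initial (rank z)" "x \<in> Y" "w + vec x \<in> initial (rank z)" for w x
    using valid that by (simp add: valid_on_def edge_ok_def)
  show "lam (z + vec a + vec b) c \<in> carrier Q" "lam (z + vec a + vec c) b \<in> carrier Q"
      "lam (z + vec b + vec c) a \<in> carrier Q"
    using ed faces top' Y by (simp_all add: ac_simps)
qed (use face_edge_closed ab bc ac face_sym in blast)+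

lemma strong_cube:
  assumes s: "strong z s" and ab: "face z a b" and c: "com s a" "com s b"
  shows "transition lam z s a \<otimes>\<^bsub>Q\<^esub> transition lam z a b = transition lam z s b"
    "transition lam z a s \<otimes>\<^bsub>Q\<^esub> transition lam z s b = transition lam z a b"
proof -
  have sa: "face z s a" "face z s b" using strong_face[OF s] ab c by (auto simp: face_def)
  have "vec a + vec b \<in> {0} \<union> vec ` Y \<union> {vec a + vec b | a b. a \<in> Y \<and> b \<in> Y}"
    using face_Y[OF ab] by blast
  then have "rank (z + (vec a + vec b)) \<le> rank z \<longrightarrow> rank (z + (vec a + vec b) + vec s) < rank z"
    using s unfolding strong_letter_def by blast
  then have top: "rank (z + vec s + vec a + vec b) < rank z" "rank (z + vec a + vec s + vec b) < rank z"
    using ab by (simp_all add: face_def ac_simps)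
  show "transition lam z s a \<otimes>\<^bsub>Q\<^esub> transition lam z a b = transition lam z s b"
    by (rule transition_cube[OF sa(1) ab sa(2) top(1)])
  show "transition lam z a s \<otimes>\<^bsub>Q\<^esub> transition lam z s b = transition lam z a b"
    by (rule transition_cube[OF face_sym[OF sa(1)] sa(2) ab top(2)])
qed

text \<open>
  The faces below a good point form a simply connected complex: on the good side everything is in
  the cone of \<open>v\<close>, and the letters of the other side are joined to \<open>v\<close> through the connected set \<open>D\<close>.
\<close>

lemma good_coboundary:
  assumes good: "good z"
  obtains v c where "descending z v"
    "\<And>a. descending z a \<Longrightarrow> c a \<in> carrier Q"
    "\<And>a. descending z a \<Longrightarrow> \<epsilon> (c a) =
       p (z + vec v) \<otimes>\<^bsub>A\<^esub> inv\<^bsub>A\<^esub> el v \<otimes>\<^bsub>A\<^esub> el a \<otimes>\<^bsub>A\<^esub> inv\<^bsub>A\<^esub> p (z + vec a)"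
    "\<And>a b. face z a b \<Longrightarrow> c a \<otimes>\<^bsub>Q\<^esub> transition lam z a b = c b"
proof -
  obtain i D v where g: "strong z v \<and> side v \<noteq> i \<and> D \<noteq> {} \<and> (\<forall>d\<in>D. strong z d \<and> side d = i) \<and>
     (\<forall>d\<in>D. \<forall>d'\<in>D. (d, d') \<in> {(x, y). x \<in> D \<and> y \<in> D \<and> com x y}\<^sup>*) \<and>
     (\<forall>u\<in>Y. side u = i \<and> rank (z + vec u) < rank z \<longrightarrow> u \<in> D \<or> (\<exists>d\<in>D. com u d))"
    using good unfolding good_point_def by (elim exE)
  then have v: "strong z v" "side v \<noteq> i" and D: "D \<noteq> {}" "\<And>d. d \<in> D \<Longrightarrow> strong z d \<and> side d = i"
    by simp_all
  from g have dom: "u \<in> D \<or> (\<exists>d\<in>D. com u d)"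
    if "u \<in> Y" "side u = i" "rank (z + vec u) < rank z" for u
    using that by simp
  from g have conn: "(d, d') \<in> {(x, y). x \<in> D \<and> y \<in> D \<and> com x y}\<^sup>*" if "d \<in> D" "d' \<in> D" for d d'
    using that by simp
  obtain d0 where d0: "d0 \<in> D" using D(1) by blast
  \<comment> \<open>Paths from \<open>v\<close>: directly to the letters of side \<open>i\<close>,
    which all commute with \<open>v\<close>, and through \<open>d0\<close> to those of the other
    side.\<close>
  define c where "c a = (if side a = i then transition lam z v a else transition lam z v d0 \<otimes>\<^bsub>Q\<^esub> transition lam z d0 a)" for a
  have com_side: "com a b" if "descending z a" "descending z b" "side a \<noteq> side b" for a b
    using that com(3) by (simp add: descending_def)
  have Dd: "descending z d" if "d \<in> D" for d using strong_descending D(2) that by blast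
  have vd: "descending z v" using strong_descending v by blast
  have Y: "a \<in> Y" if "descending z a" for a using that by (simp add: descending_def)
  have fvu: "face z v a" if "descending z a" "side a = i" for a
    using strong_face[OF v(1) that(1)] com_side[OF vd that(1)] v(2) that(2) by simp
  have fdp: "face z d a" if "d \<in> D" "descending z a" "side a \<noteq> i" for d a
    using strong_face[of z d a] com_side[OF Dd that(2)] D(2) that by auto
  \<comment> \<open>The detour may pass through any \<open>d\<close> in \<open>D\<close>: for a step
    from \<open>d\<close> to \<open>d'\<close>, the cubes spanned by this step with \<open>v\<close>
    and with \<open>a\<close> exchange one detour for the other.\<close>
  have indep: "transition lam z v d \<otimes>\<^bsub>Q\<^esub> transition lam z d a = c a" if d: "d \<in> D" and a: "descending z a" "side a \<noteq> i" for d a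
    using conn[OF d0 d]
  proof (induction rule: rtrancl_induct)
    case base
    then show ?case using a by (simp add: c_def)
  next
    case (step d d')
    then have dd: "d \<in> D" "d' \<in> D" "com d d'" by auto
    have f: "face z d d'" using strong_face[of z d d'] D(2) Dd dd by blast
    have "com d a" "com d' a" "com v d" "com v d'"
      using com_side[OF Dd[OF dd(1)] a(1)] com_side[OF Dd[OF dd(2)] a(1)] com_side[OF vd Dd[OF dd(1)]]
        com_side[OF vd Dd[OF dd(2)]] D(2) dd a v by auto
    note cm = this
    have e1: "transition lam z v d' = transition lam z v d \<otimes>\<^bsub>Q\<^esub> transition lam z d d'"
      using strong_cube(1)[OF v(1) f cm(3,4)] by simp
    have e2: "transition lam z d d' \<otimes>\<^bsub>Q\<^esub> transition lam z d' a = transition lam z d a"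
      using strong_cube(1)[of d d' a] D(2) dd cm fdp[OF dd(2) a] by blast
    show ?case
      using step.IH transition_closed[OF f] transition_closed[OF fdp[OF dd(2) a]]
        transition_closed[OF fvu[OF Dd[OF dd(1)]]] D(2)[OF dd(1)] e2
      unfolding e1 by (simp add: Q.m_assoc)
  qed
  have c_closed: "c a \<in> carrier Q" if "descending z a" for a
    using that transition_closed fvu fdp[OF d0] Dd[OF d0] D(2)[OF d0] by (auto simp: c_def)
  \<comment> \<open>If \<open>a\<close> is not in \<open>D\<close>, some \<open>d\<close> in
    \<open>D\<close> commutes with it, and the cubes on \<open>v\<close>, \<open>a\<close>,
    \<open>d\<close> and on \<open>a\<close>, \<open>d\<close>, \<open>b\<close> reduce the claim to
    the detour through \<open>d\<close>.\<close>
  have mixed: "c a \<otimes>\<^bsub>Q\<^esub> transition lam z a b = c b" if f: "face z a b" and s: "side a = i" "side b \<noteq> i" for a b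
  proof -
    have ab: "descending z a" "descending z b" "com a b" using f by (auto simp: face_def)
    obtain d where d: "d \<in> D" "d = a \<or> com a d"
      using dom[of a] ab s by (auto simp: descending_def)
    show ?thesis
    proof (cases "d = a")
      case True
      then show ?thesis using indep[OF d(1) ab(2) s(2)] s by (simp add: c_def)
    next
      case False
      then have ad: "com d a" using d com(1) by blast
      have sd: "strong z d" "side d = i" using D(2) d(1) by auto
      have fad: "face z a d" using strong_face[OF sd(1) ab(1) ad] by (rule face_sym)
      have cvs: "com v a" "com v d" "com d b"
        using com_side[OF vd ab(1)] com_side[OF vd Dd[OF d(1)]] com_side[OF Dd[OF d(1)] ab(2)] v s sd by auto
      have e1: "transition lam z v a \<otimes>\<^bsub>Q\<^esub> transition lam z a d = transition lam z v d"
        by (rule strong_cube(1)[OF v(1) fad cvs(1,2)])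
      have e2: "transition lam z a d \<otimes>\<^bsub>Q\<^esub> transition lam z d b = transition lam z a b"
        by (rule strong_cube(2)[OF sd(1) f ad cvs(3)])
      have "c a \<otimes>\<^bsub>Q\<^esub> transition lam z a b = transition lam z v a \<otimes>\<^bsub>Q\<^esub> (transition lam z a d \<otimes>\<^bsub>Q\<^esub> transition lam z d b)"
        using s e2 by (simp add: c_def)
      also have "\<dots> = transition lam z v d \<otimes>\<^bsub>Q\<^esub> transition lam z d b"
        using e1 transition_closed[OF fad] transition_closed[OF fvu[OF ab(1) s(1)]]
          transition_closed[OF fdp[OF d(1) ab(2) s(2)]] by (simp flip: Q.m_assoc)
      finally show ?thesis using indep[OF d(1) ab(2) s(2)] by simp
    qed
  qed
  have cob: "c a \<otimes>\<^bsub>Q\<^esub> transition lam z a b = c b" if f: "face z a b" for a b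
  proof -
    have ab: "descending z a" "descending z b" "com a b" using f by (auto simp: face_def)
    consider "side a = i" "side b = i" | "side a = i" "side b \<noteq> i" | "side a \<noteq> i" "side b = i"
      | "side a \<noteq> i" "side b \<noteq> i" by blast
    then show ?thesis
    proof cases
      case 1
      then have "com v a" "com v b" using com_side[OF vd] ab v by auto
      then show ?thesis using strong_cube(1)[OF v(1) f] 1 by (simp add: c_def)
    next
      case 2
      then show ?thesis by (rule mixed[OF f])
    next
      case 3
      have "c b \<otimes>\<^bsub>Q\<^esub> inv\<^bsub>Q\<^esub> transition lam z a b = c a"
        using mixed[OF face_sym[OF f] 3(2,1)] transition_sym[OF f] by simp
      then show ?thesis
        using c_closed ab transition_closed[OF f] by (metis Q.inv_closed Q.inv_solve_right)
    next
      case 4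
      then have cm: "com d0 a" "com d0 b" using com_side[OF Dd[OF d0]] ab D(2)[OF d0] by auto
      have "transition lam z d0 a \<otimes>\<^bsub>Q\<^esub> transition lam z a b = transition lam z d0 b"
        using strong_cube(1)[OF _ f cm] D(2)[OF d0] by blast
      then show ?thesis
        using 4 transition_closed[OF f] transition_closed[OF fdp[OF d0 ab(1) 4(1)]]
          transition_closed[OF fvu[OF Dd[OF d0]]] D(2)[OF d0] by (simp add: c_def Q.m_assoc)
    qed
  qed
  have ini: "z + vec a \<in> initial (rank z)" if "descending z a" for a
    using that z L_closed by (simp add: descending_def initial_def)
  have pc: "p (z + vec a) \<in> carrier A" "el a \<in> carrier A" if "descending z a" for a
    using that p_closed ini el Y by auto
  have c_eps: "\<epsilon> (c a) = p (z + vec v) \<otimes>\<^bsub>A\<^esub> inv\<^bsub>A\<^esub> el v \<otimes>\<^bsub>A\<^esub> el a \<otimes>\<^bsub>A\<^esub> inv\<^bsub>A\<^esub> p (z + vec a)"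
    if a: "descending z a" for a
  proof (cases "side a = i")
    case True
    then show ?thesis using eps_transition[OF fvu[OF a True]] by (simp add: c_def)
  next
    case False
    have cancel: "inv\<^bsub>A\<^esub> x \<otimes>\<^bsub>A\<^esub> (x \<otimes>\<^bsub>A\<^esub> y) = y" "x \<otimes>\<^bsub>A\<^esub> (inv\<^bsub>A\<^esub> x \<otimes>\<^bsub>A\<^esub> y) = y"
      if "x \<in> carrier A" "y \<in> carrier A" for x y
      using that by (simp_all flip: A.m_assoc)
    have f: "face z v d0" "face z d0 a" using fvu[OF Dd[OF d0]] D(2)[OF d0] fdp[OF d0 a False] by auto
    have "\<epsilon> (c a) = \<epsilon> (transition lam z v d0) \<otimes>\<^bsub>A\<^esub> \<epsilon> (transition lam z d0 a)"
      using False hom_mult[OF eps_hom] transition_closed f by (simp add: c_def)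
    then show ?thesis
      unfolding eps_transition[OF f(1)] eps_transition[OF f(2)]
      using pc[OF vd] pc[OF Dd[OF d0]] pc[OF a] by (simp add: A.m_assoc cancel)
  qed
  show ?thesis by (rule that[OF vd c_closed c_eps cob])
qed

end

lemma initial_Suc: "z \<in> L \<Longrightarrow> initial (Suc (rank z)) = insert z (initial (rank z))"
  using rank_inj by (auto simp: initial_def inj_on_def less_Suc_eq)

lemma extend_valid:
  assumes valid: "valid_on (initial (rank z)) lam p" and z: "z \<in> L" and good: "good z"
  shows "\<exists>lam' p'. valid_on (initial (Suc (rank z))) lam' p' \<and>
    (\<forall>w\<in>initial (rank z). p' w = p w \<and>
       (\<forall>a\<in>Y. w + vec a \<in> initial (rank z) \<longrightarrow> lam' w a = lam w a))"
proof -
  let ?B = "initial (rank z)"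
  obtain v c where v: "descending z v"
    and c_closed: "\<And>a. descending z a \<Longrightarrow> c a \<in> carrier Q"
    and c_eps: "\<And>a. descending z a \<Longrightarrow> \<epsilon> (c a) =
       p (z + vec v) \<otimes>\<^bsub>A\<^esub> inv\<^bsub>A\<^esub> el v \<otimes>\<^bsub>A\<^esub> el a \<otimes>\<^bsub>A\<^esub> inv\<^bsub>A\<^esub> p (z + vec a)"
    and cob: "\<And>a b. face z a b \<Longrightarrow> c a \<otimes>\<^bsub>Q\<^esub> transition lam z a b = c b"
    using good_coboundary[OF valid z good] by blast
  have zB: "z \<notin> ?B" by (simp add: initial_def)
  have desc: "descending z a \<longleftrightarrow> a \<in> Y \<and> z + vec a \<in> ?B" for a
    using L_closed z by (auto simp: descending_def initial_def)
  define lam' where "lam' w b = (if w = z then c b else if w + vec b = z then inv\<^bsub>Q\<^esub> c (bar b) else lam w b)" for w b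
  \<comment> \<open>With this frame at \<open>z\<close>, the formula \<open>c_eps\<close> becomes
    the edge condition at \<open>z\<close>.\<close>
  define p' where "p' = p(z := p (z + vec v) \<otimes>\<^bsub>A\<^esub> inv\<^bsub>A\<^esub> el v)"
  have pB: "p w \<in> carrier A" if "w \<in> ?B" for w using valid that by (simp add: valid_on_def)
  have p'B: "p' w = p w" if "w \<in> ?B" for w using that zB by (auto simp: p'_def)
  have vY: "v \<in> Y" "z + vec v \<in> ?B" using v desc by auto
  have p'z: "p' z \<in> carrier A" using pB vY el by (simp add: p'_def)
  have zvec: "z + vec a \<noteq> z" if "a \<in> Y" for a using vec_nz[OF that] by simp
  have lam_old: "lam' w a = lam w a" if "w \<in> ?B" "w + vec a \<in> ?B" for w a
    using that zB by (auto simp: lam'_def)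
  have edge_z: "edge_ok lam' p' z a" if "descending z a" for a
    using that desc[of a] zvec[of a] c_closed[OF that] c_eps[OF that] p'B[of "z + vec a"] bar[of a]
    by (simp add: edge_ok_def lam'_def p'_def)
  have edge: "edge_ok lam' p' w a"
    if w: "w \<in> insert z ?B" "a \<in> Y" "w + vec a \<in> insert z ?B" for w a
  proof -
    consider "w = z" | "w \<noteq> z" "w + vec a = z" | "w \<in> ?B" "w + vec a \<in> ?B" using w by blast
    then show ?thesis
    proof cases
      case 1
      then show ?thesis using edge_z desc[of a] w zvec[of a] by simp
    next
      case 2
      have w': "w = z + vec (bar a)" using 2 bar(3)[OF w(2)] by (auto simp: algebra_simps)
      then have d: "descending z (bar a)" using desc w bar(1)[OF w(2)] 2 by simp
      from edge_z[OF d] have e: "c (bar a) \<in> carrier Q"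
        "\<epsilon> (c (bar a)) = p' z \<otimes>\<^bsub>A\<^esub> inv\<^bsub>A\<^esub> el a \<otimes>\<^bsub>A\<^esub> inv\<^bsub>A\<^esub> p' w"
        using el(2)[OF w(2)] w' by (simp_all add: edge_ok_def lam'_def)
      have p'w: "p' w \<in> carrier A" using w 2 pB p'B by simp
      have "\<epsilon> (inv\<^bsub>Q\<^esub> c (bar a)) = inv\<^bsub>A\<^esub> \<epsilon> (c (bar a))"
        using eps_inv[OF e(1)] .
      also have "\<dots> = p' w \<otimes>\<^bsub>A\<^esub> el a \<otimes>\<^bsub>A\<^esub> inv\<^bsub>A\<^esub> p' z"
        unfolding e(2) using p'w p'z el(1)[OF w(2)] by (simp add: A.inv_mult_group A.m_assoc)
      finally show ?thesis using 2 e(1) by (simp add: edge_ok_def lam'_def)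
    next
      case 3
      have "edge_ok lam p w a" using valid w(2) 3 by (simp add: valid_on_def)
      moreover have "lam' (w + vec a) (bar a) = lam (w + vec a) (bar a)"
        using lam_old[of "w + vec a" "bar a"] 3 vec_bar[OF w(2), of w] by simp
      ultimately show ?thesis
        using lam_old[OF 3] p'B[OF 3(1)] p'B[OF 3(2)] by (simp add: edge_ok_def)
    qed
  qed
  have base: "commuting_square lam' z a b"
    if ab: "a \<in> Y" "b \<in> Y" "com a b" "z + vec a \<in> ?B" "z + vec b \<in> ?B" "z + vec a + vec b \<in> ?B" for a b
  proof -
    have f: "face z a b" using ab desc by (auto simp: face_def initial_def)
    have "transition lam z a b \<in> carrier Q" by (rule transition_closed[OF valid z f])
    have l: "lam (z + vec a) b \<in> carrier Q" "lam (z + vec b) a \<in> carrier Q"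
      using face_edge_closed[OF valid z f] face_edge_closed[OF valid z face_sym[OF f]] by auto
    have cl: "c a \<in> carrier Q" "c b \<in> carrier Q" using c_closed f by (auto simp: face_def)
    have "c a \<otimes>\<^bsub>Q\<^esub> lam (z + vec a) b \<otimes>\<^bsub>Q\<^esub> inv\<^bsub>Q\<^esub> lam (z + vec b) a = c b"
      using cob[OF f] cl l by (simp add: transition_def Q.m_assoc)
    then have "c a \<otimes>\<^bsub>Q\<^esub> lam (z + vec a) b = c b \<otimes>\<^bsub>Q\<^esub> lam (z + vec b) a"
      using cl l by (metis Q.inv_solve_right Q.m_closed)
    moreover have "lam' (z + vec a) b = lam (z + vec a) b" "lam' (z + vec b) a = lam (z + vec b) a"
      using lam_old ab by (simp_all add: ac_simps)
    ultimately show ?thesis by (simp add: commuting_square_def lam'_def)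
  qed
  have base': "commuting_square lam' z a b"
    if ab: "a \<in> Y" "b \<in> Y" "com a b"
      and c: "z + vec a \<in> insert z ?B" "z + vec b \<in> insert z ?B" "z + vec a + vec b \<in> insert z ?B" for a b
  proof -
    have "z + vec a + vec b \<noteq> z" using com_vec_sum[OF ab] by (simp add: add.assoc)
    then show ?thesis using base[OF ab] c zvec[OF ab(1)] zvec[OF ab(2)] by blast
  qed
  have square: "commuting_square lam' w a b"
    if w: "w \<in> insert z ?B" and ab: "a \<in> Y" "b \<in> Y" "com a b"
      and corners: "w + vec a \<in> insert z ?B" "w + vec b \<in> insert z ?B" "w + vec a + vec b \<in> insert z ?B"
    for w a b
  proof -
    have bars: "bar a \<in> Y" "bar b \<in> Y" "com (bar a) b" "com (bar b) a" "com (bar a) (bar b)"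
      using bar(1)[OF ab(1)] bar(1)[OF ab(2)] com(2)[OF ab(1,3)] com(2)[OF ab(2) com(1)[OF ab(3)]]
        com(1)[OF com(2)[OF ab(2) com(1)[OF com(2)[OF ab(1,3)]]]] .
    have corners': "w + vec b + vec a \<in> insert z ?B" using corners(3) by (simp add: ac_simps)
    have rot: "commuting_square lam' w' x y"
      if "w' \<in> insert z ?B" "x \<in> Y" "y \<in> Y" "w' + vec x \<in> insert z ?B" "w' + vec y \<in> insert z ?B"
        "w' + vec x + vec y \<in> insert z ?B" "commuting_square lam' (w' + vec x) (bar x) y" for w' x y
    proof -
      have "w' + vec y + vec x \<in> insert z ?B" using that(6) by (simp add: ac_simps)
      then show ?thesis
        using that edge[of w' x] edge[of "w' + vec y" x] edge[of w' y] edge[of "w' + vec x" y]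
          commuting_square_rotate[of x y lam' p' w'] by (simp add: edge_ok_def)
    qed
    \<comment> \<open>Whichever corner equals \<open>z\<close>, the square is rotated until it
      starts there; the opposite corner takes two rotations.\<close>
    consider "w = z" | "w \<noteq> z" "w + vec a = z" | "w \<noteq> z" "w + vec b = z" | "w \<noteq> z" "w + vec a + vec b = z"
      | "w \<in> ?B" "w + vec a \<in> ?B" "w + vec b \<in> ?B" "w + vec a + vec b \<in> ?B"
      using w corners by blast
    then show ?thesis
    proof cases
      case 1
      then show ?thesis using base'[OF ab] corners by simp
    next
      case 2
      have e: "z + vec (bar a) = w" using 2 vec_bar[OF ab(1), of w] by simp
      have "commuting_square lam' z (bar a) b"
        using base'[OF bars(1) ab(2) bars(3), unfolded e] w corners 2 by simp
      then show ?thesis using rot[OF w ab(1,2) corners] 2 by simp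
    next
      case 3
      have e: "z + vec (bar b) = w" using 3 vec_bar[OF ab(2), of w] by simp
      have "commuting_square lam' z (bar b) a"
        by (rule base'[OF bars(2) ab(1) bars(4), unfolded e, OF w corners'[unfolded 3(2)] corners(1)])
      then have "commuting_square lam' w b a" using rot[OF w ab(2,1) corners(2,1) corners'] 3 by simp
      then show ?thesis by (simp add: commuting_square_sym)
    next
      case 4
      have wa: "z + vec (bar b) = w + vec a" using 4 vec_bar[OF ab(2), of "w + vec a"] by simp
      have "w + vec b + vec a = z" using 4 by (simp add: ac_simps)
      then have wb: "z + vec (bar a) = w + vec b" using vec_bar[OF ab(1), of "w + vec b"] by simp
      have sq: "commuting_square lam' z (bar b) (bar a)"
        by (rule base'[OF bars(2,1) com(1)[OF bars(5)], unfolded wa wb vec_bar[OF ab(1)], OF corners(1,2) w])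
      have c1: "w + vec a + vec (bar a) \<in> insert z ?B" unfolding vec_bar[OF ab(1)] by (rule w)
      have c2: "w + vec a + vec b + vec (bar a) \<in> insert z ?B" unfolding 4(2) wb by (rule corners(2))
      have c3: "commuting_square lam' (w + vec a + vec b) (bar b) (bar a)" unfolding 4(2) by (rule sq)
      have "commuting_square lam' (w + vec a) b (bar a)"
        by (rule rot[OF corners(1) ab(2) bars(1) corners(3) c1 c2 c3])
      then have "commuting_square lam' (w + vec a) (bar a) b" by (simp add: commuting_square_sym)
      then show ?thesis by (rule rot[OF w ab(1,2) corners])
    next
      case 5
      have "commuting_square lam w a b" using valid 5 ab unfolding valid_on_def by blast
      moreover have "w + vec b + vec a \<in> ?B" using 5(4) by (simp add: ac_simps)
      ultimately show ?thesis using lam_old 5 by (simp add: commuting_square_def)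
    qed
  qed
  have "valid_on (initial (Suc (rank z))) lam' p'"
    unfolding initial_Suc[OF z] valid_on_def
  proof (intro conjI ballI impI)
    show "p' w \<in> carrier A" if "w \<in> insert z ?B" for w using that p'z p'B pB by auto
  qed (rule edge square; blast)+
  then show ?thesis using p'B lam_old by blast
qed

text \<open>Dependent choice produces the stages. A value set on an edge between old points never
  changes afterwards, so the limit is well defined; a rank that no point attains leaves the stage as
  it is.\<close>

lemma extend_valid_everywhere:
  assumes valid: "valid_on (initial k0) lam0 p0"
    and good: "\<And>z. \<lbrakk>z \<in> L; rank z \<ge> k0\<rbrakk> \<Longrightarrow> good z"
  shows "\<exists>lam p. valid_on L lam p \<and> (\<forall>z\<in>initial k0. p z = p0 z)"
proof -
  define agree where "agree k x y \<longleftrightarrow> (\<forall>w\<in>initial k. snd y w = snd x w \<and>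
      (\<forall>a\<in>Y. w + vec a \<in> initial k \<longrightarrow> fst y w a = fst x w a))"
    for k and x y :: "('l \<Rightarrow> 's \<Rightarrow> 'q) \<times> ('l \<Rightarrow> 'a)"
  have step: "\<exists>y. valid_on (initial (Suc k)) (fst y) (snd y) \<and> agree k x y"
    if x: "valid_on (initial k) (fst x) (snd x)" and k: "k \<ge> k0" for x k
  proof (cases "\<exists>z\<in>L. rank z = k")
    case True
    then obtain z where z: "z \<in> L" "rank z = k" by blast
    from extend_valid[of z "fst x" "snd x"] x z good k
    obtain lam' p' where "valid_on (initial (Suc k)) lam' p'"
        "\<forall>w\<in>initial k. p' w = snd x w \<and> (\<forall>a\<in>Y. w + vec a \<in> initial k \<longrightarrow> lam' w a = fst x w a)"
      by blast
    then show ?thesis by (intro exI[of _ "(lam', p')"]) (simp add: agree_def)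
  next
    case False
    then have "initial (Suc k) = initial k" by (auto simp: initial_def less_Suc_eq)
    then show ?thesis using x by (intro exI[of _ x]) (simp add: agree_def)
  qed
  have "\<exists>f. \<forall>n. (valid_on (initial (k0 + n)) (fst (f n)) (snd (f n)) \<and> (n = 0 \<longrightarrow> f n = (lam0, p0))) \<and>
      agree (k0 + n) (f n) (f (Suc n))"
  proof (rule dependent_nat_choice)
    show "\<exists>x. valid_on (initial (k0 + 0)) (fst x) (snd x) \<and> (0 = (0::nat) \<longrightarrow> x = (lam0, p0))"
      using valid by (intro exI[of _ "(lam0, p0)"]) simp
  next
    fix x n
    assume "valid_on (initial (k0 + n)) (fst x) (snd x) \<and> (n = 0 \<longrightarrow> x = (lam0, p0))"
    then obtain y where "valid_on (initial (Suc (k0 + n))) (fst y) (snd y)" "agree (k0 + n) x y"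
      using step[of "k0 + n" x] by auto
    then show "\<exists>y. (valid_on (initial (k0 + Suc n)) (fst y) (snd y) \<and> (Suc n = 0 \<longrightarrow> y = (lam0, p0))) \<and>
        agree (k0 + n) x y"
      by (intro exI[of _ y]) simp
  qed
  then obtain f where f: "\<And>n. valid_on (initial (k0 + n)) (fst (f n)) (snd (f n))"
      "\<And>n. agree (k0 + n) (f n) (f (Suc n))" "f 0 = (lam0, p0)" by blast
  have mono: "initial k \<subseteq> initial l" if "k \<le> l" for k l using that by (auto simp: initial_def)
  have agree: "agree (k0 + n) (f n) (f (n + m))" for n m
  proof (induction m)
    case (Suc m)
    then show ?case
      using f(2)[of "n + m"] mono[of "k0 + n" "k0 + (n + m)"] unfolding agree_def by fastforce
  qed (simp add: agree_def)
  \<comment> \<open>Stage \<open>Suc (rank z)\<close> is late enough to contain \<open>z\<close>;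
    for an edge, the sum of the two ranks takes the place of \<open>rank z\<close>.\<close>
  define p where "p z = snd (f (Suc (rank z))) z" for z
  define lam where "lam z a = fst (f (Suc (rank z + rank (z + vec a)))) z a" for z a
  have p_eq: "p z = snd (f n) z" if "z \<in> initial (k0 + n)" "z \<in> L" for z n
  proof -
    have "snd (f (max n (Suc (rank z)))) z = snd (f n) z"
      using agree[of n "max n (Suc (rank z)) - n"] that by (simp add: agree_def)
    moreover have "z \<in> initial (k0 + Suc (rank z))" using that by (simp add: initial_def)
    then have "snd (f (max n (Suc (rank z)))) z = p z"
      using agree[of "Suc (rank z)" "max n (Suc (rank z)) - Suc (rank z)"] by (simp add: agree_def p_def)
    ultimately show ?thesis by simp
  qed
  have lam_eq: "lam z a = fst (f n) z a"
    if "z \<in> initial (k0 + n)" "a \<in> Y" "z + vec a \<in> initial (k0 + n)" for z a n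
  proof -
    let ?l = "Suc (rank z + rank (z + vec a))"
    have "fst (f (max n ?l)) z a = fst (f n) z a"
      using agree[of n "max n ?l - n"] that by (simp add: agree_def)
    moreover have "z \<in> initial (k0 + ?l)" "z + vec a \<in> initial (k0 + ?l)"
      using that by (auto simp: initial_def)
    then have "fst (f (max n ?l)) z a = lam z a"
      using agree[of ?l "max n ?l - ?l"] that(2) by (simp add: agree_def lam_def)
    ultimately show ?thesis by simp
  qed
  have edge: "edge_ok lam p z a" if "z \<in> L" "a \<in> Y" for z a
  proof -
    define n where "n = Suc (rank z + rank (z + vec a))"
    have zi: "z \<in> initial (k0 + n)" "z + vec a \<in> initial (k0 + n)"
      using that L_closed by (auto simp: initial_def n_def)
    moreover have zi3: "z + vec a + vec (bar a) \<in> initial (k0 + n)"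
      unfolding vec_bar[OF that(2)] by (rule zi(1))
    ultimately have "edge_ok (fst (f n)) (snd (f n)) z a" using f(1)[of n] that by (simp add: valid_on_def)
    then show ?thesis
      using lam_eq[OF zi(1) that(2) zi(2)] lam_eq[OF zi(2) bar(1)[OF that(2)] zi3] p_eq[OF zi(1)]
        p_eq[OF zi(2)] that L_closed by (simp add: edge_ok_def)
  qed
  have square: "commuting_square lam z a b" if "z \<in> L" "a \<in> Y" "b \<in> Y" "com a b" for z a b
  proof -
    define n where "n = Suc (rank z + rank (z + vec a) + rank (z + vec b) + rank (z + vec a + vec b))"
    have zi: "z \<in> initial (k0 + n)" "z + vec a \<in> initial (k0 + n)" "z + vec b \<in> initial (k0 + n)"
      "z + vec a + vec b \<in> initial (k0 + n)"
      using that L_closed by (auto simp: initial_def n_def)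
    then have zi': "z + vec b + vec a \<in> initial (k0 + n)" by (simp add: ac_simps)
    have "commuting_square (fst (f n)) z a b"
      using f(1)[of n] that zi unfolding valid_on_def by blast
    then show ?thesis
      using lam_eq[OF zi(1) that(2) zi(2)] lam_eq[OF zi(1) that(3) zi(3)]
        lam_eq[OF zi(2) that(3) zi(4)] lam_eq[OF zi(3) that(2) zi']
      by (simp add: commuting_square_def)
  qed
  have p_closed: "p z \<in> carrier A" if "z \<in> L" for z
  proof -
    have "z \<in> initial (k0 + Suc (rank z))" using that by (simp add: initial_def)
    then show ?thesis using f(1)[of "Suc (rank z)"] by (simp add: p_def valid_on_def)
  qed
  have "p z = p0 z" if "z \<in> initial k0" for z
    using p_eq[of z 0] that f(3) by (simp add: initial_def)
  moreover have "valid_on L lam p" unfolding valid_on_def using p_closed edge square by blast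
  ultimately show ?thesis by blast
qed

end

section \<open>Finitely presented fibre products\<close>

text \<open>The commutator subgroup is trivial, so the fibre product is the diagonal copy of
  \<open>raag K\<close> and inherits its presentation.\<close>

theorem abelian_fibre_product_finitely_presented:
  assumes K: "simplicial_complex K" and fin: "finite (vertices K)" and A: "comm_group (raag K)"
  shows "finitely_presented (fibre_product (raag K) id)"
proof -
  interpret G: comm_group "raag K" by fact
  let ?P = "fibre_product (raag K) id"
  have P: "group ?P" by (rule group_fibre_product[OF G.is_group iso_id])
  have D: "commutator_subgroup (raag K) = {\<one>\<^bsub>raag K\<^esub>}"
    by (rule G.derived_eq_singleton) simp
  have memP: "(g, h) \<in> carrier ?P \<longleftrightarrow> g \<in> carrier (raag K) \<and> h = g" for g h
    by (auto simp: fibre_product_def D r_coset_def)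
  define \<epsilon> where "\<epsilon> v = (raag_gen K v, raag_gen K v)" for v
  have dhom: "(\<lambda>g. (g, g)) \<in> hom (raag K) ?P"
    by (rule homI) (simp_all add: memP fibre_product_mult)
  have fsthom: "fst \<in> hom ?P (raag K)"
    by (rule homI) (auto simp: memP fibre_product_mult)
  have \<epsilon>: "\<epsilon> \<in> vertices K \<rightarrow> carrier ?P" by (auto simp: \<epsilon>_def memP)
  have R: "\<forall>r\<in>raag_relators K. word_value ?P \<epsilon> r = \<one>\<^bsub>?P\<^esub>"
  proof
    fix r assume "r \<in> raag_relators K"
    then obtain u v where uv: "r = commutator_word u v" "{u, v} \<in> K" by blast
    note e = edge_vertices[OF K uv(2)]
    show "word_value ?P \<epsilon> r = \<one>\<^bsub>?P\<^esub>"
      unfolding uv(1) using group.word_value_commutator[OF P, of \<epsilon> u v] \<epsilon> e raag_gen_commute[OF K uv(2)]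
      by (simp add: \<epsilon>_def memP fibre_product_mult)
  qed
  have finR: "finite (raag_relators K)"
  proof (rule finite_subset)
    show "raag_relators K \<subseteq> (\<lambda>(u, v). commutator_word u v) ` (vertices K \<times> vertices K)"
      using edge_vertices[OF K] by auto
  qed (use fin in simp)
  show ?thesis
  proof (rule finitely_presented_retract[OF P fin finR raag_relators_words[OF K] \<epsilon> R])
    show "fst \<in> hom ?P (presented_group (vertices K) (raag_relators K))"
      using fsthom by (simp add: raag_def)
    fix p assume p: "p \<in> carrier ?P"
    then obtain g where g: "p = (g, g)" "g \<in> carrier (raag K)" by (cases p) (auto simp: memP)
    have "lift_presented ?P \<epsilon> g = (g, g)"
    proof (rule raag_hom_eqI[OF P _ dhom _ g(2)])
      show "lift_presented ?P \<epsilon> \<in> hom (raag K) ?P"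
        using group.lift_presented_hom[OF P \<epsilon> raag_relators_words[OF K] R, folded raag_def] .
      show "lift_presented ?P \<epsilon> (raag_gen K v) = (raag_gen K v, raag_gen K v)" if "v \<in> vertices K" for v
        using lift_presented_gen[OF P \<epsilon> raag_relators_words[OF K] R that]
        by (simp only: \<epsilon>_def raag_gen_def)
    qed
    then show "lift_presented ?P \<epsilon> (fst p) = p" by (simp add: g)
  qed
qed

section \<open>Lattice points ordered by norm\<close>

text \<open>Ties of \<open>q\<close> are broken by an enumeration of the countable set
  \<open>L\<close>. Finite sublevel sets make the number of earlier points finite, and that number
  is the rank.\<close>

lemma rank_refining:
  fixes q :: "'l \<Rightarrow> nat"
  assumes fin: "\<And>n. finite {z \<in> L. q z \<le> n}"
  obtains rank :: "'l \<Rightarrow> nat" where "inj_on rank L"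
    "\<And>z z'. \<lbrakk>z \<in> L; z' \<in> L; q z < q z'\<rbrakk> \<Longrightarrow> rank z < rank z'"
proof -
  have "L = (\<Union>n. {z \<in> L. q z \<le> n})" by auto
  also have "countable \<dots>" using fin by (intro countable_UN) (auto intro: countable_finite)
  finally have "countable L" .
  then obtain enc :: "'l \<Rightarrow> nat" where enc: "inj_on enc L" by (auto simp: countable_def)
  define before where "before z = {y \<in> L. q y < q z \<or> q y = q z \<and> enc y < enc z}" for z
  have finb: "finite (before z)" for z
    by (rule finite_subset[OF _ fin[of "q z"]]) (auto simp: before_def)
  have less: "card (before z) < card (before z')"
    if "z \<in> L" "z' \<in> L" "q z < q z' \<or> q z = q z' \<and> enc z < enc z'" for z z'
  proof (rule psubset_card_mono[OF finb])
    show "before z \<subset> before z'"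
    proof
      show "before z \<subseteq> before z'" using that by (auto simp: before_def)
      have "z \<in> before z'" "z \<notin> before z" using that by (auto simp: before_def)
      then show "before z \<noteq> before z'" by blast
    qed
  qed
  show ?thesis
  proof (rule that[of "\<lambda>z. card (before z)"])
    show "inj_on (\<lambda>z. card (before z)) L"
    proof (rule inj_onI)
      fix z z' assume zz: "z \<in> L" "z' \<in> L" "card (before z) = card (before z')"
      then have "\<not> (q z < q z' \<or> q z = q z' \<and> enc z < enc z')"
          "\<not> (q z' < q z \<or> q z' = q z \<and> enc z' < enc z)"
        using less[of z z'] less[of z' z] by auto
      then have "enc z = enc z'" by linarith
      then show "z = z'" using enc zz by (auto dest: inj_onD)
    qed
  qed (use less in blast)
qed

section \<open>Automorphisms of the abelianisation given by integer matrices\<close>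

lemma exponents_surjective:
  assumes K: "simplicial_complex K" and fin: "finite (vertices K)" and x: "\<And>v. v \<notin> vertices K \<Longrightarrow> x v = 0"
  obtains g where "g \<in> carrier (raag K)" "exponents K g = x"
proof -
  interpret G: group "raag K" by (rule group_raag)
  have single: "\<exists>g\<in>carrier (raag K). exponents K g = (\<lambda>u. if u = v then k else 0)"
    if v: "v \<in> vertices K" for v and k :: int
  proof (induction k rule: int_induct[where k = 0])
    case base
    show ?case by (rule bexI[of _ "\<one>\<^bsub>raag K\<^esub>"]) (auto simp: exponents_one[OF K])
  next
    case (step1 k)
    then obtain g where "g \<in> carrier (raag K)" "exponents K g = (\<lambda>u. if u = v then k else 0)" by blast
    then show ?case
      using v by (intro bexI[of _ "raag_gen K v \<otimes>\<^bsub>raag K\<^esub> g"]) (auto simp: exponents_mult[OF K] exponents_gen[OF K])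
  next
    case (step2 k)
    then obtain g where "g \<in> carrier (raag K)" "exponents K g = (\<lambda>u. if u = v then k else 0)" by blast
    then show ?case
      using v by (intro bexI[of _ "inv\<^bsub>raag K\<^esub> raag_gen K v \<otimes>\<^bsub>raag K\<^esub> g"])
        (auto simp: exponents_mult[OF K] exponents_gen[OF K] exponents_inv[OF K])
  qed
  have "\<exists>g\<in>carrier (raag K). exponents K g = (\<lambda>u. if u \<in> W then x u else 0)" if "W \<subseteq> vertices K" for W
    using finite_subset[OF that fin] that
  proof (induction W rule: finite_induct)
    case empty
    show ?case by (rule bexI[of _ "\<one>\<^bsub>raag K\<^esub>"]) (auto simp: exponents_one[OF K])
  next
    case (insert w W)
    then obtain g where g: "g \<in> carrier (raag K)" "exponents K g = (\<lambda>u. if u \<in> W then x u else 0)" by blast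
    obtain h where h: "h \<in> carrier (raag K)" "exponents K h = (\<lambda>u. if u = w then x w else 0)"
      using single[of w "x w"] insert.prems by blast
    show ?case
      using g h insert.hyps by (intro bexI[of _ "g \<otimes>\<^bsub>raag K\<^esub> h"]) (auto simp: exponents_mult[OF K])
  qed
  from this[of "vertices K"] show ?thesis using that x by (metis (no_types, lifting) ext subset_refl)
qed

definition matrix_map :: "'v set \<Rightarrow> ('v \<Rightarrow> 'v \<Rightarrow> int) \<Rightarrow> ('v \<Rightarrow> int) \<Rightarrow> 'v \<Rightarrow> int" where
  "matrix_map V m x = (\<lambda>u. if u \<in> V then \<Sum>v\<in>V. m u v * x v else 0)"

lemma matrix_map_add: "matrix_map V m (x + y) = matrix_map V m x + matrix_map V m y"
  by (auto simp: matrix_map_def distrib_left sum.distrib)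

lemma matrix_map_inverse:
  assumes fin: "finite V" and x: "\<And>v. v \<notin> V \<Longrightarrow> x v = 0"
    and inv: "\<And>v w. \<lbrakk>v \<in> V; w \<in> V\<rbrakk> \<Longrightarrow> (\<Sum>u\<in>V. m' v u * m u w) = (if v = w then 1 else 0)"
  shows "matrix_map V m' (matrix_map V m x) = x"
proof
  fix v
  show "matrix_map V m' (matrix_map V m x) v = x v"
  proof (cases "v \<in> V")
    case True
    have "matrix_map V m' (matrix_map V m x) v = (\<Sum>u\<in>V. \<Sum>w\<in>V. m' v u * m u w * x w)"
      using True by (simp add: matrix_map_def sum_distrib_left mult.assoc)
    also have "\<dots> = (\<Sum>w\<in>V. (\<Sum>u\<in>V. m' v u * m u w) * x w)"
      by (subst sum.swap) (simp add: sum_distrib_right)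
    also have "\<dots> = (\<Sum>w\<in>V. (if v = w then 1 else 0) * x w)"
      using True inv by (intro sum.cong) auto
    also have "\<dots> = x v" using True fin by (simp add: if_distrib[of "\<lambda>x. x * _"] cong: if_cong)
    finally show ?thesis .
  qed (simp add: matrix_map_def x)
qed

lemma matrix_automorphism:
  assumes K: "simplicial_complex K" and fin: "finite (vertices K)"
    and inv: "\<And>v w. \<lbrakk>v \<in> vertices K; w \<in> vertices K\<rbrakk> \<Longrightarrow>
        (\<Sum>u\<in>vertices K. m' v u * m u w) = (if v = w then 1 else 0)"
      "\<And>v w. \<lbrakk>v \<in> vertices K; w \<in> vertices K\<rbrakk> \<Longrightarrow>
        (\<Sum>u\<in>vertices K. m v u * m' u w) = (if v = w then 1 else 0)"
  obtains \<mu> where "\<mu> \<in> iso (abelianisation (raag K)) (abelianisation (raag K))"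
    "carrier (fibre_product (raag K) \<mu>) = {(g, h). g \<in> carrier (raag K) \<and> h \<in> carrier (raag K) \<and>
       exponents K h = matrix_map (vertices K) m (exponents K g)}"
proof -
  let ?G = "raag K" and ?D = "commutator_subgroup (raag K)"
  interpret G: group ?G by (rule group_raag)
  interpret Der: normal ?D ?G by (rule G.derived_self_is_normal)
  let ?M = "matrix_map (vertices K) m" and ?M' = "matrix_map (vertices K) m'"
  let ?q = "\<lambda>g. ?D #>\<^bsub>?G\<^esub> g"
  have carr: "carrier (abelianisation ?G) = ?q ` carrier ?G"
    by (auto simp: FactGroup_def RCOSETS_def)
  have q_eq: "?q g = ?q h \<longleftrightarrow> exponents K g = exponents K h" if "g \<in> carrier ?G" "h \<in> carrier ?G" for g h
    by (rule commutator_coset_eq_iff[OF K fin that])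
  have q_mult: "?q g \<otimes>\<^bsub>abelianisation ?G\<^esub> ?q h = ?q (g \<otimes>\<^bsub>?G\<^esub> h)" if "g \<in> carrier ?G" "h \<in> carrier ?G" for g h
    using Der.rcos_sum[OF that] by (simp add: FactGroup_def)
  have out: "exponents K g v = 0" if "g \<in> carrier ?G" "v \<notin> vertices K" for g v
    by (rule exponents_outside[OF K that])
  have M_out: "?M x v = 0" "?M' x v = 0" if "v \<notin> vertices K" for x v
    using that by (simp_all add: matrix_map_def)
  have M'M: "?M' (?M (exponents K g)) = exponents K g" "?M (?M' (exponents K g)) = exponents K g"
    if "g \<in> carrier ?G" for g
  proof -
    show "?M' (?M (exponents K g)) = exponents K g"
      by (rule matrix_map_inverse[OF fin]) (simp_all add: out[OF that] inv(1))
    show "?M (?M' (exponents K g)) = exponents K g"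
      by (rule matrix_map_inverse[OF fin]) (simp_all add: out[OF that] inv(2))
  qed
  \<comment> \<open>A set-theoretic section of the exponent map; only the coset of its value enters,
    so the choice is immaterial.\<close>
  define s where "s x = (SOME g. g \<in> carrier ?G \<and> exponents K g = x)" for x
  have s: "s x \<in> carrier ?G \<and> exponents K (s x) = x" if x: "\<And>v. v \<notin> vertices K \<Longrightarrow> x v = 0" for x
  proof -
    obtain g where "g \<in> carrier ?G" "exponents K g = x"
      by (rule exponents_surjective[where x = x, OF K fin x])
    then have "\<exists>g. g \<in> carrier ?G \<and> exponents K g = x" by blast
    then show ?thesis unfolding s_def by (rule someI_ex)
  qed
  have sM: "s (?M x) \<in> carrier ?G" "exponents K (s (?M x)) = ?M x"
      "s (?M' x) \<in> carrier ?G" "exponents K (s (?M' x)) = ?M' x" for x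
    using s[OF M_out(1)] s[OF M_out(2)] by simp_all
  define \<mu> where "\<mu> C = ?q (s (?M (exponents K (SOME g. g \<in> C))))" for C
  have \<mu>: "\<mu> (?q g) = ?q (s (?M (exponents K g)))" if g: "g \<in> carrier ?G" for g
  proof -
    have "g \<in> ?q g" using g Der.subgroup_axioms by (rule G.rcos_self)
    then have "(SOME h. h \<in> ?q g) \<in> ?q g" by (rule someI)
    moreover have "h \<in> carrier ?G \<and> exponents K h = exponents K g" if "h \<in> ?q g" for h
    proof -
      have h: "h \<in> carrier ?G"
        by (rule Der.elemrcos_carrier[OF G.is_group g that])
      have "?q g = ?q h" using that g Der.subgroup_axioms by (rule G.repr_independence)
      then show ?thesis using q_eq[OF g h] h by simp
    qed
    ultimately have "exponents K (SOME h. h \<in> ?q g) = exponents K g" by blast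
    then show ?thesis by (simp add: \<mu>_def)
  qed
  have \<mu>_eq: "\<mu> (?q g) = ?q h \<longleftrightarrow> exponents K h = ?M (exponents K g)"
    if "g \<in> carrier ?G" "h \<in> carrier ?G" for g h
    using that q_eq[OF sM(1) that(2)] sM(2) by (auto simp: \<mu>)
  have hom: "\<mu> \<in> hom (abelianisation ?G) (abelianisation ?G)"
  proof (rule homI)
    fix x y assume "x \<in> carrier (abelianisation ?G)" "y \<in> carrier (abelianisation ?G)"
    then obtain g h where gh: "g \<in> carrier ?G" "h \<in> carrier ?G" "x = ?q g" "y = ?q h"
      unfolding carr by blast
    show "\<mu> x \<in> carrier (abelianisation ?G)" unfolding gh(3) \<mu>[OF gh(1)] carr using sM(1) by blast
    have "\<mu> (?q (g \<otimes>\<^bsub>?G\<^esub> h)) = ?q (s (?M (exponents K g)) \<otimes>\<^bsub>?G\<^esub> s (?M (exponents K h)))"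
      using gh sM by (subst \<mu>_eq) (simp_all add: exponents_mult[OF K] matrix_map_add)
    then show "\<mu> (x \<otimes>\<^bsub>abelianisation ?G\<^esub> y) = \<mu> x \<otimes>\<^bsub>abelianisation ?G\<^esub> \<mu> y"
      unfolding gh(3,4) q_mult[OF gh(1,2)] \<mu>[OF gh(1)] \<mu>[OF gh(2)] q_mult[OF sM(1) sM(1)] .
  qed
  have inj: "inj_on \<mu> (carrier (abelianisation ?G))"
  proof (rule inj_onI)
    fix x y assume xy: "x \<in> carrier (abelianisation ?G)" "y \<in> carrier (abelianisation ?G)" "\<mu> x = \<mu> y"
    then obtain g h where gh: "g \<in> carrier ?G" "h \<in> carrier ?G" "x = ?q g" "y = ?q h"
      unfolding carr by blast
    have "?q (s (?M (exponents K g))) = ?q (s (?M (exponents K h)))"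
      using xy(3) unfolding gh(3,4) \<mu>[OF gh(1)] \<mu>[OF gh(2)] .
    then have "?M (exponents K g) = ?M (exponents K h)" using q_eq[OF sM(1) sM(1)] sM(2) by simp
    then have "?M' (?M (exponents K g)) = ?M' (?M (exponents K h))" by (rule arg_cong)
    then show "x = y" unfolding gh(3,4) using q_eq[OF gh(1,2)] M'M(1)[OF gh(1)] M'M(1)[OF gh(2)] by simp
  qed
  have surj: "\<mu> ` carrier (abelianisation ?G) = carrier (abelianisation ?G)"
  proof
    show "\<mu> ` carrier (abelianisation ?G) \<subseteq> carrier (abelianisation ?G)"
      using hom by (auto simp: hom_def)
    show "carrier (abelianisation ?G) \<subseteq> \<mu> ` carrier (abelianisation ?G)"
    proof
      fix y assume "y \<in> carrier (abelianisation ?G)"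
      then obtain h where h: "h \<in> carrier ?G" "y = ?q h" unfolding carr by blast
      have "\<mu> (?q (s (?M' (exponents K h)))) = ?q h"
        using sM(3,4) h(1) M'M(2)[OF h(1)] by (subst \<mu>_eq) simp_all
      then show "y \<in> \<mu> ` carrier (abelianisation ?G)" unfolding h(2) carr using sM(3) by (metis imageI)
    qed
  qed
  show ?thesis
  proof (rule that[of \<mu>])
    show "\<mu> \<in> iso (abelianisation ?G) (abelianisation ?G)"
      using hom inj surj by (simp add: iso_def bij_betw_def)
    show "carrier (fibre_product ?G \<mu>) = {(g, h). g \<in> carrier ?G \<and> h \<in> carrier ?G \<and>
       exponents K h = ?M (exponents K g)}"
      using \<mu>_eq by (auto simp: fibre_product_def)
  qed
qed

section \<open>Paths, letters and lattice vectors\<close>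

text \<open>The unrestricted wreath product of \<open>Q\<close> with the translations. A pair
  \<open>(F, a)\<close> records, for every starting point \<open>z\<close>, the label
  \<open>F z\<close> collected along a path with displacement \<open>a\<close>; multiplication
  concatenates paths.\<close>

definition shift_wreath :: "('q, 'm) monoid_scheme \<Rightarrow> (('l::ab_group_add \<Rightarrow> 'q) \<times> 'l) monoid" where
  "shift_wreath Q = \<lparr>carrier = {(F, a). \<forall>z. F z \<in> carrier Q},
     mult = (\<lambda>(F, a) (F', b). (\<lambda>z. F z \<otimes>\<^bsub>Q\<^esub> F' (z + a), a + b)),
     one = (\<lambda>z. \<one>\<^bsub>Q\<^esub>, 0)\<rparr>"

lemma shift_wreath_simps [simp]:
  "(F, a) \<in> carrier (shift_wreath Q) \<longleftrightarrow> (\<forall>z. F z \<in> carrier Q)"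
  "(F, a) \<otimes>\<^bsub>shift_wreath Q\<^esub> (F', b) = (\<lambda>z. F z \<otimes>\<^bsub>Q\<^esub> F' (z + a), a + b)"
  "\<one>\<^bsub>shift_wreath Q\<^esub> = (\<lambda>z. \<one>\<^bsub>Q\<^esub>, 0)"
  by (simp_all add: shift_wreath_def)

lemma group_shift_wreath:
  assumes "group Q"
  shows "group (shift_wreath Q :: (('l::ab_group_add \<Rightarrow> 'q) \<times> 'l) monoid)"
proof (rule groupI)
  interpret group Q by fact
  let ?W = "shift_wreath Q :: (('l \<Rightarrow> 'q) \<times> 'l) monoid"
  show "x \<otimes>\<^bsub>?W\<^esub> y \<in> carrier ?W" if "x \<in> carrier ?W" "y \<in> carrier ?W" for x y
    using that by (cases x; cases y) simp
  show "\<one>\<^bsub>?W\<^esub> \<in> carrier ?W" by simp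
  show "x \<otimes>\<^bsub>?W\<^esub> y \<otimes>\<^bsub>?W\<^esub> z = x \<otimes>\<^bsub>?W\<^esub> (y \<otimes>\<^bsub>?W\<^esub> z)"
    if "x \<in> carrier ?W" "y \<in> carrier ?W" "z \<in> carrier ?W" for x y z
    using that by (cases x; cases y; cases z) (simp add: m_assoc add.assoc)
  show "\<one>\<^bsub>?W\<^esub> \<otimes>\<^bsub>?W\<^esub> x = x" if "x \<in> carrier ?W" for x
    using that by (cases x) simp
  show "\<exists>y\<in>carrier ?W. y \<otimes>\<^bsub>?W\<^esub> x = \<one>\<^bsub>?W\<^esub>" if "x \<in> carrier ?W" for x
  proof -
    obtain F a where x: "x = (F, a)" by (cases x)
    with that show ?thesis
      by (intro bexI[of _ "(\<lambda>z. inv\<^bsub>Q\<^esub> F (z - a), - a)"]) simp_all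
  qed
qed

text \<open>
  A letter consists of a factor of \<open>G \<times> G\<close>, a vertex and a sign. The first factor is mapped to
  the lattice by the matrix \<open>m\<close>, and the second one by \<open>-1\<close>.
\<close>

definition base_vec :: "'v set \<Rightarrow> ('v \<Rightarrow> 'v \<Rightarrow> int) \<Rightarrow> bool \<Rightarrow> 'v \<Rightarrow> 'v \<Rightarrow> int" where
  "base_vec V m s v = (\<lambda>u. if s then if u \<in> V then m u v else 0 else if u = v then -1 else 0)"

definition letter_vec :: "'v set \<Rightarrow> ('v \<Rightarrow> 'v \<Rightarrow> int) \<Rightarrow> bool \<times> 'v \<times> bool \<Rightarrow> 'v \<Rightarrow> int" where
  "letter_vec V m = (\<lambda>(s, v, b). if b then base_vec V m s v else - base_vec V m s v)"

text \<open>Since \<open>{v, v}\<close> is a simplex, \<open>v \<noteq> w\<close> has to be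
  demanded: a letter must not count as commuting with itself or its inverse, whose vectors coincide
  or cancel.\<close>

definition letter_com :: "'v set set \<Rightarrow> bool \<times> 'v \<times> bool \<Rightarrow> bool \<times> 'v \<times> bool \<Rightarrow> bool" where
  "letter_com K = (\<lambda>(s, v, b) (t, w, c). s \<noteq> t \<or> v \<noteq> w \<and> {v, w} \<in> K)"

abbreviation letters :: "'v set \<Rightarrow> (bool \<times> 'v \<times> bool) set" where
  "letters V \<equiv> UNIV \<times> V \<times> UNIV"

definition lattice_points :: "'v set \<Rightarrow> ('v \<Rightarrow> int) set" where
  "lattice_points V = {z. \<forall>v. v \<notin> V \<longrightarrow> z v = 0}"

definition dot :: "'v set \<Rightarrow> ('v \<Rightarrow> int) \<Rightarrow> ('v \<Rightarrow> int) \<Rightarrow> int" where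
  "dot V x y = (\<Sum>v\<in>V. x v * y v)"

lemma dot_add: "dot V (x + y) z = dot V x z + dot V y z" "dot V x (y + z) = dot V x y + dot V x z"
  and dot_neg: "dot V x (- y) = - dot V x y" "dot V (- x) y = - dot V x y"
  and dot_commute: "dot V x y = dot V y x" and dot_self_nonneg: "dot V x x \<ge> 0"
  by (simp_all add: dot_def algebra_simps sum.distrib sum_negf sum_nonneg)

lemma dot_base_vec:
  assumes "finite V" "v \<in> V"
  shows "dot V z (base_vec V m True v) = (\<Sum>u\<in>V. z u * m u v)" "dot V z (base_vec V m False v) = - z v"
proof -
  show "dot V z (base_vec V m True v) = (\<Sum>u\<in>V. z u * m u v)"
    unfolding dot_def by (intro sum.cong) (auto simp: base_vec_def)
  show "dot V z (base_vec V m False v) = - z v"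
    using assms by (simp add: dot_def base_vec_def if_distrib cong: if_cong)
qed

lemma lattice_points_add: "\<lbrakk>x \<in> lattice_points V; y \<in> lattice_points V\<rbrakk> \<Longrightarrow> x + y \<in> lattice_points V"
  by (simp add: lattice_points_def)

lemma letter_vec_lattice: "a \<in> letters V \<Longrightarrow> letter_vec V m a \<in> lattice_points V"
  by (auto simp: letter_vec_def lattice_points_def base_vec_def)

lemma finite_lattice_box:
  assumes "finite V"
  shows "finite {z \<in> lattice_points V. \<forall>v\<in>V. \<bar>z v\<bar> \<le> n}"
proof (rule finite_subset)
  show "{z \<in> lattice_points V. \<forall>v\<in>V. \<bar>z v\<bar> \<le> n} \<subseteq>
      {z. \<forall>v. (v \<in> V \<longrightarrow> z v \<in> {-n..n}) \<and> (v \<notin> V \<longrightarrow> z v = 0)}"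
    by (auto simp: lattice_points_def abs_le_iff)
  show "finite {z. \<forall>v. (v \<in> V \<longrightarrow> z v \<in> {-n..n}) \<and> (v \<notin> V \<longrightarrow> z v = 0)}"
    by (rule finite_set_of_finite_funs[OF assms]) simp
qed

lemma lattice_rank:
  assumes fin: "finite V"
  obtains rank :: "('v \<Rightarrow> int) \<Rightarrow> nat" where "inj_on rank (lattice_points V)"
    "\<forall>z\<in>lattice_points V. \<forall>z'\<in>lattice_points V. dot V z z < dot V z' z' \<longrightarrow> rank z < rank z'"
proof -
  have finq: "finite {z \<in> lattice_points V. nat (dot V z z) \<le> n}" for n
  proof (rule finite_subset[OF _ finite_lattice_box[OF fin, of "int n"]])
    show "{z \<in> lattice_points V. nat (dot V z z) \<le> n} \<subseteq> {z \<in> lattice_points V. \<forall>v\<in>V. \<bar>z v\<bar> \<le> int n}"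
    proof safe
      fix z v assume z: "nat (dot V z z) \<le> n" and v: "v \<in> V"
      have "z v * z v \<le> dot V z z" unfolding dot_def by (rule member_le_sum) (use fin v in auto)
      moreover have "\<bar>z v\<bar> \<le> z v * z v"
      proof (cases "z v = 0")
        case False
        then have "1 \<le> \<bar>z v\<bar>" by linarith
        from mult_left_mono[OF this, of "\<bar>z v\<bar>"] show ?thesis by simp
      qed simp
      ultimately show "\<bar>z v\<bar> \<le> int n" using z by linarith
    qed
  qed
  obtain rank :: "('v \<Rightarrow> int) \<Rightarrow> nat" where r: "inj_on rank (lattice_points V)"
    "\<And>z z'. \<lbrakk>z \<in> lattice_points V; z' \<in> lattice_points V; nat (dot V z z) < nat (dot V z' z')\<rbrakk> \<Longrightarrow> rank z < rank z'"
    using rank_refining[where q = "\<lambda>z. nat (dot V z z)", OF finq] by blast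
  have "rank z < rank z'"
    if "z \<in> lattice_points V" "z' \<in> lattice_points V" "dot V z z < dot V z' z'" for z z'
    using r(2)[OF that(1,2)] that(3) dot_self_nonneg[of V z] by (simp add: nat_less_eq_zless)
  with r(1) show ?thesis by (intro that) blast+
qed

section \<open>Strong letters far from the origin\<close>

lemma connected_imp_good_point:
  assumes K: "simplicial_complex K" and V: "V = vertices K" and fin: "finite V"
    and conn: "\<And>Z. \<lbrakk>Z \<subseteq> V; 2 * card Z < card V\<rbrakk> \<Longrightarrow> complex_connected (remove_vertices K Z)"
    and C: "C > 0" "\<And>x :: 'v \<Rightarrow> real. card {v \<in> V. C * \<bar>x v\<bar> < (\<Sum>u\<in>V. \<bar>x u\<bar>)} +
      card {w \<in> V. C * \<bar>\<Sum>u\<in>V. x u * of_int (m u w)\<bar> < (\<Sum>u\<in>V. \<bar>x u\<bar>)} < card V"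
    and rank: "\<And>z z'. \<lbrakk>z \<in> lattice_points V; z' \<in> lattice_points V; dot V z z < dot V z' z'\<rbrakk>
      \<Longrightarrow> rank z < rank z'"
  obtains k0 :: nat where "\<forall>z\<in>lattice_points V. rank z \<ge> k0 \<longrightarrow>
    good_point rank (letters V) (letter_vec V m) (letter_com K) fst z"
proof -
  let ?Y = "letters V" and ?vec = "letter_vec V m" and ?L = "lattice_points V" and ?base = "base_vec V m"
  let ?W = "{0} \<union> ?vec ` ?Y \<union> {?vec a + ?vec b | a b. a \<in> ?Y \<and> b \<in> ?Y}"
  have finY: "finite ?Y" using fin by simp
  have "finite {?vec a + ?vec b | a b. a \<in> ?Y \<and> b \<in> ?Y}"
    by (rule finite_image_set2) (use finY in simp_all)
  then have finW: "finite ?W" by (intro finite_UnI finite_imageI finY) simp_all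
  have WL: "w \<in> ?L" if "w \<in> ?W" for w
    using that letter_vec_lattice lattice_points_add by (auto simp: lattice_points_def letter_vec_def base_vec_def)
  \<comment> \<open>After a detour \<open>w\<close>, a letter \<open>s\<close> changes the squared
    norm by twice its pairing with \<open>z\<close> plus this term, which does not depend on
    \<open>z\<close> and is at most \<open>B\<close>.\<close>
  define f where "f = (\<lambda>(w, s). 2 * dot V w (?vec s) + dot V (?vec s) (?vec s))"
  define B where "B = Max (insert 0 (f ` (?W \<times> ?Y)))"
  have finf: "finite (insert 0 (f ` (?W \<times> ?Y)))" using finW finY by blast
  have B0: "B \<ge> 0" unfolding B_def using finf by (intro Max_ge) auto
  have B: "2 * dot V w (?vec s) + dot V (?vec s) (?vec s) \<le> B" if "w \<in> ?W" "s \<in> ?Y" for w s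
  proof -
    have "f (w, s) \<in> insert 0 (f ` (?W \<times> ?Y))" using that by blast
    then have "f (w, s) \<le> B" unfolding B_def using finf by (intro Max_ge) auto
    then show ?thesis by (simp add: f_def)
  qed
  define T where "T z = (\<Sum>v\<in>V. \<bar>z v\<bar>)" for z :: "'v \<Rightarrow> int"
  \<comment> \<open>The points too close to the origin for \<open>B\<close> to be outweighed;
    \<open>k0\<close> lies above their ranks.\<close>
  have "finite {z \<in> ?L. 2 * real_of_int (T z) \<le> C * B}"
  proof (rule finite_subset[OF _ finite_lattice_box[OF fin, of "\<lceil>C * B\<rceil>"]])
    show "{z \<in> ?L. 2 * real_of_int (T z) \<le> C * B} \<subseteq> {z \<in> ?L. \<forall>v\<in>V. \<bar>z v\<bar> \<le> \<lceil>C * B\<rceil>}"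
    proof safe
      fix z v assume z: "2 * real_of_int (T z) \<le> C * B" and v: "v \<in> V"
      have "\<bar>z v\<bar> \<le> T z" unfolding T_def by (rule member_le_sum) (use fin v in auto)
      moreover have "real_of_int (T z) \<le> C * B" using z \<open>\<bar>z v\<bar> \<le> T z\<close> by linarith
      ultimately show "\<bar>z v\<bar> \<le> \<lceil>C * B\<rceil>" by linarith
    qed
  qed
  then have "finite (rank ` {z \<in> ?L. 2 * real_of_int (T z) \<le> C * B})" by blast
  then obtain k0 where k0: "\<forall>n\<in>rank ` {z \<in> ?L. 2 * real_of_int (T z) \<le> C * B}. n < k0"
    unfolding finite_nat_set_iff_bounded by blast
  show ?thesis
  proof (rule that[of k0], intro ballI impI)
    fix z assume z: "z \<in> ?L" "rank z \<ge> k0"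
    have big: "2 * real_of_int (T z) > C * B"
    proof (rule ccontr)
      assume "\<not> 2 * real_of_int (T z) > C * B"
      then have "rank z < k0" using k0 z(1) by auto
      with z(2) show False by simp
    qed
    \<comment> \<open>Indices whose pairing with \<open>z\<close> is small relative to the sum norm:
      by \<open>C\<close>, fewer than \<open>card V\<close> on both sides together.\<close>
    define weak where "weak s = {v \<in> V. C * \<bar>real_of_int (dot V z (?base s v))\<bar> < T z}" for s
    have "card (weak False) + card (weak True) < card V"
    proof -
      have "real_of_int (T z) = (\<Sum>u\<in>V. \<bar>real_of_int (z u)\<bar>)" by (simp add: T_def)
      then have "weak False = {v \<in> V. C * \<bar>real_of_int (z v)\<bar> < (\<Sum>u\<in>V. \<bar>real_of_int (z u)\<bar>)}"
          "weak True = {w \<in> V. C * \<bar>\<Sum>u\<in>V. real_of_int (z u) * of_int (m u w)\<bar> < (\<Sum>u\<in>V. \<bar>real_of_int (z u)\<bar>)}"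
        using dot_base_vec[OF fin] by (auto simp: weak_def)
      then show ?thesis using C(2)[of "\<lambda>u. real_of_int (z u)"] by simp
    qed
    then have card_lt: "card (weak s) < card V" for s by (cases s) auto
    obtain i where i: "2 * card (weak i) < card V"
    proof (cases "2 * card (weak True) < card V")
      case False
      then show ?thesis
        using that[of False] \<open>card (weak False) + card (weak True) < card V\<close> by linarith
    qed (use that in blast)
    have weakV: "weak s \<subseteq> V" for s by (auto simp: weak_def)
    \<comment> \<open>The sign makes the letter point towards the origin.\<close>
    define sl where "sl s v = (s, v, dot V z (?base s v) < 0)" for s v
    have strong: "strong_letter rank ?Y ?vec z (sl s v)" if v: "v \<in> V - weak s" for s v
    proof -
      have Y: "sl s v \<in> ?Y" using v by (simp add: sl_def)
      have d: "dot V z (?vec (sl s v)) = - \<bar>dot V z (?base s v)\<bar>"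
        by (simp add: letter_vec_def sl_def dot_neg)
      have "C * \<bar>real_of_int (dot V z (?base s v))\<bar> \<ge> T z" using v by (auto simp: weak_def)
      then have "C * (2 * \<bar>real_of_int (dot V z (?base s v))\<bar>) > C * B" using big by linarith
      then have "2 * \<bar>real_of_int (dot V z (?base s v))\<bar> > B" using C(1) by simp
      then have dB: "2 * dot V z (?vec (sl s v)) < - B" unfolding d by linarith
      show ?thesis
        unfolding strong_letter_def
      proof (intro conjI Y ballI impI)
        fix w assume w: "w \<in> ?W" "rank (z + w) \<le> rank z"
        have L: "z + w \<in> ?L" "z + w + ?vec (sl s v) \<in> ?L"
          using lattice_points_add z(1) WL[OF w(1)] letter_vec_lattice[OF Y] by blast+
        have "dot V (z + w) (z + w) \<le> dot V z z"
          using rank[OF z(1) L(1)] w(2) by linarith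
        moreover have "dot V (z + w + ?vec (sl s v)) (z + w + ?vec (sl s v)) =
            dot V (z + w) (z + w) + 2 * dot V z (?vec (sl s v)) +
            (2 * dot V w (?vec (sl s v)) + dot V (?vec (sl s v)) (?vec (sl s v)))"
          by (simp add: dot_add dot_commute[of V "?vec (sl s v)" w] dot_commute[of V "?vec (sl s v)" z] dot_commute[of V w z])
        ultimately have "dot V (z + w + ?vec (sl s v)) (z + w + ?vec (sl s v)) < dot V z z"
          using B[OF w(1) Y] dB by linarith
        then show "rank (z + w + ?vec (sl s v)) < rank z" by (rule rank[OF L(2) z(1)])
      qed
    qed
    have ex: "\<exists>v. v \<in> V - weak s" for s
    proof (rule ccontr)
      assume "\<nexists>v. v \<in> V - weak s"
      then have "V \<subseteq> weak s" by blast
      then have "card V \<le> card (weak s)" using fin weakV by (metis card_mono finite_subset)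
      then show False using card_lt[of s] by simp
    qed
    obtain w where w: "w \<in> V - weak (\<not> i)" using ex by blast
    define D where "D = sl i ` (V - weak i)"
    have vert: "vertices (remove_vertices K Z) = V - Z" for Z
      by (auto simp: vertices_def remove_vertices_def V)
    have path: "(d, d') \<in> {(x, y). x \<in> D \<and> y \<in> D \<and> letter_com K x y}\<^sup>*" if dd: "d \<in> D" "d' \<in> D" for d d'
    proof -
      obtain v v' where v: "v \<in> V - weak i" "v' \<in> V - weak i" "d = sl i v" "d' = sl i v'"
        using dd by (auto simp: D_def)
      have "(v, v') \<in> {(x, y). {x, y} \<in> remove_vertices K (weak i)}\<^sup>*"
        using conn[OF weakV i] v unfolding complex_connected_def vert by blast
      then have "(sl i v, sl i v') \<in> {(x, y). x \<in> D \<and> y \<in> D \<and> letter_com K x y}\<^sup>*"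
      proof (induction rule: rtrancl_induct)
        case (step x y)
        then have xy: "{x, y} \<in> K" "{x, y} \<inter> weak i = {}" by (auto simp: remove_vertices_def)
        show ?case
        proof (cases "x = y")
          case False
          have "x \<in> V - weak i" "y \<in> V - weak i" using xy edge_vertices[OF K xy(1)] V by auto
          then have "(sl i x, sl i y) \<in> {(x, y). x \<in> D \<and> y \<in> D \<and> letter_com K x y}"
            using False xy(1) by (auto simp: D_def letter_com_def sl_def)
          with step.IH show ?thesis by (rule rtrancl_into_rtrancl)
        qed (use step.IH in simp)
      qed simp
      then show ?thesis by (simp add: v)
    qed
    \<comment> \<open>A descending letter whose index is outside \<open>weak i\<close> must have the
      sign used in \<open>D\<close>. For a weak index \<open>v\<close>, deleting the other weak
      indices leaves a connected complex, in which \<open>v\<close> has a neighbour that is not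
      weak.\<close>
    have dom: "u \<in> D \<or> (\<exists>d\<in>D. letter_com K u d)"
      if u: "u \<in> ?Y" "fst u = i" "rank (z + ?vec u) < rank z" for u
    proof -
      obtain v b where ub: "u = (i, v, b)" "v \<in> V" using u by (cases u) auto
      show ?thesis
      proof (cases "v \<in> weak i")
        case False
        then have v: "v \<in> V - weak i" using ub by blast
        have "b = (dot V z (?base i v) < 0)"
        proof (rule ccontr)
          assume b: "b \<noteq> (dot V z (?base i v) < 0)"
          then have "dot V z (?vec u) = \<bar>dot V z (?base i v)\<bar>"
            by (auto simp: letter_vec_def ub dot_neg)
          \<comment> \<open>The second alternative is impossible: outside \<open>weak i\<close> the
            pairing is at least \<open>T z / C\<close> in absolute value, and \<open>T z\<close> is
            positive.\<close>
          then have "dot V z z < dot V (z + ?vec u) (z + ?vec u) \<or> dot V z (?base i v) = 0"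
            using dot_self_nonneg[of V "?vec u"]
            by (auto simp: dot_add dot_commute[of V "?vec u" z])
          moreover have "C * \<bar>real_of_int (dot V z (?base i v))\<bar> \<ge> T z" using v by (auto simp: weak_def)
          moreover have "real_of_int (T z) > 0"
            using big B0 C(1) mult_nonneg_nonneg[of C "real_of_int B"] by linarith
          ultimately have "dot V z z < dot V (z + ?vec u) (z + ?vec u)" by auto
          then have "rank z < rank (z + ?vec u)"
            using rank[OF z(1)] lattice_points_add[OF z(1) letter_vec_lattice[OF u(1)]] by blast
          with u(3) show False by simp
        qed
        then have "u = sl i v" by (simp add: sl_def ub)
        then show ?thesis using v by (simp add: D_def)
      next
        case True
        define Z where "Z = weak i - {v}"
        have "card Z \<le> card (weak i)" unfolding Z_def using fin weakV by (meson card_Diff1_le)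
        then have "complex_connected (remove_vertices K Z)"
          using i weakV[of i] by (intro conn) (auto simp: Z_def)
        moreover obtain x where x: "x \<in> V - weak i" using ex by blast
        ultimately have reach: "(v, x) \<in> {(x, y). {x, y} \<in> remove_vertices K Z}\<^sup>*"
          unfolding complex_connected_def vert using ub True by (auto simp: Z_def)
        have "\<exists>d\<in>D. letter_com K u d"
        proof (rule ccontr)
          assume none: "\<not> (\<exists>d\<in>D. letter_com K u d)"
          have "y = v" if "(v, y) \<in> {(x, y). {x, y} \<in> remove_vertices K Z}\<^sup>*" for y
            using that
          proof (induction rule: rtrancl_induct)
            case (step y y')
            then have e: "{v, y'} \<in> K" "{v, y'} \<inter> Z = {}" by (auto simp: remove_vertices_def)
            show ?case
            proof (rule ccontr)
              assume ne: "y' \<noteq> v"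
              then have "y' \<in> V - weak i" using e edge_vertices[OF K e(1)] V by (auto simp: Z_def)
              then have "sl i y' \<in> D" by (simp add: D_def)
              moreover have "letter_com K u (sl i y')" using ne e by (auto simp: letter_com_def ub sl_def)
              ultimately show False using none by blast
            qed
          qed simp
          from this[OF reach] show False using x True by blast
        qed
        then show ?thesis by blast
      qed
    qed
    show "good_point rank ?Y ?vec (letter_com K) fst z"
      unfolding good_point_def
    proof (rule exI[of _ i], rule exI[of _ D], rule exI[of _ "sl (\<not> i) w"], intro conjI ballI impI)
      show "strong_letter rank ?Y ?vec z (sl (\<not> i) w)" by (rule strong[OF w])
      show "fst (sl (\<not> i) w) \<noteq> i" by (simp add: sl_def)
      show "D \<noteq> {}" using ex[of i] by (auto simp: D_def)
      show "strong_letter rank ?Y ?vec z d" "fst d = i" if "d \<in> D" for d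
        using that strong by (auto simp: D_def sl_def)
    qed (use path dom in blast)+
  qed
qed

section \<open>Letters as elements of the product\<close>

definition letter_bar :: "bool \<times> 'v \<times> bool \<Rightarrow> bool \<times> 'v \<times> bool" where
  "letter_bar = (\<lambda>(s, v, b). (s, v, \<not> b))"

definition factor_embed :: "'v set set \<Rightarrow> bool \<Rightarrow> 'v word set \<Rightarrow> 'v word set \<times> 'v word set" where
  "factor_embed K s g = (if s then (g, \<one>\<^bsub>raag K\<^esub>) else (\<one>\<^bsub>raag K\<^esub>, g))"

definition letter_elem :: "'v set set \<Rightarrow> bool \<times> 'v \<times> bool \<Rightarrow> 'v word set \<times> 'v word set" where
  "letter_elem K = (\<lambda>(s, v, b). factor_embed K s (if b then raag_gen K v else inv\<^bsub>raag K\<^esub> raag_gen K v))"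

text \<open>The homomorphism to the lattice; its kernel is the fibre product of the automorphism
  with matrix \<open>m\<close>.\<close>

definition position :: "'v set set \<Rightarrow> ('v \<Rightarrow> 'v \<Rightarrow> int) \<Rightarrow> 'v word set \<times> 'v word set \<Rightarrow> 'v \<Rightarrow> int" where
  "position K m = (\<lambda>(g, h). matrix_map (vertices K) m (exponents K g) - exponents K h)"

lemma letter_bar:
  "a \<in> letters V \<Longrightarrow> letter_bar a \<in> letters V" "letter_bar (letter_bar a) = a"
  "letter_vec V m (letter_bar a) = - letter_vec V m a"
  "letter_com K (letter_bar a) b = letter_com K a b"
  by (cases a; auto simp: letter_bar_def letter_vec_def letter_com_def)+

lemma letter_com_sym: "letter_com K a b \<Longrightarrow> letter_com K b a"
  by (auto simp: letter_com_def insert_commute)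

lemma letter_vec_nz:
  assumes "a \<in> letters V" and m: "\<And>v w. \<lbrakk>v \<in> V; w \<in> V\<rbrakk> \<Longrightarrow> m v w > 0"
  shows "letter_vec V m a \<noteq> 0"
proof -
  obtain s v b where a: "a = (s, v, b)" "v \<in> V" using assms by (cases a) auto
  have "letter_vec V m a v \<noteq> 0"
    using a m[OF a(2) a(2)] by (auto simp: letter_vec_def base_vec_def)
  then show ?thesis by (metis zero_fun_apply)
qed

text \<open>A positive column has no zero entry, unlike a unit vector once \<open>V\<close> has two
  elements; positivity also tells a column from the negative of another.\<close>

lemma letter_com_vec:
  assumes ab: "a \<in> letters V" "b \<in> letters V" and com: "letter_com K a b"
    and card: "card V \<ge> 2" and m: "\<And>v w. \<lbrakk>v \<in> V; w \<in> V\<rbrakk> \<Longrightarrow> m v w > 0"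
      "\<And>v w. \<lbrakk>v \<in> V; w \<in> V; v \<noteq> w\<rbrakk> \<Longrightarrow> \<exists>u\<in>V. m u v \<noteq> m u w"
  shows "letter_vec V m a \<noteq> letter_vec V m b"
proof
  assume eq: "letter_vec V m a = letter_vec V m b"
  obtain s v c where a: "a = (s, v, c)" "v \<in> V" using ab by (cases a) auto
  obtain t w d where b: "b = (t, w, d)" "w \<in> V" using ab by (cases b) auto
  have pt: "letter_vec V m a u = letter_vec V m b u" for u using eq by simp
  have other: "\<exists>u\<in>V. u \<noteq> x" for x
  proof (rule ccontr)
    assume "\<not> (\<exists>u\<in>V. u \<noteq> x)"
    then have "V \<subseteq> {x}" by blast
    then have "card V \<le> 1" using card_mono[of "{x}" V] by simp
    with card show False by simp
  qed
  have mixed: "letter_vec V m (True, x, p) \<noteq> letter_vec V m (False, y, q)" if "x \<in> V" for x y p q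
  proof
    assume e: "letter_vec V m (True, x, p) = letter_vec V m (False, y, q)"
    obtain u where u: "u \<in> V" "u \<noteq> y" using other by blast
    have "letter_vec V m (True, x, p) u = letter_vec V m (False, y, q) u" using e by simp
    then show False using u m(1)[OF u(1) that] by (simp add: letter_vec_def base_vec_def split: if_splits)
  qed
  show False
  proof (cases "s = t")
    case False
    then show False using mixed[of v c w d] mixed[of w d v c] eq a b by (cases s; cases t) auto
  next
    case True
    then have vw: "v \<noteq> w" using com by (simp add: a b letter_com_def)
    show False
    proof (cases s)
      case s: True
      obtain u where u: "u \<in> V" "m u v \<noteq> m u w" using m(2)[OF a(2) b(2) vw] by blast
      have "m u v > 0" "m u w > 0" using m(1) u a b by blast+
      then show False using pt[of u] u True s by (auto simp: a b letter_vec_def base_vec_def split: if_splits)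
    next
      case False
      then show False using pt[of v] vw True by (auto simp: a b letter_vec_def base_vec_def split: if_splits)
    qed
  qed
qed

context
  fixes K :: "'v set set"
begin

interpretation G: group "raag K" by (rule group_raag)
interpretation A: group "raag K \<times>\<times> raag K" by (rule DirProd_group[OF G.is_group G.is_group])

lemma factor_embed_closed: "g \<in> carrier (raag K) \<Longrightarrow> factor_embed K s g \<in> carrier (raag K \<times>\<times> raag K)"
  by (simp add: factor_embed_def)

lemma factor_embed_mult: "\<lbrakk>g \<in> carrier (raag K); h \<in> carrier (raag K)\<rbrakk> \<Longrightarrow>
    factor_embed K s (g \<otimes>\<^bsub>raag K\<^esub> h) = factor_embed K s g \<otimes>\<^bsub>raag K \<times>\<times> raag K\<^esub> factor_embed K s h"
  by (simp add: factor_embed_def)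

lemma factor_embed_inv: "g \<in> carrier (raag K) \<Longrightarrow>
    factor_embed K s (inv\<^bsub>raag K\<^esub> g) = inv\<^bsub>raag K \<times>\<times> raag K\<^esub> factor_embed K s g"
  by (simp add: factor_embed_def inv_DirProd[OF G.is_group G.is_group])

lemma letter_elem_closed: "a \<in> letters (vertices K) \<Longrightarrow> letter_elem K a \<in> carrier (raag K \<times>\<times> raag K)"
  by (auto simp: letter_elem_def factor_embed_def)

lemma letter_elem_bar: "a \<in> letters (vertices K) \<Longrightarrow>
    letter_elem K (letter_bar a) = inv\<^bsub>raag K \<times>\<times> raag K\<^esub> letter_elem K a"
  by (auto simp: letter_elem_def letter_bar_def factor_embed_def inv_DirProd[OF G.is_group G.is_group])

context
  fixes m :: "'v \<Rightarrow> 'v \<Rightarrow> int"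
  assumes K: "simplicial_complex K"
begin

lemma letter_elem_commute:
  assumes "a \<in> letters (vertices K)" "b \<in> letters (vertices K)" "letter_com K a b"
  shows "letter_elem K a \<otimes>\<^bsub>raag K \<times>\<times> raag K\<^esub> letter_elem K b =
    letter_elem K b \<otimes>\<^bsub>raag K \<times>\<times> raag K\<^esub> letter_elem K a"
proof -
  obtain s v c where a: "a = (s, v, c)" "v \<in> vertices K" using assms by (cases a) auto
  obtain t w d where b: "b = (t, w, d)" "w \<in> vertices K" using assms by (cases b) auto
  define x where "x = (if c then raag_gen K v else inv\<^bsub>raag K\<^esub> raag_gen K v)"
  define y where "y = (if d then raag_gen K w else inv\<^bsub>raag K\<^esub> raag_gen K w)"
  have xy: "x \<in> carrier (raag K)" "y \<in> carrier (raag K)" using a b by (simp_all add: x_def y_def)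
  have e: "letter_elem K a = factor_embed K s x" "letter_elem K b = factor_embed K t y"
    by (simp_all add: letter_elem_def a b x_def y_def)
  show ?thesis
  proof (cases "s = t")
    case True
    then have "{v, w} \<in> K" using assms(3) by (simp add: a b letter_com_def)
    then have vw: "raag_gen K v \<otimes>\<^bsub>raag K\<^esub> raag_gen K w = raag_gen K w \<otimes>\<^bsub>raag K\<^esub> raag_gen K v"
      by (rule raag_gen_commute[OF K])
    have vy: "raag_gen K v \<otimes>\<^bsub>raag K\<^esub> y = y \<otimes>\<^bsub>raag K\<^esub> raag_gen K v"
      using vw G.commutes_inv[OF _ _ vw] a b by (simp add: y_def)
    have "y \<otimes>\<^bsub>raag K\<^esub> x = x \<otimes>\<^bsub>raag K\<^esub> y"
      using vy G.commutes_inv[OF xy(2) _ vy[symmetric]] a by (simp add: x_def)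
    then show ?thesis using xy by (simp add: e True flip: factor_embed_mult)
  next
    case False
    then show ?thesis using xy by (auto simp: e factor_embed_def)
  qed
qed

lemma position_mult:
  assumes "x \<in> carrier (raag K \<times>\<times> raag K)" "y \<in> carrier (raag K \<times>\<times> raag K)"
  shows "position K m (x \<otimes>\<^bsub>raag K \<times>\<times> raag K\<^esub> y) = position K m x + position K m y"
  using assms by (cases x; cases y) (simp add: position_def exponents_mult[OF K] matrix_map_add)

lemma position_one: "position K m \<one>\<^bsub>raag K \<times>\<times> raag K\<^esub> = 0"
proof -
  have "position K m \<one>\<^bsub>raag K \<times>\<times> raag K\<^esub> + position K m \<one>\<^bsub>raag K \<times>\<times> raag K\<^esub> = position K m \<one>\<^bsub>raag K \<times>\<times> raag K\<^esub>"
    using position_mult[OF A.one_closed A.one_closed] by simp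
  then show ?thesis by (metis add_cancel_right_right)
qed

lemma position_inv:
  assumes "x \<in> carrier (raag K \<times>\<times> raag K)"
  shows "position K m (inv\<^bsub>raag K \<times>\<times> raag K\<^esub> x) = - position K m x"
proof -
  have "position K m (inv\<^bsub>raag K \<times>\<times> raag K\<^esub> x) + position K m x = 0"
    using position_mult[OF A.inv_closed[OF assms] assms] A.l_inv[OF assms] position_one by simp
  then show ?thesis by (simp only: eq_neg_iff_add_eq_0)
qed

lemma position_letter:
  assumes fin: "finite (vertices K)" and a: "a \<in> letters (vertices K)"
  shows "position K m (letter_elem K a) = letter_vec (vertices K) m a"
proof -
  obtain s v b where a: "a = (s, v, b)" "v \<in> vertices K" using a by (cases a) auto
  have base: "position K m (factor_embed K s (raag_gen K v)) = base_vec (vertices K) m s v"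
    using a(2) fin by (auto simp: position_def factor_embed_def base_vec_def exponents_gen[OF K] exponents_one[OF K]
        matrix_map_def if_distrib cong: if_cong)
  show ?thesis
  proof (cases b)
    case True
    then show ?thesis by (simp add: a letter_elem_def letter_vec_def base)
  next
    case False
    then show ?thesis
      using position_inv[OF factor_embed_closed[OF raag_gen_closed[OF a(2)], of s]] a(2)
      by (simp add: a(1) letter_elem_def letter_vec_def factor_embed_inv base)
  qed
qed

lemma position_lattice:
  assumes "x \<in> carrier (raag K \<times>\<times> raag K)"
  shows "position K m x \<in> lattice_points (vertices K)"
  using assms by (cases x) (auto simp: position_def lattice_points_def matrix_map_def exponents_outside[OF K])

text \<open>The last clause makes the frame at the origin trivial, so that labels read along loops
  at the origin give back the element itself.\<close>

lemma position_surjective: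
  assumes fin: "finite (vertices K)" and z: "z \<in> lattice_points (vertices K)"
  shows "\<exists>x. x \<in> carrier (raag K \<times>\<times> raag K) \<and> position K m x = z \<and>
    (z = 0 \<longrightarrow> x = \<one>\<^bsub>raag K \<times>\<times> raag K\<^esub>)"
proof (cases "z = 0")
  case True
  then show ?thesis using position_one by (intro exI[of _ "\<one>\<^bsub>raag K \<times>\<times> raag K\<^esub>"]) simp
next
  case False
  have "(- z) v = 0" if "v \<notin> vertices K" for v using z that by (simp add: lattice_points_def)
  from exponents_surjective[where x = "- z", OF K fin this]
  obtain g where g: "g \<in> carrier (raag K)" "exponents K g = - z" by blast
  have "matrix_map (vertices K) m 0 = 0" by (auto simp: matrix_map_def)
  then show ?thesis
    using g False by (intro exI[of _ "(\<one>\<^bsub>raag K\<^esub>, g)"]) (simp add: position_def exponents_one[OF K])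
qed

end

end

lemma group_hom_commuting_product:
  assumes H: "group H" and G: "group G" and \<phi>: "\<phi> \<in> hom G H" and \<psi>: "\<psi> \<in> hom G H"
    and comm: "\<And>g h. \<lbrakk>g \<in> carrier G; h \<in> carrier G\<rbrakk> \<Longrightarrow> \<phi> g \<otimes>\<^bsub>H\<^esub> \<psi> h = \<psi> h \<otimes>\<^bsub>H\<^esub> \<phi> g"
  shows "(\<lambda>(g, h). \<phi> g \<otimes>\<^bsub>H\<^esub> \<psi> h) \<in> hom (G \<times>\<times> G) H"
proof (rule homI)
  interpret H: group H by fact
  have cl: "\<phi> g \<in> carrier H" "\<psi> g \<in> carrier H" if "g \<in> carrier G" for g
    using that \<phi> \<psi> by (auto simp: hom_def)
  show "(case x of (g, h) \<Rightarrow> \<phi> g \<otimes>\<^bsub>H\<^esub> \<psi> h) \<in> carrier H" if "x \<in> carrier (G \<times>\<times> G)" for x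
    using that cl by (cases x) simp
  fix x y assume "x \<in> carrier (G \<times>\<times> G)" "y \<in> carrier (G \<times>\<times> G)"
  then obtain g h g' h' where x: "x = (g, h)" "g \<in> carrier G" "h \<in> carrier G"
    and y: "y = (g', h')" "g' \<in> carrier G" "h' \<in> carrier G" by (cases x; cases y) auto
  have "\<phi> (g \<otimes>\<^bsub>G\<^esub> g') \<otimes>\<^bsub>H\<^esub> \<psi> (h \<otimes>\<^bsub>G\<^esub> h') = \<phi> g \<otimes>\<^bsub>H\<^esub> (\<phi> g' \<otimes>\<^bsub>H\<^esub> \<psi> h) \<otimes>\<^bsub>H\<^esub> \<psi> h'"
    using x y cl by (simp add: hom_mult[OF \<phi>] hom_mult[OF \<psi>] H.m_assoc)
  also have "\<dots> = \<phi> g \<otimes>\<^bsub>H\<^esub> \<psi> h \<otimes>\<^bsub>H\<^esub> (\<phi> g' \<otimes>\<^bsub>H\<^esub> \<psi> h')"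
    unfolding comm[OF y(2) x(3)] using x y cl by (simp add: H.m_assoc)
  finally show "(case x \<otimes>\<^bsub>G \<times>\<times> G\<^esub> y of (g, h) \<Rightarrow> \<phi> g \<otimes>\<^bsub>H\<^esub> \<psi> h) =
      (case x of (g, h) \<Rightarrow> \<phi> g \<otimes>\<^bsub>H\<^esub> \<psi> h) \<otimes>\<^bsub>H\<^esub> (case y of (g, h) \<Rightarrow> \<phi> g \<otimes>\<^bsub>H\<^esub> \<psi> h)"
    by (simp add: x y)
qed

section \<open>The retraction onto the kernel\<close>

text \<open>The presented group maps to the kernel by sending an edge to the loop closed up with the
  frames \<open>p0\<close>. The section reads the labels of the extended labelling from the origin.
  Reading is multiplicative in general only for all starting points at once, hence the passage
  through \<open>shift_wreath\<close>.\<close>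

lemma position_kernel_finitely_presented:
  assumes K: "simplicial_complex K" and fin: "finite (vertices K)" and card: "card (vertices K) \<ge> 2"
    and m: "\<And>v w. \<lbrakk>v \<in> vertices K; w \<in> vertices K\<rbrakk> \<Longrightarrow> m v w > 0"
      "\<And>v w. \<lbrakk>v \<in> vertices K; w \<in> vertices K; v \<noteq> w\<rbrakk> \<Longrightarrow> \<exists>u\<in>vertices K. m u v \<noteq> m u w"
    and rank: "inj_on rank (lattice_points (vertices K))"
    and good: "\<And>z. \<lbrakk>z \<in> lattice_points (vertices K); rank z \<ge> N\<rbrakk> \<Longrightarrow>
      good_point rank (letters (vertices K)) (letter_vec (vertices K) m) (letter_com K) fst z"
    and N: "rank 0 < N"
    and P: "subgroup H (raag K \<times>\<times> raag K)"
      "H = {x \<in> carrier (raag K \<times>\<times> raag K). position K m x = 0}"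
  shows "finitely_presented ((raag K \<times>\<times> raag K)\<lparr>carrier := H\<rparr>)"
proof -
  let ?V = "vertices K" and ?G = "raag K"
  define A where "A = raag K \<times>\<times> raag K"
  define P' where "P' = A\<lparr>carrier := H\<rparr>"
  let ?Y = "letters ?V" and ?vec = "letter_vec ?V m" and ?L = "lattice_points ?V"
    and ?com = "letter_com K" and ?el = "letter_elem K" and ?f = "position K m"
  interpret G: group ?G by (rule group_raag)
  interpret A: group A unfolding A_def by (rule DirProd_group[OF G.is_group G.is_group])
  note pos_mult = position_mult[where K = K and m = m, OF K, folded A_def]
  note pos_inv = position_inv[where K = K and m = m, OF K, folded A_def]
  note pos_letter = position_letter[where K = K and m = m, OF K fin]
  note el_closed = letter_elem_closed[where K = K, folded A_def]
  note el_bar = letter_elem_bar[where K = K, folded A_def]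
  note el_comm = letter_elem_commute[where K = K, OF K, folded A_def]
  have H: "H = {x \<in> carrier A. ?f x = 0}" using P(2) by (simp add: A_def)
  have subH: "subgroup H A" using P(1) by (simp add: A_def)
  interpret P: group P' unfolding P'_def by (rule subgroup.subgroup_is_group[OF subH A.is_group])
  have L_add: "z + ?vec a \<in> ?L" if "z \<in> ?L" "a \<in> ?Y" for z a
    using that by (intro lattice_points_add letter_vec_lattice)
  have vec_bar: "z + ?vec a + ?vec (letter_bar a) = z" for z a by (simp add: letter_bar(3))
  have bar_Y: "letter_bar a \<in> ?Y" if "a \<in> ?Y" for a using that by (rule letter_bar(1))
  have finY: "finite ?Y" using fin by simp
  have "\<forall>z\<in>?L. \<exists>x. x \<in> carrier A \<and> ?f x = z \<and> (z = 0 \<longrightarrow> x = \<one>\<^bsub>A\<^esub>)"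
    using position_surjective[where m = m, OF K fin] by (simp add: A_def)
  from bchoice[OF this] obtain p0 where p0: "\<forall>z\<in>?L. p0 z \<in> carrier A \<and> ?f (p0 z) = z \<and> (z = 0 \<longrightarrow> p0 z = \<one>\<^bsub>A\<^esub>)"
    by blast
  define I where "I = {z \<in> ?L. rank z < N}"
  have finI: "finite I"
  proof (rule finite_imageD)
    show "finite (rank ` I)" by (rule finite_subset[of _ "{..<N}"]) (auto simp: I_def)
    show "inj_on rank I" using rank by (rule inj_on_subset) (auto simp: I_def)
  qed
  have IL: "z \<in> ?L" if "z \<in> I" for z using that by (simp add: I_def)
  define X where "X = {(z, a). z \<in> I \<and> a \<in> ?Y \<and> z + ?vec a \<in> I}"
  have finX: "finite X"
    by (rule finite_subset[of _ "I \<times> ?Y"]) (use finI finY in \<open>auto simp: X_def\<close>)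
  define edge_word where "edge_word = (\<lambda>(z, a). [((z, a), True), ((z + ?vec a, letter_bar a), True)])"
  define square_word where "square_word = (\<lambda>(z, a, b).
    [((z, a), True), ((z + ?vec a, b), True), ((z + ?vec b, a), False), ((z, b), False)])"
  define S where "S = {(z, a, b). z \<in> I \<and> a \<in> ?Y \<and> b \<in> ?Y \<and> ?com a b \<and>
    z + ?vec a \<in> I \<and> z + ?vec b \<in> I \<and> z + ?vec a + ?vec b \<in> I}"
  define R where "R = edge_word ` X \<union> square_word ` S"
  have SX: "(z, a) \<in> X" "(z + ?vec a, b) \<in> X" "(z + ?vec b, a) \<in> X" "(z, b) \<in> X" if "(z, a, b) \<in> S" for z a b
  proof -
    have comm: "z + ?vec b + ?vec a = z + ?vec a + ?vec b" by (simp add: ac_simps)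
    have "z + ?vec b + ?vec a \<in> I" unfolding comm using that by (simp add: S_def)
    then show "(z, a) \<in> X" "(z + ?vec a, b) \<in> X" "(z + ?vec b, a) \<in> X" "(z, b) \<in> X"
      using that unfolding S_def X_def by simp_all
  qed
  have Xbar: "(z + ?vec a, letter_bar a) \<in> X" if "(z, a) \<in> X" for z a
  proof -
    have "z + ?vec a + ?vec (letter_bar a) \<in> I" unfolding vec_bar using that by (simp add: X_def)
    then show ?thesis using that bar_Y[of a] unfolding X_def by simp
  qed
  have finS: "finite S"
    by (rule finite_subset[of _ "I \<times> ?Y \<times> ?Y"]) (use finI finY in \<open>auto simp: S_def\<close>)
  have finR: "finite R" unfolding R_def using finX finS by blast
  have Rw: "R \<subseteq> words X"
  proof
    fix r assume "r \<in> R"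
    then consider z a where "(z, a) \<in> X" "r = edge_word (z, a)"
      | z a b where "(z, a, b) \<in> S" "r = square_word (z, a, b)"
      by (auto simp: R_def)
    then show "r \<in> words X"
    proof cases
      case 1
      then show ?thesis using Xbar[OF 1(1)] by (simp add: edge_word_def)
    next
      case 2
      then show ?thesis using SX[OF 2(1)] by (simp add: square_word_def)
    qed
  qed
  \<comment> \<open>The frames move each edge into the kernel: the positions \<open>z\<close>,
    \<open>vec a\<close> and \<open>- (z + vec a)\<close> cancel.\<close>
  define e0 where "e0 = (\<lambda>(z, a). p0 z \<otimes>\<^bsub>A\<^esub> ?el a \<otimes>\<^bsub>A\<^esub> inv\<^bsub>A\<^esub> p0 (z + ?vec a))"
  have p0c: "p0 z \<in> carrier A" if "z \<in> I" for z using p0 IL that by blast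
  have e0A: "e0 x \<in> carrier A" if "x \<in> X" for x
    using that p0c el_closed by (auto simp: X_def e0_def)
  have e0P: "e0 x \<in> carrier P'" if x: "x \<in> X" for x
  proof -
    obtain z a where za: "x = (z, a)" "z \<in> I" "a \<in> ?Y" "z + ?vec a \<in> I" using x by (auto simp: X_def)
    have "?f (e0 x) = z + ?vec a - (z + ?vec a)"
      using za p0 IL p0c el_closed[OF za(3)] by (simp add: e0_def pos_mult pos_inv pos_letter)
    then show ?thesis using e0A[OF x] by (simp add: P'_def H)
  qed
  have cancel: "inv\<^bsub>A\<^esub> x \<otimes>\<^bsub>A\<^esub> (x \<otimes>\<^bsub>A\<^esub> y) = y" "x \<otimes>\<^bsub>A\<^esub> (inv\<^bsub>A\<^esub> x \<otimes>\<^bsub>A\<^esub> y) = y"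
    if "x \<in> carrier A" "y \<in> carrier A" for x y
    using that by (simp_all flip: A.m_assoc)
  have relA: "word_value A e0 r = \<one>\<^bsub>A\<^esub>" if "r \<in> R" for r
  proof -
    from that consider z a where "(z, a) \<in> X" "r = edge_word (z, a)"
      | z a b where "(z, a, b) \<in> S" "r = square_word (z, a, b)"
      by (auto simp: R_def)
    then show ?thesis
    proof cases
      case 1
      then have za: "z \<in> I" "a \<in> ?Y" "z + ?vec a \<in> I" by (auto simp: X_def)
      show ?thesis
        unfolding 1(2) edge_word_def using p0c[OF za(1)] p0c[OF za(3)] el_closed[OF za(2)]
        by (simp add: e0_def vec_bar el_bar[OF za(2)] A.m_assoc cancel)
    next
      case 2
      then have zab: "z \<in> I" "a \<in> ?Y" "b \<in> ?Y" "?com a b" "z + ?vec a \<in> I" "z + ?vec b \<in> I"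
          "z + ?vec a + ?vec b \<in> I" by (auto simp: S_def)
      have top: "z + ?vec b + ?vec a = z + ?vec a + ?vec b" by (simp add: ac_simps)
      have ab: "?el a \<otimes>\<^bsub>A\<^esub> ?el b = ?el b \<otimes>\<^bsub>A\<^esub> ?el a" by (rule el_comm[OF zab(2-4)])
      have "e0 (z, a) \<otimes>\<^bsub>A\<^esub> e0 (z + ?vec a, b) =
          p0 z \<otimes>\<^bsub>A\<^esub> (?el a \<otimes>\<^bsub>A\<^esub> ?el b) \<otimes>\<^bsub>A\<^esub> inv\<^bsub>A\<^esub> p0 (z + ?vec a + ?vec b)"
        using p0c zab el_closed by (simp add: e0_def A.m_assoc cancel)
      also have "\<dots> = e0 (z, b) \<otimes>\<^bsub>A\<^esub> e0 (z + ?vec b, a)"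
        unfolding ab using p0c zab el_closed by (simp add: e0_def top A.m_assoc cancel)
      finally show ?thesis
        unfolding 2(2) square_word_def
        using A.word_value_square[of e0 "(z, a)" "(z + ?vec a, b)" "(z + ?vec b, a)" "(z, b)"] e0A SX[OF 2(1)]
        by simp
    qed
  qed
  \<comment> \<open>The frames lie outside the kernel, so the labelling is set up over
    \<open>A\<close>; this makes evaluation in the kernel and in \<open>A\<close> agree.\<close>
  have idhom: "id \<in> hom P' A" using subgroup.subset[OF subH] by (auto simp: hom_def P'_def)
  have e0P': "e0 \<in> X \<rightarrow> carrier P'" and e0A': "e0 \<in> X \<rightarrow> carrier A" using e0P e0A by blast+
  have valP: "word_value P' e0 w = word_value A e0 w" if "w \<in> words X" for w
    using hom_word_value[OF P.is_group A.is_group idhom e0P' that] by (simp add: comp_def)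
  have RA: "\<forall>r\<in>R. word_value A e0 r = \<one>\<^bsub>A\<^esub>" using relA by blast
  have RP: "\<forall>r\<in>R. word_value P' e0 r = \<one>\<^bsub>P'\<^esub>"
  proof
    fix r assume r: "r \<in> R"
    then have "r \<in> words X" using Rw by blast
    moreover have "\<one>\<^bsub>P'\<^esub> = \<one>\<^bsub>A\<^esub>" by (simp add: P'_def)
    ultimately show "word_value P' e0 r = \<one>\<^bsub>P'\<^esub>" using valP relA[OF r] by simp
  qed
  let ?Q = "presented_group X R"
  define \<epsilon> where "\<epsilon> = lift_presented A e0"
  interpret lab: labelling ?Q A \<epsilon> ?L rank ?Y ?vec letter_bar ?com ?el fst
  proof (intro labelling.intro labelling_axioms.intro)
    show "group ?Q" by (rule group_presented_group)
    show "group A" by (rule A.is_group)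
    show "\<epsilon> \<in> hom ?Q A" unfolding \<epsilon>_def by (rule A.lift_presented_hom[OF e0A' Rw RA])
    show "inj_on rank ?L" by (rule rank)
    show "z + ?vec a \<in> ?L" if "z \<in> ?L" "a \<in> ?Y" for z a using that by (rule L_add)
    show "letter_bar a \<in> ?Y" if "a \<in> ?Y" for a using that by (rule bar_Y)
    show "letter_bar (letter_bar a) = a" for a by (rule letter_bar(2))
    show "?vec (letter_bar a) = - ?vec a" for a by (rule letter_bar(3))
    show "?el a \<in> carrier A" if "a \<in> ?Y" for a using that by (rule el_closed)
    show "?el (letter_bar a) = inv\<^bsub>A\<^esub> ?el a" if "a \<in> ?Y" for a using that by (rule el_bar)
    show "?com b a" if "?com a b" for a b using that by (rule letter_com_sym)
    show "?com (letter_bar a) b" if "?com a b" for a b using that by (simp add: letter_bar(4))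
    show "?com a b" if "fst a \<noteq> fst b" for a b
      using that by (cases a; cases b) (simp add: letter_com_def)
    show "?el a \<otimes>\<^bsub>A\<^esub> ?el b = ?el b \<otimes>\<^bsub>A\<^esub> ?el a" if "a \<in> ?Y" "b \<in> ?Y" "?com a b" for a b
      using that by (rule el_comm)
    show "?vec a \<noteq> 0" if "a \<in> ?Y" for a using that m(1) by (rule letter_vec_nz)
    show "?vec a \<noteq> ?vec b" if "a \<in> ?Y" "b \<in> ?Y" "?com a b" for a b
      using that card m by (rule letter_com_vec)
  qed
  have I_eq: "lab.initial N = I" by (simp add: lab.initial_def I_def)
  define lam0 where "lam0 z a = gen_class X R (z, a)" for z a
  have lam0: "lam0 z a \<in> carrier ?Q" if "(z, a) \<in> X" for z a
    unfolding lam0_def using gen_class_closed[of X R] that by blast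
  have valid: "lab.valid_on I lam0 p0"
    unfolding lab.valid_on_def
  proof (intro conjI ballI impI)
    show "p0 z \<in> carrier A" if "z \<in> I" for z using p0c that .
    show "lab.edge_ok lam0 p0 z a" if za: "z \<in> I" "a \<in> ?Y" "z + ?vec a \<in> I" for z a
    proof -
      have X: "(z, a) \<in> X" using za by (simp add: X_def)
      have "word_value ?Q (gen_class X R) (edge_word (z, a)) = \<one>\<^bsub>?Q\<^esub>"
        using word_value_relator[OF Rw] X by (simp add: R_def)
      then have "lam0 z a \<otimes>\<^bsub>?Q\<^esub> lam0 (z + ?vec a) (letter_bar a) = \<one>\<^bsub>?Q\<^esub>"
        using lam0[OF Xbar[OF X]] by (simp add: edge_word_def lam0_def)
      then have "inv\<^bsub>?Q\<^esub> (lam0 (z + ?vec a) (letter_bar a)) = lam0 z a"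
        using lam0[OF X] lam0[OF Xbar[OF X]] by (intro lab.Q.inv_equality)
      then have "lam0 (z + ?vec a) (letter_bar a) = inv\<^bsub>?Q\<^esub> lam0 z a"
        using lab.Q.inv_inv[OF lam0[OF Xbar[OF X]]] by simp
      moreover have "\<epsilon> (lam0 z a) = e0 (z, a)"
        unfolding \<epsilon>_def lam0_def by (rule lift_presented_gen[OF A.is_group e0A' Rw RA X])
      ultimately show ?thesis using lam0[OF X] by (simp add: lab.edge_ok_def e0_def)
    qed
    show "lab.commuting_square lam0 z a b"
      if zab: "z \<in> I" "a \<in> ?Y" "b \<in> ?Y"
        "?com a b \<and> z + ?vec a \<in> I \<and> z + ?vec b \<in> I \<and> z + ?vec a + ?vec b \<in> I" for z a b
    proof -
      have S: "(z, a, b) \<in> S" using zab by (simp add: S_def)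
      have "word_value ?Q (gen_class X R) (square_word (z, a, b)) = \<one>\<^bsub>?Q\<^esub>"
        using word_value_relator[OF Rw] S by (simp add: R_def)
      then show ?thesis
        unfolding square_word_def lab.commuting_square_def lam0_def
        using lab.Q.word_value_square[of "gen_class X R" "(z, a)" "(z + ?vec a, b)" "(z + ?vec b, a)" "(z, b)"]
          lam0 SX[OF S] by (simp add: lam0_def)
    qed
  qed
  obtain lam p where lam: "lab.valid_on ?L lam p" and p: "\<forall>z\<in>lab.initial N. p z = p0 z"
    using lab.extend_valid_everywhere[OF valid[folded I_eq] good] by blast
  have zeroL: "0 \<in> ?L" by (simp add: lattice_points_def)
  have p_zero: "p 0 = \<one>\<^bsub>A\<^esub>"
    using p p0 zeroL N by (simp add: lab.initial_def)
  have pL: "p z \<in> carrier A" if "z \<in> ?L" for z using lam that by (simp add: lab.valid_on_def)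
  have lamE: "lab.edge_ok lam p z a" if "z \<in> ?L" "a \<in> ?Y" for z a
    by (rule lam[unfolded lab.valid_on_def, THEN conjunct2, THEN conjunct1, rule_format, OF that L_add[OF that]])
  have lamS: "lab.commuting_square lam z a b" if "z \<in> ?L" "a \<in> ?Y" "b \<in> ?Y" "?com a b" for z a b
    by (rule lam[unfolded lab.valid_on_def, THEN conjunct2, THEN conjunct2, rule_format, OF that(1-3)],
      intro conjI that(4) L_add that(1-3))
  have lamQ: "lam z a \<in> carrier ?Q" if "z \<in> ?L" "a \<in> ?Y" for z a
    using lamE[OF that] by (simp add: lab.edge_ok_def)
  let ?W = "shift_wreath ?Q :: ((('v \<Rightarrow> int) \<Rightarrow> _) \<times> ('v \<Rightarrow> int)) monoid"
  interpret W: group ?W by (rule group_shift_wreath[OF group_presented_group])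
  \<comment> \<open>Starting points range over a whole function type; off the lattice the neutral
    label keeps all relations valid.\<close>
  define w where "w a = (\<lambda>z. if z \<in> ?L then lam z a else \<one>\<^bsub>?Q\<^esub>, ?vec a)" for a
  have wW: "w a \<in> carrier ?W" if "a \<in> ?Y" for a using lamQ that by (simp add: w_def)
  have L_iff: "z + ?vec a \<in> ?L \<longleftrightarrow> z \<in> ?L" if "a \<in> ?Y" for z a
    using L_add[OF _ that, of z] L_add[OF _ bar_Y[OF that], of "z + ?vec a"] vec_bar[of z a] by auto
  have w_bar: "w (letter_bar a) = inv\<^bsub>?W\<^esub> w a" if a: "a \<in> ?Y" for a
  proof -
    have "w a \<otimes>\<^bsub>?W\<^esub> w (letter_bar a) = \<one>\<^bsub>?W\<^esub>"
    proof -
      have "lam z a \<otimes>\<^bsub>?Q\<^esub> lam (z + ?vec a) (letter_bar a) = \<one>\<^bsub>?Q\<^esub>" if "z \<in> ?L" for z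
        using lamE[OF that a] by (simp add: lab.edge_ok_def)
      then show ?thesis using L_iff[OF a] by (auto simp: w_def letter_bar(3) fun_eq_iff)
    qed
    then have "inv\<^bsub>?W\<^esub> w (letter_bar a) = w a"
      using wW[OF a] wW[OF bar_Y[OF a]] by (intro W.inv_equality)
    then show ?thesis using W.inv_inv[OF wW[OF bar_Y[OF a]]] by simp
  qed
  have w_comm: "w a \<otimes>\<^bsub>?W\<^esub> w b = w b \<otimes>\<^bsub>?W\<^esub> w a" if "a \<in> ?Y" "b \<in> ?Y" "?com a b" for a b
    using lamS[OF _ that] L_iff[OF that(1)] L_iff[OF that(2)]
    by (auto simp: w_def lab.commuting_square_def add.commute fun_eq_iff)
  have "\<exists>\<phi>. \<phi> \<in> hom ?G ?W \<and> (\<forall>v\<in>?V. \<phi> (raag_gen K v) = w (s, v, True))" for s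
  proof -
    have c: "w (s, v, True) \<in> carrier ?W" if "v \<in> ?V" for v using that by (intro wW) simp
    have "w (s, u, True) \<otimes>\<^bsub>?W\<^esub> w (s, v, True) = w (s, v, True) \<otimes>\<^bsub>?W\<^esub> w (s, u, True)"
      if "u \<noteq> v" "{u, v} \<in> K" for u v
      using that edge_vertices[OF K that(2)] by (intro w_comm) (simp_all add: letter_com_def)
    from raag_universal[where f = "\<lambda>v. w (s, v, True)", OF K W.is_group c this]
    obtain \<phi> where "\<phi> \<in> hom ?G ?W" "\<And>v. v \<in> ?V \<Longrightarrow> \<phi> (raag_gen K v) = w (s, v, True)"
      by blast
    then show ?thesis by blast
  qed
  then have "\<forall>s. \<exists>\<phi>. \<phi> \<in> hom ?G ?W \<and> (\<forall>v\<in>?V. \<phi> (raag_gen K v) = w (s, v, True))" by blast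
  from choice[OF this] obtain \<phi> where \<phi>: "\<And>s. \<phi> s \<in> hom ?G ?W"
      "\<And>s v. v \<in> ?V \<Longrightarrow> \<phi> s (raag_gen K v) = w (s, v, True)" by blast
  have \<phi>W: "\<phi> s g \<in> carrier ?W" if "g \<in> carrier ?G" for s g using \<phi>(1)[of s] that by (auto simp: hom_def)
  have \<phi>_comm: "\<phi> True g \<otimes>\<^bsub>?W\<^esub> \<phi> False h = \<phi> False h \<otimes>\<^bsub>?W\<^esub> \<phi> True g"
    if gh: "g \<in> carrier ?G" "h \<in> carrier ?G" for g h
  proof (rule raag_hom_commutes[OF W.is_group \<phi>(1) \<phi>W[OF gh(1)] _ gh(2)])
    fix v assume v: "v \<in> ?V"
    have "\<phi> False (raag_gen K v) \<otimes>\<^bsub>?W\<^esub> \<phi> True g = \<phi> True g \<otimes>\<^bsub>?W\<^esub> \<phi> False (raag_gen K v)"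
    proof (rule raag_hom_commutes[OF W.is_group \<phi>(1) \<phi>W[OF raag_gen_closed[OF v]] _ gh(1)])
      fix u assume u: "u \<in> ?V"
      show "\<phi> False (raag_gen K v) \<otimes>\<^bsub>?W\<^esub> \<phi> True (raag_gen K u) =
          \<phi> True (raag_gen K u) \<otimes>\<^bsub>?W\<^esub> \<phi> False (raag_gen K v)"
        unfolding \<phi>(2)[OF u] \<phi>(2)[OF v] by (rule w_comm) (use u v in \<open>simp_all add: letter_com_def\<close>)
    qed
    then show "\<phi> True g \<otimes>\<^bsub>?W\<^esub> \<phi> False (raag_gen K v) = \<phi> False (raag_gen K v) \<otimes>\<^bsub>?W\<^esub> \<phi> True g" by simp
  qed
  define \<Theta> where "\<Theta> = (\<lambda>(g, h). \<phi> True g \<otimes>\<^bsub>?W\<^esub> \<phi> False h)"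
  have \<Theta>hom: "\<Theta> \<in> hom A ?W"
    unfolding \<Theta>_def A_def by (rule group_hom_commuting_product[OF W.is_group G.is_group \<phi>(1) \<phi>(1) \<phi>_comm])
  \<comment> \<open>\<open>F\<close> lies over \<open>x\<close>: its displacement is the position of
    \<open>x\<close>, and each label maps to \<open>x\<close> as seen in the frames at the two
    ends.\<close>
  define tracks where "tracks F x \<longleftrightarrow> snd F = ?f x \<and>
      (\<forall>z\<in>?L. \<epsilon> (fst F z) = p z \<otimes>\<^bsub>A\<^esub> x \<otimes>\<^bsub>A\<^esub> inv\<^bsub>A\<^esub> p (z + ?f x))" for F x
  have tracks_w: "tracks (w a) (?el a)" if "a \<in> ?Y" for a
    using lamE[OF _ that] by (simp add: tracks_def w_def pos_letter[OF that] lab.edge_ok_def)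
  have tracks_mult: "tracks (F \<otimes>\<^bsub>?W\<^esub> F') (x \<otimes>\<^bsub>A\<^esub> x')"
    if t: "tracks F x" "tracks F' x'" and F: "F \<in> carrier ?W" "F' \<in> carrier ?W"
      and x: "x \<in> carrier A" "x' \<in> carrier A" for F F' x x'
  proof -
    obtain B a B' a' where FB: "F = (B, a)" "F' = (B', a')" by (cases F; cases F')
    have fL: "?f x \<in> ?L" by (rule position_lattice[OF K x(1)[unfolded A_def]])
    have f: "?f (x \<otimes>\<^bsub>A\<^esub> x') = ?f x + ?f x'" using pos_mult[OF x] .
    have "\<epsilon> (B z \<otimes>\<^bsub>?Q\<^esub> B' (z + a)) =
        p z \<otimes>\<^bsub>A\<^esub> (x \<otimes>\<^bsub>A\<^esub> x') \<otimes>\<^bsub>A\<^esub> inv\<^bsub>A\<^esub> p (z + (?f x + ?f x'))" if z: "z \<in> ?L" for z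
    proof -
      have a: "a = ?f x" using t(1) FB by (simp add: tracks_def)
      have fL': "?f x' \<in> ?L" by (rule position_lattice[OF K x(2)[unfolded A_def]])
      have zL: "z + ?f x \<in> ?L" "z + ?f x + ?f x' \<in> ?L"
        by (intro lattice_points_add z fL fL')+
      have "\<epsilon> (B z \<otimes>\<^bsub>?Q\<^esub> B' (z + a)) = \<epsilon> (B z) \<otimes>\<^bsub>A\<^esub> \<epsilon> (B' (z + a))"
        using F FB by (intro hom_mult[OF lab.eps_hom]) simp_all
      also have "\<dots> = p z \<otimes>\<^bsub>A\<^esub> x \<otimes>\<^bsub>A\<^esub> inv\<^bsub>A\<^esub> p (z + ?f x) \<otimes>\<^bsub>A\<^esub>
          (p (z + ?f x) \<otimes>\<^bsub>A\<^esub> x' \<otimes>\<^bsub>A\<^esub> inv\<^bsub>A\<^esub> p (z + ?f x + ?f x'))"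
        using t FB z zL a by (simp add: tracks_def)
      also have "\<dots> = p z \<otimes>\<^bsub>A\<^esub> (x \<otimes>\<^bsub>A\<^esub> x') \<otimes>\<^bsub>A\<^esub> inv\<^bsub>A\<^esub> p (z + ?f x + ?f x')"
        using pL[OF z] pL[OF zL(1)] pL[OF zL(2)] x by (simp add: A.m_assoc cancel)
      finally show ?thesis by (simp add: add.assoc)
    qed
    then show ?thesis using t by (simp add: tracks_def FB f)
  qed
  have tracks_one: "tracks \<one>\<^bsub>?W\<^esub> \<one>\<^bsub>A\<^esub>"
    using position_one[where m = m, OF K] pL hom_one[OF lab.eps_hom lab.Q.is_group A.is_group]
    by (simp add: tracks_def A_def[symmetric])
  have tracks_\<phi>: "tracks (\<phi> s g) (factor_embed K s g)" if "g \<in> carrier ?G" for s g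
    using that
  proof (induction rule: raag_induct)
    case one
    have "factor_embed K s \<one>\<^bsub>?G\<^esub> = \<one>\<^bsub>A\<^esub>" by (simp add: factor_embed_def A_def)
    then show ?case using tracks_one hom_one[OF \<phi>(1) G.is_group W.is_group] by simp
  next
    case (gen v g)
    have l: "(s, v, True) \<in> ?Y" using gen by simp
    have "tracks (w (s, v, True) \<otimes>\<^bsub>?W\<^esub> \<phi> s g) (?el (s, v, True) \<otimes>\<^bsub>A\<^esub> factor_embed K s g)"
      by (rule tracks_mult[OF tracks_w[OF l] gen.IH wW[OF l] \<phi>W[OF gen(2)] el_closed[OF l]
            factor_embed_closed[OF gen(2), folded A_def]])
    moreover have "\<phi> s (raag_gen K v \<otimes>\<^bsub>?G\<^esub> g) = w (s, v, True) \<otimes>\<^bsub>?W\<^esub> \<phi> s g"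
      using hom_mult[OF \<phi>(1) raag_gen_closed[OF gen(1)] gen(2)] \<phi>(2)[OF gen(1)] by simp
    moreover have "factor_embed K s (raag_gen K v \<otimes>\<^bsub>?G\<^esub> g) = ?el (s, v, True) \<otimes>\<^bsub>A\<^esub> factor_embed K s g"
      using factor_embed_mult[OF raag_gen_closed[OF gen(1)] gen(2)] by (simp add: letter_elem_def A_def)
    ultimately show ?case by simp
  next
    case (inv v g)
    have l: "(s, v, False) \<in> ?Y" "(s, v, True) \<in> ?Y" using inv by simp_all
    have "tracks (w (s, v, False) \<otimes>\<^bsub>?W\<^esub> \<phi> s g) (?el (s, v, False) \<otimes>\<^bsub>A\<^esub> factor_embed K s g)"
      by (rule tracks_mult[OF tracks_w[OF l(1)] inv.IH wW[OF l(1)] \<phi>W[OF inv(2)] el_closed[OF l(1)]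
            factor_embed_closed[OF inv(2), folded A_def]])
    moreover have "\<phi> s (inv\<^bsub>?G\<^esub> raag_gen K v \<otimes>\<^bsub>?G\<^esub> g) = w (s, v, False) \<otimes>\<^bsub>?W\<^esub> \<phi> s g"
    proof -
      have "\<phi> s (inv\<^bsub>?G\<^esub> raag_gen K v) = inv\<^bsub>?W\<^esub> \<phi> s (raag_gen K v)"
        using group_hom.hom_inv[of ?G ?W "\<phi> s"] \<phi>(1) inv(1) G.is_group W.is_group
        by (simp add: group_hom_def group_hom_axioms_def)
      also have "\<dots> = w (s, v, False)"
        using w_bar[OF l(2)] \<phi>(2)[OF inv(1)] by (simp add: letter_bar_def)
      finally show ?thesis
        using hom_mult[OF \<phi>(1) G.inv_closed[OF raag_gen_closed[OF inv(1)]] inv(2)] by simp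
    qed
    moreover have "factor_embed K s (inv\<^bsub>?G\<^esub> raag_gen K v \<otimes>\<^bsub>?G\<^esub> g) = ?el (s, v, False) \<otimes>\<^bsub>A\<^esub> factor_embed K s g"
      using factor_embed_mult[OF G.inv_closed[OF raag_gen_closed[OF inv(1)]] inv(2)]
      by (simp add: letter_elem_def A_def)
    ultimately show ?case by simp
  qed
  have tracks_\<Theta>: "tracks (\<Theta> x) x" if xA: "x \<in> carrier A" for x
  proof -
    obtain g h where x: "x = (g, h)" "g \<in> carrier ?G" "h \<in> carrier ?G"
      using xA by (cases x) (simp add: A_def)
    have "tracks (\<phi> True g \<otimes>\<^bsub>?W\<^esub> \<phi> False h) (factor_embed K True g \<otimes>\<^bsub>A\<^esub> factor_embed K False h)"
      by (rule tracks_mult[OF tracks_\<phi>[OF x(2)] tracks_\<phi>[OF x(3)] \<phi>W[OF x(2)] \<phi>W[OF x(3)]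
            factor_embed_closed[OF x(2), folded A_def] factor_embed_closed[OF x(3), folded A_def]])
    moreover have "factor_embed K True g \<otimes>\<^bsub>A\<^esub> factor_embed K False h = x"
      using x by (simp add: factor_embed_def A_def)
    ultimately show ?thesis by (simp add: \<Theta>_def x)
  qed
  \<comment> \<open>For elements of the kernel the displacement is zero, so in a product the second
    factor is again read from the origin, and \<Lambda> is multiplicative.\<close>
  define \<Lambda> where "\<Lambda> x = fst (\<Theta> x) 0" for x
  have \<Theta>W: "\<Theta> x \<in> carrier ?W" if "x \<in> carrier A" for x using \<Theta>hom that by (auto simp: hom_def)
  have HA: "x \<in> carrier A" "?f x = 0" if "x \<in> carrier P'" for x using that by (auto simp: P'_def H)
  have \<Lambda>hom: "\<Lambda> \<in> hom P' ?Q"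
  proof (rule homI)
    show "\<Lambda> x \<in> carrier ?Q" if "x \<in> carrier P'" for x
      using \<Theta>W[OF HA(1)[OF that]] by (cases "\<Theta> x") (simp add: \<Lambda>_def)
    fix x y assume xy: "x \<in> carrier P'" "y \<in> carrier P'"
    have "\<Theta> (x \<otimes>\<^bsub>A\<^esub> y) = \<Theta> x \<otimes>\<^bsub>?W\<^esub> \<Theta> y" using hom_mult[OF \<Theta>hom] HA xy by blast
    moreover have "snd (\<Theta> x) = 0" using tracks_\<Theta>[OF HA(1)[OF xy(1)]] HA(2)[OF xy(1)] by (simp add: tracks_def)
    ultimately show "\<Lambda> (x \<otimes>\<^bsub>P'\<^esub> y) = \<Lambda> x \<otimes>\<^bsub>?Q\<^esub> \<Lambda> y"
      by (cases "\<Theta> x"; cases "\<Theta> y") (simp add: \<Lambda>_def P'_def)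
  qed
  have "finitely_presented P'"
  proof (rule finitely_presented_retract[OF P.is_group finX finR Rw e0P' RP \<Lambda>hom])
    fix x assume x: "x \<in> carrier P'"
    have "\<Lambda> x \<in> carrier ?Q" using \<Lambda>hom x by (auto simp: hom_def)
    then obtain u where u: "u \<in> words X" "\<Lambda> x = word_value ?Q (gen_class X R) u"
      by (rule carrier_presented_group_word_value)
    have "lift_presented P' e0 (\<Lambda> x) = \<epsilon> (\<Lambda> x)"
      unfolding \<epsilon>_def u(2) lift_presented_word_value[OF P.is_group e0P' Rw RP u(1)]
        lift_presented_word_value[OF A.is_group e0A' Rw RA u(1)] by (rule valP[OF u(1)])
    also have "\<dots> = p 0 \<otimes>\<^bsub>A\<^esub> x \<otimes>\<^bsub>A\<^esub> inv\<^bsub>A\<^esub> p (0 + ?f x)"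
      using tracks_\<Theta>[OF HA(1)[OF x]] zeroL unfolding tracks_def \<Lambda>_def by blast
    also have "\<dots> = x" using HA[OF x] by (simp add: p_zero)
    finally show "lift_presented P' e0 (\<Lambda> x) = x" .
  qed
  then show ?thesis by (simp add: P'_def A_def)
qed

theorem connected_fibre_product_finitely_presented:
  assumes K: "simplicial_complex K" and fin: "finite (vertices K)" and card: "card (vertices K) \<ge> 2"
    and conn: "\<And>Z. \<lbrakk>Z \<subseteq> vertices K; 2 * card Z < card (vertices K)\<rbrakk> \<Longrightarrow>
      complex_connected (remove_vertices K Z)"
  shows "\<exists>\<mu>\<in>iso (abelianisation (raag K)) (abelianisation (raag K)).
    finitely_presented (fibre_product (raag K) \<mu>)"
proof -
  let ?V = "vertices K"
  obtain m' m :: "'a \<Rightarrow> 'a \<Rightarrow> int" where *: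
    "(\<forall>v\<in>?V. \<forall>w\<in>?V. (\<Sum>u\<in>?V. m' v u * m u w) = (if v = w then 1 else 0)) \<and>
    (\<forall>v\<in>?V. \<forall>w\<in>?V. (\<Sum>u\<in>?V. m v u * m' u w) = (if v = w then 1 else 0)) \<and>
    (\<forall>x :: 'a \<Rightarrow> real. (\<exists>v\<in>?V. x v \<noteq> 0) \<longrightarrow>
       card {v \<in> ?V. x v = 0} + card {w \<in> ?V. (\<Sum>u\<in>?V. x u * of_int (m u w)) = 0} < card ?V) \<and>
    (\<forall>v\<in>?V. \<forall>w\<in>?V. m v w > 0) \<and>
    (\<forall>v\<in>?V. \<forall>w\<in>?V. v \<noteq> w \<longrightarrow> (\<exists>u\<in>?V. m u v \<noteq> m u w))"
    using unimodular_general_position[OF fin] by (elim exE)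
  note inv = *[THEN conjunct1, rule_format] *[THEN conjunct2, THEN conjunct1, rule_format]
  note * = *[THEN conjunct2, THEN conjunct2]
  note gp = *[THEN conjunct1, rule_format]
    and pos = *[THEN conjunct2, THEN conjunct1, rule_format]
    and ne = *[THEN conjunct2, THEN conjunct2, rule_format]
  have V_ne: "?V \<noteq> {}" using card by auto
  have "\<exists>C>0. \<forall>x :: 'a \<Rightarrow> real. card {v \<in> ?V. C * \<bar>x v\<bar> < (\<Sum>u\<in>?V. \<bar>x u\<bar>)} +
      card {w \<in> ?V. C * \<bar>\<Sum>u\<in>?V. x u * of_int (m u w)\<bar> < (\<Sum>u\<in>?V. \<bar>x u\<bar>)} < card ?V"
    by (rule general_position_bound[where m = m, OF fin V_ne]) (rule gp)
  then obtain C where C: "C > 0 \<and>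
    (\<forall>x :: 'a \<Rightarrow> real. card {v \<in> ?V. C * \<bar>x v\<bar> < (\<Sum>u\<in>?V. \<bar>x u\<bar>)} +
      card {w \<in> ?V. C * \<bar>\<Sum>u\<in>?V. x u * of_int (m u w)\<bar> < (\<Sum>u\<in>?V. \<bar>x u\<bar>)} < card ?V)"
    by (elim exE)
  obtain rank :: "('a \<Rightarrow> int) \<Rightarrow> nat" where rank: "inj_on rank (lattice_points ?V)"
    "\<forall>z\<in>lattice_points ?V. \<forall>z'\<in>lattice_points ?V. dot ?V z z < dot ?V z' z' \<longrightarrow> rank z < rank z'"
    by (rule lattice_rank[OF fin])
  obtain k0 :: nat where k0: "\<forall>z\<in>lattice_points ?V. rank z \<ge> k0 \<longrightarrow>
    good_point rank (letters ?V) (letter_vec ?V m) (letter_com K) fst z"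
  proof (rule connected_imp_good_point[OF K refl fin])
    show "complex_connected (remove_vertices K Z)" if "Z \<subseteq> ?V" "2 * card Z < card ?V" for Z
      by (rule conn[OF that])
  qed (rule C[THEN conjunct1] C[THEN conjunct2, rule_format] rank(2)[rule_format]; assumption)+
  obtain \<mu> where \<mu>: "\<mu> \<in> iso (abelianisation (raag K)) (abelianisation (raag K))"
    "carrier (fibre_product (raag K) \<mu>) = {(g, h). g \<in> carrier (raag K) \<and> h \<in> carrier (raag K) \<and>
       exponents K h = matrix_map ?V m (exponents K g)}"
    by (rule matrix_automorphism[OF K fin inv])
  have "finitely_presented ((raag K \<times>\<times> raag K)\<lparr>carrier := carrier (fibre_product (raag K) \<mu>)\<rparr>)"
  \<comment> \<open>The maximum places the origin inside the ball, where the extended frames agree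
    with \<open>p0\<close>.\<close>
  proof (rule position_kernel_finitely_presented[OF K fin card pos ne rank(1), where N = "max k0 (Suc (rank 0))"])
    show "good_point rank (letters ?V) (letter_vec ?V m) (letter_com K) fst z"
      if "z \<in> lattice_points ?V" "rank z \<ge> max k0 (Suc (rank 0))" for z
      using k0 that by simp
    show "rank 0 < max k0 (Suc (rank 0))" by simp
    show "subgroup (carrier (fibre_product (raag K) \<mu>)) (raag K \<times>\<times> raag K)"
      by (rule subgroup_fibre_product[OF group_raag \<mu>(1)])
    show "carrier (fibre_product (raag K) \<mu>) =
        {x \<in> carrier (raag K \<times>\<times> raag K). position K m x = 0}"
      unfolding \<mu>(2) by (auto simp: position_def)
  qed
  then have "finitely_presented (fibre_product (raag K) \<mu>)"
    by (simp add: fibre_product_def)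
  with \<mu>(1) show ?thesis by blast
qed

section \<open>Minimal separators and the conclusion\<close>

lemma minimal_separator_subset:
  assumes "finite Z" "Z \<subseteq> vertices K" "\<not> complex_connected (remove_vertices K Z)"
  shows "\<exists>S\<in>minimal_separators K. S \<subseteq> Z"
  using assms
proof (induction Z rule: finite_psubset_induct)
  case (psubset Z)
  show ?case
  proof (cases "\<forall>T. T \<subset> Z \<longrightarrow> complex_connected (remove_vertices K T)")
    case True
    then have "Z \<in> minimal_separators K" using psubset.prems by (simp add: minimal_separators_def)
    then show ?thesis by blast
  next
    case False
    then obtain T where T: "T \<subset> Z" "\<not> complex_connected (remove_vertices K T)" by blast
    then show ?thesis using psubset.IH[OF T(1)] psubset.prems(1) by blast
  qed
qed

theorem corollary5p4:
  fixes \<Delta> :: "'v set set"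
  assumes "finite \<Delta>" and "flag_complex \<Delta>"
  shows "(finitely_presented (fibre_product (raag \<Delta>) id) \<longleftrightarrow> comm_group (raag \<Delta>)) \<and>
    ((\<exists>\<mu> \<in> iso (abelianisation (raag \<Delta>)) (abelianisation (raag \<Delta>)).
        finitely_presented (fibre_product (raag \<Delta>) \<mu>)) \<longleftrightarrow>
     (\<forall>S \<in> minimal_separators \<Delta>. card (vertices \<Delta>) \<le> 2 * card S))"
proof (intro conjI iffI)
  have K: "simplicial_complex \<Delta>" using assms(2) by (simp add: flag_complex_def)
  have fin: "finite (vertices \<Delta>)"
    using finite_imageD[of "\<lambda>v. {v}" "vertices \<Delta>"] finite_subset[OF _ assms(1), of "(\<lambda>v. {v}) ` vertices \<Delta>"]
    by (auto simp: vertices_def inj_on_def)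
  show "comm_group (raag \<Delta>)" if "finitely_presented (fibre_product (raag \<Delta>) id)"
    using untwisted_fibre_product_not_finitely_presented[OF K fin] that by blast
  show abelian: "finitely_presented (fibre_product (raag \<Delta>) id)" if "comm_group (raag \<Delta>)"
    by (rule abelian_fibre_product_finitely_presented[OF K fin that])
  show "\<forall>S \<in> minimal_separators \<Delta>. card (vertices \<Delta>) \<le> 2 * card S"
    if "\<exists>\<mu> \<in> iso (abelianisation (raag \<Delta>)) (abelianisation (raag \<Delta>)).
      finitely_presented (fibre_product (raag \<Delta>) \<mu>)"
  proof
    fix S assume "S \<in> minimal_separators \<Delta>"
    then have "S \<subseteq> vertices \<Delta>" "\<not> complex_connected (remove_vertices \<Delta> S)"
      by (auto simp: minimal_separators_def)
    then show "card (vertices \<Delta>) \<le> 2 * card S"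
      using small_separator_fibre_product_not_finitely_presented[OF K fin] that by (meson not_le)
  qed
  show "\<exists>\<mu> \<in> iso (abelianisation (raag \<Delta>)) (abelianisation (raag \<Delta>)).
      finitely_presented (fibre_product (raag \<Delta>) \<mu>)"
    if sep: "\<forall>S \<in> minimal_separators \<Delta>. card (vertices \<Delta>) \<le> 2 * card S"
  proof (cases "comm_group (raag \<Delta>)")
    case True
    then show ?thesis using abelian iso_id by blast
  next
    \<comment> \<open>The lattice construction assumes at least two vertices, and a nonadjacent pair
      supplies them.\<close>
    case False
    obtain u v where uv: "u \<in> vertices \<Delta>" "v \<in> vertices \<Delta>" "u \<noteq> v"
      by (rule raag_not_comm_group[OF K False])
    have "card {u, v} \<le> card (vertices \<Delta>)" by (rule card_mono[OF fin]) (use uv in blast)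
    then have card: "card (vertices \<Delta>) \<ge> 2" using uv(3) by simp
    show ?thesis
    proof (rule connected_fibre_product_finitely_presented[OF K fin card], rule ccontr)
      fix Z assume Z: "Z \<subseteq> vertices \<Delta>" "2 * card Z < card (vertices \<Delta>)"
        "\<not> complex_connected (remove_vertices \<Delta> Z)"
      have finZ: "finite Z" using Z(1) fin by (rule finite_subset)
      obtain S where S: "S \<in> minimal_separators \<Delta>" "S \<subseteq> Z"
        using minimal_separator_subset[OF finZ Z(1,3)] by blast
      have "card S \<le> card Z" by (rule card_mono[OF finZ S(2)])
      then show False using sep S(1) Z(2) by fastforce
    qed
  qed
qed

end
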